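(* Let $\mathbb{M}$ be a graded group with Lie algebra $\mathcal{M}=W_1\oplus\cdots\oplus W_\upsilon$ and a fixed norm $\|\cdot\|$. There is a nondecreasing function $\Upsilon:[0,+\infty)\to[0,+\infty)$ depending only on $\mathcal{M}$ with the following property. If $\Gamma:[a,b]\to\mathbb{M}$ is a horizontal curve and $\gamma=\exp^{-1}\circ\Gamma$, $\gamma_1=\pi_1\circ\gamma$, then for every approximate continuity point $t$ of $\dot\gamma_1$ and every $h\ne0$ with $t+h\in[a,b]$, $$\Big\|\delta_{1/h}\Big(-h\,\dot\gamma_1(t)\circledcirc(-\gamma(t))\circledcirc\gamma(t+h)\Big)\Big\|\le\Upsilon(L_t)\,\mathcal{A}^h_t\big(\dot\gamma_1-\dot\gamma_1(t)\big),$$ where $L_t=\max\{\mathcal{A}^{b-t}_t(\dot\gamma_1),\mathcal{A}^{a-t}_t(\dot\gamma_1)\}$. In particular $\Gamma$ is P-differentiable at a.e. $t\in[a,b]$.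
   Context: Graded group: connected simply connected real Lie group with Lie algebra $W_1\oplus\cdots\oplus W_\upsilon$, $[W_i,W_j]\subset W_{i+j}$; $\exp$ is a global diffeomorphism. $\pi_i$ projects onto $W_i$. For $s\ne0$, $\delta_s$ is the linear map acting as multiplication by $s^i$ on $W_i$. $X\circledcirc Y=\exp^{-1}(\exp X\exp Y)$ (Baker–Campbell–Hausdorff product). Horizontal subspace $H_x\mathbb{M}=\{U(x):U\in W_1\}$ (left invariant fields). $\Gamma$ is horizontal if $\gamma$ is absolutely continuous and $\dot\Gamma(t)\in H_{\Gamma(t)}\mathbb{M}$ for a.e. $t$. Sup-average of a locally summable $g$: $\mathcal{A}^\lambda_t(g)=\sup_{0\le\tau\le\lambda}\frac1\tau\int_t^{t+\tau}\|g\|$ if $\lambda>0$ and $\sup_{\lambda\le\tau\le0}\frac1{|\tau|}\int_{t+\tau}^t\|g\|$ if $\lambda<0$ (possibly $+\infty$). P-differentiability of $\Gamma$ at $t$ (with $\mathbb{R}$ graded by one layer, dilations $s\mapsto rs$): there is an h-homomorphism $L:\mathbb{R}\to\mathbb{M}$ with $\rho(\Gamma(t)^{-1}\Gamma(t+h),L(h))/|h|\to0$ as $h\to0$, $\rho$ a homogeneous (continuous, left invariant, dilation 1-homogeneous) distance. *)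

theory Defs
  imports "HOL-Analysis.Analysis"
begin

text \<open>The graded group M is identified with its Lie algebra (type 'a, a finite dimensional
real vector space) through the global diffeomorphism exp; the group law becomes the
Baker-Campbell-Hausdorff product, written out via Dynkin's formula below.
B is the Lie bracket, W i the layers W_1, ..., W_v (v = ups).\<close>

definition graded_lie_algebra ::
  "('a::euclidean_space \<Rightarrow> 'a \<Rightarrow> 'a) \<Rightarrow> (nat \<Rightarrow> 'a set) \<Rightarrow> nat \<Rightarrow> bool" where
  "graded_lie_algebra B W ups \<longleftrightarrow>
     bilinear B \<and>
     (\<forall>x. B x x = 0) \<and>
     (\<forall>x y z. B x (B y z) + B y (B z x) + B z (B x y) = 0) \<and>
     (\<forall>i\<in>{1..ups}. subspace (W i)) \<and>
     (\<forall>x. \<exists>!c. (\<forall>i. i \<notin> {1..ups} \<longrightarrow> c i = 0) \<and> (\<forall>i\<in>{1..ups}. c i \<in> W i) \<and>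
              x = (\<Sum>i=1..ups. c i)) \<and>
     (\<forall>i\<in>{1..ups}. \<forall>j\<in>{1..ups}. \<forall>x\<in>W i. \<forall>y\<in>W j.
        B x y \<in> (if i + j \<le> ups then W (i + j) else {0}))"

definition proj :: "(nat \<Rightarrow> 'a::euclidean_space set) \<Rightarrow> nat \<Rightarrow> nat \<Rightarrow> 'a \<Rightarrow> 'a" where
  "proj W ups i x = (THE c. (\<forall>i. i \<notin> {1..ups} \<longrightarrow> c i = 0) \<and> (\<forall>i\<in>{1..ups}. c i \<in> W i) \<and>
              x = (\<Sum>i=1..ups. c i)) i"

definition dil :: "(nat \<Rightarrow> 'a::euclidean_space set) \<Rightarrow> nat \<Rightarrow> real \<Rightarrow> 'a \<Rightarrow> 'a" where
  "dil W ups s x = (\<Sum>i=1..ups. (s ^ i) *\<^sub>R proj W ups i x)"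

fun rbr :: "('a \<Rightarrow> 'a \<Rightarrow> 'a) \<Rightarrow> 'a::zero list \<Rightarrow> 'a" where
  "rbr B [] = 0"
| "rbr B [x] = x"
| "rbr B (x # y # zs) = B x (rbr B (y # zs))"

definition dyn_word :: "'a \<Rightarrow> 'a \<Rightarrow> (nat \<times> nat) list \<Rightarrow> 'a list" where
  "dyn_word X Y rs = concat (map (\<lambda>(r, s). replicate r X @ replicate s Y) rs)"

definition dyn_idx :: "nat \<Rightarrow> nat \<Rightarrow> (nat \<times> nat) list set" where
  "dyn_idx N n = {rs. length rs = n \<and> (\<forall>p\<in>set rs. 0 < fst p + snd p \<and> fst p \<le> N \<and> snd p \<le> N)}"

text \<open>Baker-Campbell-Hausdorff product X (circledcirc) Y = log(exp X exp Y) by Dynkin's formula.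
Since brackets of length > ups vanish in a graded Lie algebra of step ups, the series
is exactly the finite sum over n \<le> ups and r_i, s_i \<le> ups.\<close>
definition bch :: "('a::euclidean_space \<Rightarrow> 'a \<Rightarrow> 'a) \<Rightarrow> nat \<Rightarrow> 'a \<Rightarrow> 'a \<Rightarrow> 'a" where
  "bch B ups X Y =
     (\<Sum>n=1..ups. ((-1) ^ (n - 1) / real n) *\<^sub>R
        (\<Sum>rs\<in>dyn_idx ups n.
           (1 / (real (\<Sum>p\<leftarrow>rs. fst p + snd p) *
                 (\<Prod>p\<leftarrow>rs. fact (fst p) * fact (snd p)))) *\<^sub>R
           rbr B (dyn_word X Y rs)))"

definition is_norm :: "('a::real_vector \<Rightarrow> real) \<Rightarrow> bool" where
  "is_norm N \<longleftrightarrow> (\<forall>x. N x = 0 \<longleftrightarrow> x = 0) \<and> (\<forall>x y. N (x + y) \<le> N x + N y) \<and>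
                  (\<forall>c x. N (c *\<^sub>R x) = \<bar>c\<bar> * N x)"

definition abs_cont_on :: "real \<Rightarrow> real \<Rightarrow> (real \<Rightarrow> 'a::real_normed_vector) \<Rightarrow> bool" where
  "abs_cont_on a b g \<longleftrightarrow>
     (\<forall>e>0. \<exists>d>0. \<forall>(n::nat) (u::nat \<Rightarrow> real) v.
        (\<forall>k<n. a \<le> u k \<and> u k \<le> v k \<and> v k \<le> b) \<and>
        (\<forall>i<n. \<forall>j<n. i \<noteq> j \<longrightarrow> v i \<le> u j \<or> v j \<le> u i) \<and>
        (\<Sum>k<n. v k - u k) < d \<longrightarrow>
        (\<Sum>k<n. norm (g (v k) - g (u k))) < e)"

text \<open>Horizontal curve, in exponential coordinates gam = exp^{-1} o Gamma: gam is absolutely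
continuous and for a.e. t the velocity equals U(gam t) for some U in W_1, where the left
invariant field is U(x) = d/ds|_{s=0} x (circledcirc) (sU).\<close>
definition horizontal :: "('a::euclidean_space \<Rightarrow> 'a \<Rightarrow> 'a) \<Rightarrow> (nat \<Rightarrow> 'a set) \<Rightarrow> nat \<Rightarrow>
    real \<Rightarrow> real \<Rightarrow> (real \<Rightarrow> 'a) \<Rightarrow> bool" where
  "horizontal B W ups a b gam \<longleftrightarrow>
     abs_cont_on a b gam \<and>
     (AE t in lborel. t \<in> {a..b} \<longrightarrow>
        (\<exists>U\<in>W 1. \<exists>v. (gam has_vector_derivative v) (at t within {a..b}) \<and>
                     ((\<lambda>s. bch B ups (gam t) (s *\<^sub>R U)) has_vector_derivative v) (at 0)))"

definition approx_cont_at :: "real set \<Rightarrow> (real \<Rightarrow> 'a::real_normed_vector) \<Rightarrow> real \<Rightarrow> bool" where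
  "approx_cont_at S f t \<longleftrightarrow> t \<in> S \<and>
     (\<forall>e>0. ((\<lambda>r. measure lebesgue {s \<in> S \<inter> {t - r..t + r}. norm (f s - f t) > e} / (2 * r))
              \<longlongrightarrow> 0) (at_right 0))"

text \<open>Sup-average A^lam_t(g) (value in [0,+infinity]); for lam = 0 it is the sup over the
empty set, i.e. 0.\<close>
definition sup_avg :: "('a \<Rightarrow> real) \<Rightarrow> real \<Rightarrow> real \<Rightarrow> (real \<Rightarrow> 'a) \<Rightarrow> ennreal" where
  "sup_avg N lam t g =
     (if lam > 0 then (SUP \<tau>\<in>{0<..lam}.
         (\<integral>\<^sup>+ s. indicator {t..t + \<tau>} s * ennreal (N (g s)) \<partial>lborel) / ennreal \<tau>)
      else if lam < 0 then (SUP \<tau>\<in>{lam..<0}.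
         (\<integral>\<^sup>+ s. indicator {t + \<tau>..t} s * ennreal (N (g s)) \<partial>lborel) / ennreal (- \<tau>))
      else 0)"

definition h_hom :: "('a::euclidean_space \<Rightarrow> 'a \<Rightarrow> 'a) \<Rightarrow> (nat \<Rightarrow> 'a set) \<Rightarrow> nat \<Rightarrow>
    (real \<Rightarrow> 'a) \<Rightarrow> bool" where
  "h_hom B W ups L \<longleftrightarrow> (\<forall>x y. L (x + y) = bch B ups (L x) (L y)) \<and>
     (\<forall>r>0. \<forall>x. L (r * x) = dil W ups r (L x))"

definition hom_dist :: "('a::euclidean_space \<Rightarrow> 'a \<Rightarrow> 'a) \<Rightarrow> (nat \<Rightarrow> 'a set) \<Rightarrow> nat \<Rightarrow>
    ('a \<Rightarrow> 'a \<Rightarrow> real) \<Rightarrow> bool" where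
  "hom_dist B W ups \<rho> \<longleftrightarrow>
     (\<forall>x y. \<rho> x y = 0 \<longleftrightarrow> x = y) \<and> (\<forall>x y. \<rho> x y = \<rho> y x) \<and>
     (\<forall>x y z. \<rho> x z \<le> \<rho> x y + \<rho> y z) \<and>
     continuous_on UNIV (\<lambda>p. \<rho> (fst p) (snd p)) \<and>
     (\<forall>x y z. \<rho> (bch B ups z x) (bch B ups z y) = \<rho> x y) \<and>
     (\<forall>r>0. \<forall>x y. \<rho> (dil W ups r x) (dil W ups r y) = r * \<rho> x y)"

text \<open>P-differentiability of Gamma (in coordinates gam) at t w.r.t. rho; the group inverse
of gam t is -(gam t) in exponential coordinates.\<close>
definition P_diff_at :: "('a::euclidean_space \<Rightarrow> 'a \<Rightarrow> 'a) \<Rightarrow> (nat \<Rightarrow> 'a set) \<Rightarrow> nat \<Rightarrow>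
    ('a \<Rightarrow> 'a \<Rightarrow> real) \<Rightarrow> real set \<Rightarrow> (real \<Rightarrow> 'a) \<Rightarrow> real \<Rightarrow> bool" where
  "P_diff_at B W ups \<rho> S gam t \<longleftrightarrow>
     (\<exists>L. h_hom B W ups L \<and>
        ((\<lambda>h. \<rho> (bch B ups (- gam t) (gam (t + h))) (L h) / \<bar>h\<bar>) \<longlongrightarrow> 0)
          (at 0 within {h. t + h \<in> S}))"

end

(*
  BCH side.  Adjoining the grading derivation to the Lie algebra makes its adjoint representation
  faithful on the original algebra, so the group becomes a group of unipotent operators, and
  Dynkin's formula says that bch is log (exp x * exp y) there.  The formula holds because along the
  ray (t x, t y) both sides solve the same differential equation.

  Curve side.  After applying the dilation by 1/h, the operator Q s representing gam(t)^-1 gam(s)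
  solves Q' = Q X(s)/h, with X(s) the image of the horizontal velocity g1(s).  As X(s) is nilpotent, Q is bounded
  polynomially in the mean of |g1| over [t, t + h].  Comparing with the one-parameter group of g1(t),
  (Q exp (-(s - t) X(t)/h))' contains only X(s) - X(t), so that Q(t + h) exp (-X(t)) - 1 is bounded by the
  mean of |g1 - g1(t)|; taking logarithms gives the estimate.  Its instance at Lebesgue points of g1
  gives P-differentiability.
*)
theory Submission
  imports Defs
begin

text \<open>Dilations are group automorphisms, so the dilation by 1/h can be applied to the curve
  before anything is estimated. The layers then need no separate treatment: the velocity lies in the
  first layer and picks up the single factor 1/h, which turns its integral between t and t + h into
  a mean, and one operator estimate covers all degrees at once.

  That estimate involves the norm of g1(t) and the mean deviation of g1 from g1(t), whereas
  \<Upsilon> may see only L_t. Approximate continuity closes the gap: near t most values of g1 are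
  close to g1(t), so the averages of g1 bound g1(t) itself. The curve need not be differentiable at
  such a t, hence even the membership of g1(t) in the first layer has to be extracted from nearby
  times.

  The logarithm is a polynomial because the operators strictly raise a finite flag; its injectivity
  is what turns equality of logarithms into Dynkin's formula for products.

  Averages take values in [0, \<infinity>], where \<infinity> * 0 = 0. This forces a separate
  treatment of infinite L_t and of infinite averages.\<close>

subsection \<open>Absolutely continuous functions\<close>

lemma abs_cont_on_subset: "abs_cont_on a b F \<Longrightarrow> a \<le> c \<Longrightarrow> d \<le> b \<Longrightarrow> abs_cont_on c d F"
  unfolding abs_cont_on_def
proof (intro allI impI)
  fix e :: real
  assume ab: "a \<le> c" "d \<le> b" and "e > 0" and
    *: "\<forall>e>0. \<exists>\<delta>>0. \<forall>(n::nat) (u::nat \<Rightarrow> real) v. (\<forall>k<n. a \<le> u k \<and> u k \<le> v k \<and> v k \<le> b) \<and>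
        (\<forall>i<n. \<forall>j<n. i \<noteq> j \<longrightarrow> v i \<le> u j \<or> v j \<le> u i) \<and> (\<Sum>k<n. v k - u k) < \<delta> \<longrightarrow>
        (\<Sum>k<n. norm (F (v k) - F (u k))) < e"
  from *[rule_format, OF \<open>e > 0\<close>] obtain \<delta> where \<delta>: "\<delta> > 0" 
    "\<And>(n::nat) (u::nat \<Rightarrow> real) v. (\<forall>k<n. a \<le> u k \<and> u k \<le> v k \<and> v k \<le> b) \<and>
        (\<forall>i<n. \<forall>j<n. i \<noteq> j \<longrightarrow> v i \<le> u j \<or> v j \<le> u i) \<and> (\<Sum>k<n. v k - u k) < \<delta> \<Longrightarrow>
        (\<Sum>k<n. norm (F (v k) - F (u k))) < e"
    by blast
  show "\<exists>\<delta>>0. \<forall>(n::nat) (u::nat \<Rightarrow> real) v. (\<forall>k<n. c \<le> u k \<and> u k \<le> v k \<and> v k \<le> d) \<and>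
        (\<forall>i<n. \<forall>j<n. i \<noteq> j \<longrightarrow> v i \<le> u j \<or> v j \<le> u i) \<and> (\<Sum>k<n. v k - u k) < \<delta> \<longrightarrow>
        (\<Sum>k<n. norm (F (v k) - F (u k))) < e"
  proof (intro exI[of _ \<delta>] conjI allI impI)
    fix n :: nat and u v :: "nat \<Rightarrow> real"
    assume uv: "(\<forall>k<n. c \<le> u k \<and> u k \<le> v k \<and> v k \<le> d) \<and>
        (\<forall>i<n. \<forall>j<n. i \<noteq> j \<longrightarrow> v i \<le> u j \<or> v j \<le> u i) \<and> (\<Sum>k<n. v k - u k) < \<delta>"
    then have "\<forall>k<n. a \<le> u k \<and> u k \<le> v k \<and> v k \<le> b"
      using ab by (meson order_trans)
    with uv show "(\<Sum>k<n. norm (F (v k) - F (u k))) < e"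
      by (intro \<delta>(2)) blast
  qed (rule \<delta>(1))
qed

text \<open>Divisions are finite sets of intervals with disjoint interiors, not numbered lists of
  ordered intervals; this restates absolute continuity in the form they require.\<close>

lemma abs_cont_on_finite_family:
  assumes "abs_cont_on a b F" "e > 0"
  shows "\<exists>d>0. \<forall>(I :: 'c set) u v. finite I \<and> (\<forall>i\<in>I. a \<le> u i \<and> u i \<le> v i \<and> v i \<le> b) \<and>
       (\<forall>i\<in>I. \<forall>j\<in>I. i \<noteq> j \<longrightarrow> {u i<..<v i} \<inter> {u j<..<v j} = {}) \<and>
       (\<Sum>i\<in>I. v i - u i) < d \<longrightarrow> (\<Sum>i\<in>I. norm (F (v i) - F (u i))) < e"
proof -
  obtain d where d: "d > 0" and ac: "\<And>n (u::nat \<Rightarrow> real) v.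
        (\<forall>k<n. a \<le> u k \<and> u k \<le> v k \<and> v k \<le> b) \<and>
        (\<forall>i<n. \<forall>j<n. i \<noteq> j \<longrightarrow> v i \<le> u j \<or> v j \<le> u i) \<and>
        (\<Sum>k<n. v k - u k) < d \<Longrightarrow>
        (\<Sum>k<n. norm (F (v k) - F (u k))) < e"
    using assms unfolding abs_cont_on_def by blast
  show ?thesis
  proof (intro exI[of _ d] conjI d allI impI; elim conjE)
    fix I :: "'c set" and u v :: "'c \<Rightarrow> real"
    assume fin: "finite I" and bnd: "\<forall>i\<in>I. a \<le> u i \<and> u i \<le> v i \<and> v i \<le> b"
      and disj: "\<forall>i\<in>I. \<forall>j\<in>I. i \<noteq> j \<longrightarrow> {u i<..<v i} \<inter> {u j<..<v j} = {}"
      and small: "(\<Sum>i\<in>I. v i - u i) < d"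
    \<comment> \<open>Degenerate intervals are dropped before numbering: one lying inside another
      interval has an empty interior, so it satisfies the disjointness hypothesis, but it cannot be
      ordered against the other as the definition demands. It contributes 0 to both sums.\<close>
    let ?I = "{i \<in> I. u i < v i}"
    obtain h where h: "bij_betw h {..<card ?I} ?I"
      using ex_bij_betw_nat_finite[of ?I] fin by (auto simp: atLeast0LessThan)
    have hI: "h k \<in> I" "u (h k) < v (h k)" if "k < card ?I" for k
      using bij_betwE[OF h] that by auto
    have sub: "sum g I = (\<Sum>k<card ?I. g (h k))" if "\<And>i. i \<in> I \<Longrightarrow> u i = v i \<Longrightarrow> g i = 0" for g :: "'c \<Rightarrow> real"
    proof -
      have "sum g I = sum g ?I"
        by (rule sum.mono_neutral_right) (use fin bnd that in force)+
      then show ?thesis using sum.reindex_bij_betw[OF h, of g] by simp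
    qed
    have "(\<Sum>k<card ?I. norm (F (v (h k)) - F (u (h k)))) < e"
    proof (rule ac, intro conjI allI impI)
      fix i j assume ij: "i < card ?I" "j < card ?I" "i \<noteq> j"
      then have "h i \<noteq> h j" using h by (auto simp: bij_betw_def inj_on_def)
      then have "{u (h i)<..<v (h i)} \<inter> {u (h j)<..<v (h j)} = {}"
        using disj hI ij by blast
      then show "v (h i) \<le> u (h j) \<or> v (h j) \<le> u (h i)"
        using hI(2)[OF ij(1)] hI(2)[OF ij(2)] by (auto simp: min_def max_def split: if_splits)
    next
      show "(\<Sum>k<card ?I. v (h k) - u (h k)) < d"
        using small sub[of "\<lambda>i. v i - u i"] by simp
    qed (use bnd hI in auto)
    then show "(\<Sum>i\<in>I. norm (F (v i) - F (u i))) < e"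
      using sub[of "\<lambda>i. norm (F (v i) - F (u i))"] by simp
  qed
qed

lemma abs_cont_on_tagged_partial_division:
  assumes "abs_cont_on a b F" "e > 0"
  obtains d where "d > 0" and
    "\<And>p. p tagged_partial_division_of {a..b} \<Longrightarrow> (\<Sum>(x, K)\<in>p. measure lborel K) < d \<Longrightarrow>
       (\<Sum>(x, K)\<in>p. norm (F (Sup K) - F (Inf K))) < e"
proof -
  obtain d where d: "d > 0" and ac: "\<forall>(I :: (real \<times> real set) set) u v. finite I \<and> (\<forall>i\<in>I. a \<le> u i \<and> u i \<le> v i \<and> v i \<le> b) \<and>
       (\<forall>i\<in>I. \<forall>j\<in>I. i \<noteq> j \<longrightarrow> {u i<..<v i} \<inter> {u j<..<v j} = {}) \<and>
       (\<Sum>i\<in>I. v i - u i) < d \<longrightarrow> (\<Sum>i\<in>I. norm (F (v i) - F (u i))) < e"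
    using abs_cont_on_finite_family[OF assms] by blast
  show thesis
  proof (rule that[OF d])
    fix p assume p: "p tagged_partial_division_of {a..b}" and small: "(\<Sum>(x, K)\<in>p. measure lborel K) < d"
    note pD = tagged_partial_division_ofD[OF p]
    have K: "\<exists>u v. u \<le> v \<and> snd i = {u..v} \<and> a \<le> u \<and> v \<le> b" if ip: "i \<in> p" for i
    proof -
      obtain x K where i: "i = (x, K)" by (cases i)
      obtain u v where uv: "K = cbox u v" using pD(4) ip i by blast
      have "x \<in> K" "K \<subseteq> {a..b}" using pD(2,3) ip i by auto
      then show ?thesis using uv i by (intro exI[of _ u] exI[of _ v]) auto
    qed
    have K': "Inf (snd i) \<le> Sup (snd i)" "snd i = {Inf (snd i)..Sup (snd i)}" "a \<le> Inf (snd i)" "Sup (snd i) \<le> b" 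
      if ip: "i \<in> p" for i
    proof -
      obtain u v where "u \<le> v" "snd i = {u..v}" "a \<le> u" "v \<le> b" using K[OF ip] by blast
      then show "Inf (snd i) \<le> Sup (snd i)" "snd i = {Inf (snd i)..Sup (snd i)}" "a \<le> Inf (snd i)" "Sup (snd i) \<le> b"
        by simp_all
    qed
    have "(\<Sum>i\<in>p. norm (F (Sup (snd i)) - F (Inf (snd i)))) < e"
    proof (rule ac[rule_format], intro conjI ballI impI)
      show "finite p" by (rule pD(1))
      show "a \<le> Inf (snd i)" "Inf (snd i) \<le> Sup (snd i)" "Sup (snd i) \<le> b" if "i \<in> p" for i
        using K'(1,3,4)[OF that] by simp_all
      show "{Inf (snd i)<..<Sup (snd i)} \<inter> {Inf (snd j)<..<Sup (snd j)} = {}" if "i \<in> p" "j \<in> p" "i \<noteq> j" for i j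
      proof -
        have "interior (snd i) \<inter> interior (snd j) = {}"
          using pD(5)[of "fst i" "snd i" "fst j" "snd j"] that by (metis prod.collapse)
        moreover have "{Inf (snd i)<..<Sup (snd i)} = interior (snd i)" if "i \<in> p" for i
          using K'(2)[OF that] interior_atLeastAtMost_real by metis
        ultimately show ?thesis using that by simp
      qed
      have "Sup (snd i) - Inf (snd i) = measure lborel (snd i)" if "i \<in> p" for i
        using K'(1,2)[OF that] by (metis measure_lborel_Icc)
      then show "(\<Sum>i\<in>p. Sup (snd i) - Inf (snd i)) < d"
        using small by (simp add: case_prod_beta)
    qed
    then show "(\<Sum>(x, K)\<in>p. norm (F (Sup K) - F (Inf K))) < e"
      by (simp add: case_prod_beta)
  qed
qed

text \<open>Tags in the exceptional set are confined to an open set of small measure, where absolute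
  continuity controls the increments; the other tags are handled by differentiability.\<close>
theorem abs_cont_on_has_integral_derivative:
  fixes F :: "real \<Rightarrow> 'a::banach"
  assumes ac: "abs_cont_on a b F" and "a \<le> b" and E: "negligible E"
    and deriv: "\<And>x. x \<in> {a..b} - E \<Longrightarrow> (F has_vector_derivative f x) (at x within {a..b})"
  shows "(f has_integral (F b - F a)) {a..b}"
proof -
  \<comment> \<open>With the integrand set to 0 on \<open>E\<close>, a tag in \<open>E\<close>
    contributes nothing but the increment of \<open>F\<close> over its interval.\<close>
  define f0 where "f0 x = (if x \<in> E then 0 else f x)" for x
  have "(f0 has_integral (F b - F a)) {a..b}"
    unfolding has_integral_real
  proof (intro allI impI)
    fix e :: real assume "e > 0"
    \<comment> \<open>Half of \<open>e\<close> is kept for the tags in \<open>E\<close>; the summand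
      1 keeps the denominator positive when \<open>a = b\<close>.\<close>
    define e' where "e' = e / (2 * (b - a + 1))"
    have "e' > 0" using \<open>e > 0\<close> \<open>a \<le> b\<close> by (simp add: e'_def)
    then have "\<forall>x. \<exists>d>0. x \<in> {a..b} - E \<longrightarrow>
         (\<forall>y\<in>{a..b}. norm (y-x) < d \<longrightarrow> norm (F y - F x - (y-x) *\<^sub>R f x) \<le> e' * norm (y-x))"
      using deriv[unfolded has_vector_derivative_def has_derivative_within_alt] by (meson zero_less_one)
    then obtain d where d: "\<And>x. 0 < d x"
                 "\<And>x y. \<lbrakk>x \<in> {a..b} - E; y \<in> {a..b}; norm (y-x) < d x\<rbrakk>
                        \<Longrightarrow> norm (F y - F x - (y-x) *\<^sub>R f x) \<le> e' * norm (y-x)"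
      by metis
    obtain \<eta> where "\<eta> > 0" and \<eta>: "\<And>p. p tagged_partial_division_of {a..b} \<Longrightarrow> (\<Sum>(x, K)\<in>p. measure lborel K) < \<eta> \<Longrightarrow>
       (\<Sum>(x, K)\<in>p. norm (F (Sup K) - F (Inf K))) < e / 2"
      using abs_cont_on_tagged_partial_division[OF ac, of "e / 2"] \<open>e > 0\<close> by auto
    obtain G where G: "open G" "E \<subseteq> G" "G \<in> lmeasurable" "measure lebesgue G < \<eta>"
    proof -
      have "E \<in> lmeasurable" "measure lebesgue E = 0"
        using E by (auto simp: negligible_imp_measurable negligible_imp_measure0)
      moreover obtain T where T: "open T" "E \<subseteq> T" "T - E \<in> lmeasurable" "emeasure lebesgue (T - E) < ennreal \<eta>"
        using sets_lebesgue_outer_open[of E \<eta>] \<open>\<eta> > 0\<close> \<open>E \<in> lmeasurable\<close> fmeasurableD by metis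
      moreover have T': "T = (T - E) \<union> E" using T by auto
      ultimately have "T \<in> lmeasurable" using fmeasurable.Un by metis
      moreover have "measure lebesgue T \<le> measure lebesgue (T - E) + measure lebesgue E"
        using T' measure_Un_le[of "T - E" lebesgue E] T(3) \<open>E \<in> lmeasurable\<close> by (metis fmeasurableD)
      moreover have "measure lebesgue (T - E) < \<eta>"
        using T(4) \<open>\<eta> > 0\<close> T(3) by (simp add: emeasure_eq_measure2 ennreal_less_iff)
      ultimately show thesis using that[of T] T \<open>measure lebesgue E = 0\<close> by simp
    qed
    have "\<forall>x. \<exists>r>0. x \<in> E \<longrightarrow> ball x r \<subseteq> G"
      using G open_contains_ball by (metis subsetD zero_less_one)
    then obtain r where r: "\<And>x. r x > 0" "\<And>x. x \<in> E \<Longrightarrow> ball x (r x) \<subseteq> G" by metis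
    define \<gamma> where "\<gamma> x = ball x (min (d x) (r x))" for x
    show "\<exists>\<gamma>. gauge \<gamma> \<and> (\<forall>\<D>. \<D> tagged_division_of {a..b} \<and> \<gamma> fine \<D> \<longrightarrow>
        norm (sum (\<lambda>(x,k). measure lborel k *\<^sub>R f0 x) \<D> - (F b - F a)) < e)"
    proof (rule exI[of _ \<gamma>], safe)
      show "gauge \<gamma>"
        unfolding \<gamma>_def using d(1) r(1) by (intro gauge_ball_dependent) simp
      fix p assume ptag: "p tagged_division_of {a..b}" and fine: "\<gamma> fine p"
      let ?\<Delta> = "\<lambda>K. F (Sup K) - F (Inf K)"
      define q where "q = {i \<in> p. fst i \<in> E}"
      have qp: "q \<subseteq> p" and finp: "finite p" 
        using ptag by (auto simp: q_def)
      have ba: "b - a = (\<Sum>(x,K)\<in>p. Sup K - Inf K)" "F b - F a = (\<Sum>(x,K)\<in>p. ?\<Delta> K)"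
        using additive_tagged_division_1[where f= "\<lambda>x. x"] additive_tagged_division_1[where f= F]
              \<open>a \<le> b\<close> ptag by auto
      have K: "\<exists>u v. u \<le> v \<and> K = {u..v} \<and> a \<le> u \<and> v \<le> b \<and> x \<in> K" if xK: "(x, K) \<in> p" for x K
      proof -
        obtain u v where uv: "K = cbox u v" using tagged_division_ofD(4)[OF ptag xK] by blast
        have "x \<in> K" "K \<subseteq> {a..b}" using tagged_division_ofD(2,3)[OF ptag] xK by auto
        then show ?thesis using uv by (intro exI[of _ u] exI[of _ v]) auto
      qed
      have q_part: "q tagged_partial_division_of {a..b}"
        by (rule tagged_partial_division_subset[OF _ qp]) (use ptag in \<open>simp add: tagged_division_of_def\<close>)
      have qtag: "q tagged_division_of \<Union>(snd ` q)"
        by (rule tagged_partial_division_of_Union_self[OF q_part])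
      have qdiv: "snd ` q division_of \<Union>(snd ` q)"
        by (rule division_of_tagged_division[OF qtag])
      \<comment> \<open>An interval carried by two different tags has empty interior and so content
        0. Summing over tagged pairs is therefore summing over intervals, and yields the measure of
        their union, which the gauge forces into \<open>G\<close>.\<close>
      have "(\<Sum>(x, K)\<in>q. measure lborel K) = (\<Sum>K\<in>snd ` q. measure lborel K)"
        by (rule sum.over_tagged_division_lemma[OF qtag]) (simp add: content_eq_0_interior box_real)
      also have "\<dots> = measure lebesgue (\<Union>(snd ` q))"
        unfolding content_division[OF qdiv, symmetric]
        by (intro sum.cong refl) (use division_ofD(4)[OF qdiv] in force)
      also have "\<dots> \<le> measure lebesgue G"
      proof (rule measure_mono_fmeasurable)
        show "\<Union>(snd ` q) \<subseteq> G"
          using fine r(2) by (force simp: q_def \<gamma>_def fine_def)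
        show "\<Union>(snd ` q) \<in> sets lebesgue"
          using lmeasurable_division[OF qdiv] by auto
      qed (use G in simp)
      finally have "(\<Sum>(x, K)\<in>q. measure lborel K) < \<eta>" using G by simp
      then have bad: "(\<Sum>(x, K)\<in>q. norm (?\<Delta> K)) < e / 2"
        by (rule \<eta>[OF q_part])
      have good: "norm (measure lborel K *\<^sub>R f0 x - ?\<Delta> K) \<le> e' * (Sup K - Inf K)" if xK: "(x, K) \<in> p - q" for x K
      proof -
        obtain u v where uv: "u \<le> v" "K = {u..v}" "a \<le> u" "v \<le> b" "x \<in> K" using K xK by blast
        have xE: "x \<in> {a..b} - E" using xK uv by (auto simp: q_def)
        have near: "norm (y - x) < d x" if "y \<in> K" for y
          using fine xK that by (force simp: fine_def \<gamma>_def dist_norm norm_minus_commute)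
        have "norm ((v - u) *\<^sub>R f x - (F v - F u)) = norm (F u - F x - (u - x) *\<^sub>R f x - (F v - F x - (v - x) *\<^sub>R f x))"
          by (auto simp: algebra_simps)
        also have "\<dots> \<le> norm (F u - F x - (u - x) *\<^sub>R f x) + norm (F v - F x - (v - x) *\<^sub>R f x)"
          by (rule norm_triangle_ineq4)
        also have "\<dots> \<le> e' * norm (u - x) + e' * norm (v - x)"
          by (intro add_mono d(2)[OF xE] near) (use uv in auto)
        also have "\<dots> = e' * (v - u)" using uv by (simp add: algebra_simps)
        finally show ?thesis using uv xE by (simp add: f0_def)
      qed
      have "(\<Sum>(x, K)\<in>p. measure lborel K *\<^sub>R f0 x) - (F b - F a) = (\<Sum>(x, K)\<in>p. measure lborel K *\<^sub>R f0 x - ?\<Delta> K)"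
        by (simp add: ba split_def sum_subtractf)
      also have "\<dots> = (\<Sum>(x, K)\<in>p - q. measure lborel K *\<^sub>R f0 x - ?\<Delta> K) + (\<Sum>(x, K)\<in>q. measure lborel K *\<^sub>R f0 x - ?\<Delta> K)"
        by (rule sum.subset_diff[OF qp finp])
      also have "norm \<dots> \<le> (\<Sum>(x, K)\<in>p - q. e' * (Sup K - Inf K)) + (\<Sum>(x, K)\<in>q. norm (?\<Delta> K))"
      proof (rule norm_triangle_le[OF add_mono])
        show "norm (\<Sum>(x, K)\<in>p - q. measure lborel K *\<^sub>R f0 x - ?\<Delta> K) \<le> (\<Sum>(x, K)\<in>p - q. e' * (Sup K - Inf K))"
          by (rule sum_norm_le) (use good in auto)
        show "norm (\<Sum>(x, K)\<in>q. measure lborel K *\<^sub>R f0 x - ?\<Delta> K) \<le> (\<Sum>(x, K)\<in>q. norm (?\<Delta> K))"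
          by (rule sum_norm_le) (auto simp: q_def f0_def norm_minus_commute)
      qed
      also have "(\<Sum>(x, K)\<in>p - q. e' * (Sup K - Inf K)) \<le> (\<Sum>(x, K)\<in>p. e' * (Sup K - Inf K))"
        by (rule sum_mono2) (use finp \<open>e' > 0\<close> K in \<open>force simp: q_def\<close>)+
      also have "\<dots> = e' * (b - a)"
        by (simp add: ba split_def sum_distrib_left)
      also have "\<dots> \<le> e / 2"
        using \<open>e > 0\<close> \<open>a \<le> b\<close> by (simp add: e'_def field_simps)
      finally show "norm ((\<Sum>(x, K)\<in>p. measure lborel K *\<^sub>R f0 x) - (F b - F a)) < e"
        using bad by linarith
    qed
  qed
  then show ?thesis
    by (rule has_integral_spike[OF E, rotated]) (simp add: f0_def)
qed

text \<open>Integrals of \<open>f\<close> over subintervals are increments of \<open>F\<close>.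
  Absolute continuity with tolerance 1 bounds their variation on every interval shorter than \<eta>,
  and finitely many such intervals cover \<open>{a..b}\<close>.\<close>

lemma abs_cont_on_deriv_absolutely_integrable:
  fixes F :: "real \<Rightarrow> 'a::euclidean_space"
  assumes ac: "abs_cont_on a b F" and "a \<le> b" and E: "negligible E"
    and deriv: "\<And>x. x \<in> {a..b} - E \<Longrightarrow> (F has_vector_derivative f x) (at x within {a..b})"
  shows "f absolutely_integrable_on {a..b}"
proof -
  have int: "(f has_integral (F d - F c)) {c..d}" if "a \<le> c" "c \<le> d" "d \<le> b" for c d
  proof (rule abs_cont_on_has_integral_derivative[OF abs_cont_on_subset[OF ac] _ E])
    show "(F has_vector_derivative f x) (at x within {c..d})" if "x \<in> {c..d} - E" for x
      by (rule has_vector_derivative_within_subset[OF deriv]) (use that \<open>a \<le> c\<close> \<open>d \<le> b\<close> in auto)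
  qed (use that in auto)
  obtain \<eta> where "\<eta> > 0" and \<eta>: "\<forall>(I :: real set set) u v. finite I \<and> (\<forall>i\<in>I. a \<le> u i \<and> u i \<le> v i \<and> v i \<le> b) \<and>
       (\<forall>i\<in>I. \<forall>j\<in>I. i \<noteq> j \<longrightarrow> {u i<..<v i} \<inter> {u j<..<v j} = {}) \<and>
       (\<Sum>i\<in>I. v i - u i) < \<eta> \<longrightarrow> (\<Sum>i\<in>I. norm (F (v i) - F (u i))) < 1"
    using abs_cont_on_finite_family[OF ac zero_less_one] by blast
  have short: "f absolutely_integrable_on {c..d}" if cd: "a \<le> c" "c \<le> d" "d \<le> b" "d - c < \<eta>" for c d
  proof -
    have "f absolutely_integrable_on cbox c d"
    proof (rule bounded_variation_absolutely_integrable_interval)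
      show "f integrable_on cbox c d" using int cd by auto
      fix p assume p: "p division_of cbox c d"
      have K: "\<exists>u v. u \<le> v \<and> K = {u..v} \<and> c \<le> u \<and> v \<le> d" if Kp: "K \<in> p" for K
      proof -
        obtain u v where uv: "K = cbox u v" using division_ofD(4)[OF p Kp] by blast
        have "K \<noteq> {}" "K \<subseteq> {c..d}" using division_ofD(2,3)[OF p Kp] by auto
        then show ?thesis using uv by (intro exI[of _ u] exI[of _ v]) auto
      qed
      have K': "Inf K \<le> Sup K" "K = {Inf K..Sup K}" "c \<le> Inf K" "Sup K \<le> d" if "K \<in> p" for K
        using K[OF that] by auto
      have "(\<Sum>K\<in>p. norm (integral K f)) = (\<Sum>K\<in>p. norm (F (Sup K) - F (Inf K)))"
      proof (rule sum.cong[OF refl])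
        fix K assume "K \<in> p"
        note K' = K'[OF this]
        have "integral {Inf K..Sup K} f = F (Sup K) - F (Inf K)"
          by (rule integral_unique[OF int]) (use K' cd in auto)
        then show "norm (integral K f) = norm (F (Sup K) - F (Inf K))" using K'(2) by simp
      qed
      also have "\<dots> < 1"
      proof (rule \<eta>[rule_format], intro conjI ballI impI)
        show "finite p" using p by blast
        show "a \<le> Inf K" "Inf K \<le> Sup K" "Sup K \<le> b" if "K \<in> p" for K
          using K'[OF that] cd by simp_all
        show "{Inf K<..<Sup K} \<inter> {Inf K'<..<Sup K'} = {}" if "K \<in> p" "K' \<in> p" "K \<noteq> K'" for K K'
        proof -
          have "interior K \<inter> interior K' = {}" using division_ofD(5)[OF p that] .
          moreover have "{Inf K<..<Sup K} = interior K" if "K \<in> p" for K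
            using K'(2)[OF that] interior_atLeastAtMost_real by metis
          ultimately show ?thesis using that by simp
        qed
        have "(\<Sum>K\<in>p. Sup K - Inf K) = (\<Sum>K\<in>p. measure lborel K)"
          by (rule sum.cong[OF refl]) (metis K'(1,2) measure_lborel_Icc)
        also have "\<dots> = measure lborel (cbox c d)" by (rule additive_content_division[OF p])
        finally show "(\<Sum>K\<in>p. Sup K - Inf K) < \<eta>" using cd by simp
      qed
      finally show "(\<Sum>K\<in>p. norm (integral K f)) \<le> 1" by simp
    qed
    then show ?thesis by simp
  qed
  \<comment> \<open>Steps of length \<eta> / 2 are strictly shorter than \<eta>; the cap at
    \<open>b\<close> stops the induction inside \<open>{a..b}\<close>.\<close>
  have "f absolutely_integrable_on {a..min b (a + real n * (\<eta> / 2))}" for n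
  proof (induction n)
    case 0
    then show ?case using short[of a a] \<open>a \<le> b\<close> \<open>\<eta> > 0\<close> by simp
  next
    case (Suc n)
    define c where "c = a + real n * (\<eta> / 2)"
    have c: "a + real (Suc n) * (\<eta> / 2) = c + \<eta> / 2" "a \<le> c"
      using \<open>\<eta> > 0\<close> by (auto simp: c_def algebra_simps)
    show ?case
      unfolding c(1)
    proof (rule absolutely_integrable_on_combine[OF Suc[folded c_def]])
      show "f absolutely_integrable_on {min b c..min b (c + \<eta> / 2)}"
        using \<open>a \<le> b\<close> \<open>\<eta> > 0\<close> c(2) by (intro short) auto
    qed (use \<open>a \<le> b\<close> \<open>\<eta> > 0\<close> c(2) in auto)
  qed
  note steps = this
  have "\<eta> / 2 > 0" using \<open>\<eta> > 0\<close> by simp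
  then obtain n where "b - a < real n * (\<eta> / 2)"
    using reals_Archimedean3[of "\<eta> / 2"] by blast
  then have "min b (a + real n * (\<eta> / 2)) = b" by linarith
  then show ?thesis using steps[of n] by simp
qed

section \<open>Closure properties of absolute continuity\<close>

text \<open>Common source of the closure rules: linear images, sums and products all have increments
  controlled by those of their ingredients.\<close>

lemma abs_cont_on_dominated:
  assumes f: "abs_cont_on a b f" and g: "abs_cont_on a b g"
    and dom: "\<And>x y. x \<in> {a..b} \<Longrightarrow> y \<in> {a..b} \<Longrightarrow>
       norm (k x - k y) \<le> K * (norm (f x - f y) + norm (g x - g y))"
  shows "abs_cont_on a b k"
  unfolding abs_cont_on_def
proof (intro allI impI)
  fix e :: real assume "e > 0"
  define e' where "e' = e / 2 / (\<bar>K\<bar> + 1)"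
  have "e' > 0" using \<open>e > 0\<close> by (simp add: e'_def)
  have e': "(\<bar>K\<bar> + 1) * e' = e / 2"
    unfolding e'_def by (subst times_divide_eq_right, subst nonzero_mult_div_cancel_left) auto
  obtain d1 where d1: "d1 > 0" "\<And>(n::nat) (u::nat \<Rightarrow> real) v.
        (\<forall>k<n. a \<le> u k \<and> u k \<le> v k \<and> v k \<le> b) \<and>
        (\<forall>i<n. \<forall>j<n. i \<noteq> j \<longrightarrow> v i \<le> u j \<or> v j \<le> u i) \<and>
        (\<Sum>k<n. v k - u k) < d1 \<Longrightarrow> (\<Sum>k<n. norm (f (v k) - f (u k))) < e'"
    using f \<open>e' > 0\<close> unfolding abs_cont_on_def by blast
  obtain d2 where d2: "d2 > 0" "\<And>(n::nat) (u::nat \<Rightarrow> real) v.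
        (\<forall>k<n. a \<le> u k \<and> u k \<le> v k \<and> v k \<le> b) \<and>
        (\<forall>i<n. \<forall>j<n. i \<noteq> j \<longrightarrow> v i \<le> u j \<or> v j \<le> u i) \<and>
        (\<Sum>k<n. v k - u k) < d2 \<Longrightarrow> (\<Sum>k<n. norm (g (v k) - g (u k))) < e'"
    using g \<open>e' > 0\<close> unfolding abs_cont_on_def by blast
  show "\<exists>d>0. \<forall>(n::nat) (u::nat \<Rightarrow> real) v.
        (\<forall>k<n. a \<le> u k \<and> u k \<le> v k \<and> v k \<le> b) \<and>
        (\<forall>i<n. \<forall>j<n. i \<noteq> j \<longrightarrow> v i \<le> u j \<or> v j \<le> u i) \<and>
        (\<Sum>k<n. v k - u k) < d \<longrightarrow> (\<Sum>i<n. norm (k (v i) - k (u i))) < e"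
  proof (intro exI[of _ "min d1 d2"] conjI allI impI)
    fix n :: nat and u v :: "nat \<Rightarrow> real"
    assume uv: "(\<forall>k<n. a \<le> u k \<and> u k \<le> v k \<and> v k \<le> b) \<and>
        (\<forall>i<n. \<forall>j<n. i \<noteq> j \<longrightarrow> v i \<le> u j \<or> v j \<le> u i) \<and> (\<Sum>k<n. v k - u k) < min d1 d2"
    let ?f = "\<lambda>i. norm (f (v i) - f (u i))" and ?g = "\<lambda>i. norm (g (v i) - g (u i))"
    have "(\<Sum>i<n. norm (k (v i) - k (u i))) \<le> (\<Sum>i<n. (\<bar>K\<bar> + 1) * (?f i + ?g i))"
    proof (rule sum_mono)
      fix i assume "i \<in> {..<n}"
      then have "a \<le> u i" "u i \<le> v i" "v i \<le> b" using uv by auto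
      then have "norm (k (v i) - k (u i)) \<le> K * (?f i + ?g i)" by (intro dom) auto
      also have "\<dots> \<le> (\<bar>K\<bar> + 1) * (?f i + ?g i)" by (intro mult_right_mono) auto
      finally show "norm (k (v i) - k (u i)) \<le> (\<bar>K\<bar> + 1) * (?f i + ?g i)" .
    qed
    also have "\<dots> = (\<bar>K\<bar> + 1) * ((\<Sum>i<n. ?f i) + (\<Sum>i<n. ?g i))"
      by (simp only: sum_distrib_left sum.distrib distrib_left)
    also have "\<dots> < (\<bar>K\<bar> + 1) * (e' + e')"
      using d1(2)[of n u v] d2(2)[of n u v] uv by (intro mult_strict_left_mono add_strict_mono) auto
    also have "\<dots> = e" by (simp only: distrib_left e')
    finally show "(\<Sum>i<n. norm (k (v i) - k (u i))) < e" .
  qed (use d1 d2 in simp)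
qed

lemma abs_cont_on_const: "abs_cont_on a b (\<lambda>_. c)"
  unfolding abs_cont_on_def
proof (intro allI impI)
  fix e :: real assume "e > 0"
  then show "\<exists>d>0. \<forall>(n::nat) (u::nat \<Rightarrow> real) v.
        (\<forall>k<n. a \<le> u k \<and> u k \<le> v k \<and> v k \<le> b) \<and>
        (\<forall>i<n. \<forall>j<n. i \<noteq> j \<longrightarrow> v i \<le> u j \<or> v j \<le> u i) \<and>
        (\<Sum>k<n. v k - u k) < d \<longrightarrow> (\<Sum>k<n. norm (c - c)) < e"
    by (intro exI[of _ 1]) simp
qed

lemma abs_cont_on_ident: "abs_cont_on a b (\<lambda>x::real. x)"
  unfolding abs_cont_on_def
proof (intro allI impI)
  fix e :: real assume "e > 0"
  show "\<exists>d>0. \<forall>(n::nat) (u::nat \<Rightarrow> real) v.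
        (\<forall>k<n. a \<le> u k \<and> u k \<le> v k \<and> v k \<le> b) \<and>
        (\<forall>i<n. \<forall>j<n. i \<noteq> j \<longrightarrow> v i \<le> u j \<or> v j \<le> u i) \<and>
        (\<Sum>k<n. v k - u k) < d \<longrightarrow> (\<Sum>k<n. norm (v k - u k)) < e"
    using \<open>e > 0\<close> by (intro exI[of _ e]) simp
qed

lemma abs_cont_on_continuous:
  assumes "abs_cont_on a b f"
  shows "continuous_on {a..b} f"
  unfolding continuous_on_iff
proof (intro ballI allI impI)
  fix x e :: real assume x: "x \<in> {a..b}" and "e > 0"
  obtain d where d: "d > 0" "\<And>(n::nat) (u::nat \<Rightarrow> real) v.
        (\<forall>k<n. a \<le> u k \<and> u k \<le> v k \<and> v k \<le> b) \<and>
        (\<forall>i<n. \<forall>j<n. i \<noteq> j \<longrightarrow> v i \<le> u j \<or> v j \<le> u i) \<and>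
        (\<Sum>k<n. v k - u k) < d \<Longrightarrow> (\<Sum>k<n. norm (f (v k) - f (u k))) < e"
    using assms \<open>e > 0\<close> unfolding abs_cont_on_def by blast
  show "\<exists>d>0. \<forall>x'\<in>{a..b}. dist x' x < d \<longrightarrow> dist (f x') (f x) < e"
  proof (intro exI[of _ d] conjI ballI impI d(1))
    fix y assume y: "y \<in> {a..b}" "dist y x < d"
    have "(\<Sum>k<1::nat. norm (f (max x y) - f (min x y))) < e"
      by (rule d(2)) (use x y in \<open>auto simp: dist_real_def min_def max_def\<close>)
    then show "dist (f y) (f x) < e"
      by (auto simp: dist_norm min_def max_def norm_minus_commute split: if_splits)
  qed
qed

lemma abs_cont_on_bounded:
  assumes "abs_cont_on a b f"
  obtains M where "M \<ge> 0" "\<And>x. x \<in> {a..b} \<Longrightarrow> norm (f x) \<le> M"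
proof -
  have "bounded (f ` {a..b})"
    by (intro compact_imp_bounded compact_continuous_image abs_cont_on_continuous[OF assms]) simp
  then obtain M where "\<forall>x\<in>{a..b}. norm (f x) \<le> M" by (auto simp: bounded_iff)
  then show thesis using that[of "\<bar>M\<bar>"] by (meson abs_ge_zero abs_ge_self order_trans)
qed

lemma abs_cont_on_bounded_linear:
  assumes "bounded_linear L" and f: "abs_cont_on a b f"
  shows "abs_cont_on a b (\<lambda>x. L (f x))"
proof -
  interpret bounded_linear L by fact
  obtain K where K: "\<And>x. norm (L x) \<le> norm x * K" using bounded by blast
  show ?thesis
  proof (rule abs_cont_on_dominated[OF f abs_cont_on_const])
    fix x y
    show "norm (L (f x) - L (f y)) \<le> K * (norm (f x - f y) + norm (0 - 0))"
      using K[of "f x - f y"] by (simp add: diff mult.commute)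
  qed
qed

lemma abs_cont_on_add:
  assumes "abs_cont_on a b f" "abs_cont_on a b g"
  shows "abs_cont_on a b (\<lambda>x. f x + g x)"
proof (rule abs_cont_on_dominated[OF assms])
  fix x y
  show "norm (f x + g x - (f y + g y)) \<le> 1 * (norm (f x - f y) + norm (g x - g y))"
    unfolding mult_1_left by (rule norm_diff_triangle_ineq)
qed

lemma abs_cont_on_sum:
  "(\<And>i. i \<in> I \<Longrightarrow> abs_cont_on a b (f i)) \<Longrightarrow> abs_cont_on a b (\<lambda>x. \<Sum>i\<in>I. f i x)"
proof (induction I rule: infinite_finite_induct)
  case (insert i I)
  then show ?case by (simp add: abs_cont_on_add)
qed (simp_all add: abs_cont_on_const)

lemma abs_cont_on_mult:
  fixes f g :: "real \<Rightarrow> 'b::real_normed_algebra"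
  assumes f: "abs_cont_on a b f" and g: "abs_cont_on a b g"
  shows "abs_cont_on a b (\<lambda>x. f x * g x)"
proof -
  obtain M where M: "M \<ge> 0" "\<And>x. x \<in> {a..b} \<Longrightarrow> norm (f x) \<le> M" using abs_cont_on_bounded[OF f] by metis
  obtain M' where M': "M' \<ge> 0" "\<And>x. x \<in> {a..b} \<Longrightarrow> norm (g x) \<le> M'" using abs_cont_on_bounded[OF g] by metis
  show ?thesis
  proof (rule abs_cont_on_dominated[OF f g])
    fix x y assume xy: "x \<in> {a..b}" "y \<in> {a..b}"
    have "norm (f x * g x - f y * g y) = norm ((f x - f y) * g x + f y * (g x - g y))"
      by (simp add: algebra_simps)
    also have "\<dots> \<le> norm (f x - f y) * norm (g x) + norm (f y) * norm (g x - g y)"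
      by (intro norm_triangle_le add_mono norm_mult_ineq)
    also have "\<dots> \<le> norm (f x - f y) * (M + M') + (M + M') * norm (g x - g y)"
      using M M' xy by (intro add_mono mult_left_mono mult_right_mono) (auto intro: add_increasing add_increasing2)
    finally show "norm (f x * g x - f y * g y) \<le> (M + M') * (norm (f x - f y) + norm (g x - g y))"
      by (simp add: algebra_simps)
  qed
qed

lemma abs_cont_on_power:
  fixes f :: "real \<Rightarrow> 'b::real_normed_algebra_1"
  assumes f: "abs_cont_on a b f"
  shows "abs_cont_on a b (\<lambda>x. f x ^ n)"
proof (induction n)
  case (Suc n)
  show ?case unfolding power_Suc by (rule abs_cont_on_mult[OF f Suc])
qed (simp add: abs_cont_on_const)

text \<open>The derivative and its bound are available only off \<open>E\<close>, so both functions
  are set to 0 on \<open>E\<close> before integrals are compared. The endpoints are kept apart from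
  \<open>a\<close> and \<open>b\<close> because the segment between t and t + h may lie on either
  side of t.\<close>

lemma abs_cont_on_increment_bound:
  fixes F :: "real \<Rightarrow> 'a::banach"
  assumes ac: "abs_cont_on a b F" and E: "negligible E"
    and deriv: "\<And>x. x \<in> {a..b} - E \<Longrightarrow> (F has_vector_derivative f x) (at x within {a..b})"
    and bound: "\<And>x. x \<in> {lo..hi} - E \<Longrightarrow> norm (f x) \<le> k x"
    and k: "k integrable_on {lo..hi}" and sub: "{lo..hi} \<subseteq> {a..b}" and le: "lo \<le> hi"
  shows "norm (F hi - F lo) \<le> integral {lo..hi} k"
proof -
  have lohi: "a \<le> lo" "hi \<le> b" using sub le by auto
  define f0 where "f0 x = (if x \<in> E then 0 else f x)" for x
  define k0 where "k0 x = (if x \<in> E then 0 else k x)" for x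
  have "(f has_integral (F hi - F lo)) {lo..hi}"
  proof (rule abs_cont_on_has_integral_derivative[OF abs_cont_on_subset[OF ac lohi] le E])
    show "(F has_vector_derivative f x) (at x within {lo..hi})" if "x \<in> {lo..hi} - E" for x
      by (rule has_vector_derivative_within_subset[OF deriv]) (use that lohi in auto)
  qed
  then have f0: "(f0 has_integral (F hi - F lo)) {lo..hi}"
    by (rule has_integral_spike[OF E, rotated]) (simp add: f0_def)
  have "(k has_integral integral {lo..hi} k) {lo..hi}" using k by (rule integrable_integral)
  then have k0: "(k0 has_integral integral {lo..hi} k) {lo..hi}"
    by (rule has_integral_spike[OF E, rotated]) (simp add: k0_def)
  have "norm (integral {lo..hi} f0) \<le> integral {lo..hi} k0"
    by (rule integral_norm_bound_integral) (use f0 k0 bound in \<open>auto simp: f0_def k0_def\<close>)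
  then show ?thesis using f0 k0 by (simp add: integral_unique)
qed

subsection \<open>Lebesgue points\<close>

text \<open>Lebesgue differentiation applies to each scalar function \<open>norm (f s - q)\<close>
  with q in a countable dense set, and the union of the exceptional sets is negligible. Replacing
  \<open>f t\<close> by a nearby q costs e / 3 in the limit of the averages and e / 3 in the
  integrand.\<close>

lemma lebesgue_point_one_sided:
  fixes f :: "real \<Rightarrow> 'a::euclidean_space"
  assumes "\<And>c d. f absolutely_integrable_on {c..d}"
  obtains E where "negligible E"
    "\<And>t e. t \<notin> E \<Longrightarrow> e > 0 \<Longrightarrow> \<exists>d>0. \<forall>h. 0 < h \<and> h < d \<longrightarrow> integral {t..t + h} (\<lambda>s. norm (f s - f t)) / h < e"
proof -
  obtain D :: "'a set" where D: "countable D" "\<And>X. open X \<Longrightarrow> X \<noteq> {} \<Longrightarrow> \<exists>d\<in>D. d \<in> X"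
    using countable_dense_exists by blast
  have int: "(\<lambda>s. norm (f s - q)) integrable_on {c..d}" for q c d
  proof -
    have "(\<lambda>s. f s - q) absolutely_integrable_on {c..d}"
      by (intro set_integral_diff(1) assms absolutely_integrable_continuous_real continuous_on_const)
    then show ?thesis by (simp add: absolutely_integrable_on_def)
  qed
  have "\<exists>N. negligible N \<and> (\<forall>x e. x \<notin> N \<and> 0 < e \<longrightarrow> (\<exists>d>0. \<forall>h. 0 < h \<and> h < d \<longrightarrow>
      norm (integral (cbox x (x + h *\<^sub>R One)) (\<lambda>s. norm (f s - q)) /\<^sub>R h ^ DIM(real) - norm (f x - q)) < e))" for q
    using integrable_ccontinuous_explicit[of "\<lambda>s. norm (f s - q)"] int by (metis box_real(2))
  then obtain N where N: "\<And>q. negligible (N q)"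
    and lim: "\<And>q x e. x \<notin> N q \<Longrightarrow> 0 < e \<Longrightarrow> \<exists>d>0. \<forall>h. 0 < h \<and> h < d \<longrightarrow>
      norm (integral (cbox x (x + h *\<^sub>R One)) (\<lambda>s. norm (f s - q)) /\<^sub>R h ^ DIM(real) - norm (f x - q)) < e"
    by metis
  show thesis
  proof (rule that)
    show "negligible (\<Union>(N ` D))"
      using D(1) N by (intro negligible_countable_Union) auto
    fix t e :: real assume t: "t \<notin> \<Union>(N ` D)" and "e > 0"
    obtain q where q: "q \<in> D" "norm (f t - q) < e / 3"
      using D(2)[of "ball (f t) (e / 3)"] \<open>e > 0\<close> by (auto simp: dist_norm)
    obtain d where d: "d > 0" "\<And>h. 0 < h \<Longrightarrow> h < d \<Longrightarrow>
        norm (integral (cbox t (t + h *\<^sub>R One)) (\<lambda>s. norm (f s - q)) /\<^sub>R h ^ DIM(real) - norm (f t - q)) < e / 3"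
    proof -
      have "t \<notin> N q" "e / 3 > 0" using t q \<open>e > 0\<close> by auto
      from lim[OF this] show thesis using that by blast
    qed
    show "\<exists>d>0. \<forall>h. 0 < h \<and> h < d \<longrightarrow> integral {t..t + h} (\<lambda>s. norm (f s - f t)) / h < e"
    proof (intro exI[of _ d] conjI allI impI d(1))
      fix h assume h: "0 < h \<and> h < d"
      have avg: "integral {t..t + h} (\<lambda>s. norm (f s - q)) / h < 2 * e / 3"
      proof -
        have "cbox t (t + h *\<^sub>R One) = {t..t + h}" "h ^ DIM(real) = h" by simp_all
        then have "norm (integral {t..t + h} (\<lambda>s. norm (f s - q)) /\<^sub>R h - norm (f t - q)) < e / 3"
          using d(2)[of h] h by metis
        then have "\<bar>integral {t..t + h} (\<lambda>s. norm (f s - q)) / h - norm (f t - q)\<bar> < e / 3"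
          unfolding real_norm_def real_scaleR_def divide_inverse_commute .
        then show ?thesis using q(2) by linarith
      qed
      have "integral {t..t + h} (\<lambda>s. norm (f s - f t)) \<le> integral {t..t + h} (\<lambda>s. norm (f s - q) + norm (f t - q))"
      proof (rule integral_le)
        show "norm (f s - f t) \<le> norm (f s - q) + norm (f t - q)" for s
          using norm_triangle_ineq4[of "f s - q" "f t - q"] by simp
      qed (use int in \<open>auto intro!: integrable_add\<close>)
      also have "\<dots> = integral {t..t + h} (\<lambda>s. norm (f s - q)) + h * norm (f t - q)"
        using h by (subst integral_add) (auto intro: int)
      finally have "integral {t..t + h} (\<lambda>s. norm (f s - f t)) / h \<le> 
          (integral {t..t + h} (\<lambda>s. norm (f s - q)) + h * norm (f t - q)) / h"
        using h by (intro divide_right_mono) auto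
      also have "\<dots> = integral {t..t + h} (\<lambda>s. norm (f s - q)) / h + norm (f t - q)"
        using h by (simp add: add_divide_distrib)
      also have "\<dots> < e" using avg q(2) by linarith
      finally show "integral {t..t + h} (\<lambda>s. norm (f s - f t)) / h < e" .
    qed
  qed
qed

text \<open>Extension by 0 makes one-sided averages meaningful at every real point, and left
  averages are right averages of the reflected function. The restriction on h keeps the segment
  inside \<open>{a..b}\<close>, where the extension agrees with \<open>f\<close>.\<close>

theorem lebesgue_point_ae:
  fixes f :: "real \<Rightarrow> 'a::euclidean_space"
  assumes f: "f absolutely_integrable_on {a..b}"
  shows "\<exists>E. negligible E \<and> (\<forall>t\<in>{a..b} - E.
       ((\<lambda>h. integral {min t (t + h)..max t (t + h)} (\<lambda>s. norm (f s - f t)) / \<bar>h\<bar>) \<longlongrightarrow> 0)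
         (at 0 within {h. t + h \<in> {a..b}}))"
proof -
  define F where "F s = (if s \<in> {a..b} then f s else 0)" for s
  have "F absolutely_integrable_on UNIV"
    using f unfolding F_def by (simp only: absolutely_integrable_restrict_UNIV)
  then have F: "F absolutely_integrable_on {c..d}" for c d
    by (rule set_integrable_subset) auto
  have Fm: "(\<lambda>s. F (- s)) absolutely_integrable_on {c..d}" for c d
    using F[of "- d" "- c"] by (subst absolutely_integrable_reflect_real[symmetric]) simp
  have diff_int: "(\<lambda>s. norm (F s - q)) integrable_on {c..d}" for q c d
  proof -
    have "(\<lambda>s. F s - q) absolutely_integrable_on {c..d}"
      by (intro set_integral_diff(1) F absolutely_integrable_continuous_real continuous_on_const)
    then show ?thesis by (simp add: absolutely_integrable_on_def)
  qed
  obtain E1 where E1: "negligible E1" "\<And>t e. t \<notin> E1 \<Longrightarrow> e > 0 \<Longrightarrow> 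
      \<exists>d>0. \<forall>h. 0 < h \<and> h < d \<longrightarrow> integral {t..t + h} (\<lambda>s. norm (F s - F t)) / h < e"
    using lebesgue_point_one_sided[of F] F by metis
  obtain E2 where E2: "negligible E2" "\<And>t e. t \<notin> E2 \<Longrightarrow> e > 0 \<Longrightarrow> 
      \<exists>d>0. \<forall>h. 0 < h \<and> h < d \<longrightarrow> integral {t..t + h} (\<lambda>s. norm (F (- s) - F (- t))) / h < e"
    using lebesgue_point_one_sided[of "\<lambda>s. F (- s)"] Fm by metis
  show ?thesis
  proof (intro exI[of _ "E1 \<union> uminus ` E2"] conjI ballI)
    have "negligible (uminus ` E2)"
      by (rule negligible_differentiable_image_negligible[OF order_refl E2(1)])
         (simp add: differentiable_on_def)
    then show "negligible (E1 \<union> uminus ` E2)" using E1(1) by (rule negligible_Un[rotated])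
    fix t assume t: "t \<in> {a..b} - (E1 \<union> uminus ` E2)"
    show "((\<lambda>h. integral {min t (t + h)..max t (t + h)} (\<lambda>s. norm (f s - f t)) / \<bar>h\<bar>) \<longlongrightarrow> 0)
         (at 0 within {h. t + h \<in> {a..b}})"
      unfolding Lim_within
    proof (intro allI impI)
      fix e :: real assume "e > 0"
      obtain d1 where d1: "d1 > 0" "\<And>h. 0 < h \<Longrightarrow> h < d1 \<Longrightarrow> integral {t..t + h} (\<lambda>s. norm (F s - F t)) / h < e"
        using E1(2)[of t e] t \<open>e > 0\<close> by blast
      have "- t \<notin> E2" using t by (metis DiffD2 UnCI add.inverse_inverse image_eqI)
      then obtain d2 where d2: "d2 > 0" "\<And>h. 0 < h \<Longrightarrow> h < d2 \<Longrightarrow> integral {- t..- t + h} (\<lambda>s. norm (F (- s) - F t)) / h < e"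
        using E2(2)[of "- t" e] \<open>e > 0\<close> by auto
      show "\<exists>d>0. \<forall>h\<in>{h. t + h \<in> {a..b}}. 0 < dist h 0 \<and> dist h 0 < d \<longrightarrow>
          dist (integral {min t (t + h)..max t (t + h)} (\<lambda>s. norm (f s - f t)) / \<bar>h\<bar>) 0 < e"
      proof (intro exI[of _ "min d1 d2"] conjI ballI impI)
        fix h assume h: "h \<in> {h. t + h \<in> {a..b}}" "0 < dist h 0 \<and> dist h 0 < min d1 d2"
        let ?I = "integral {min t (t + h)..max t (t + h)}"
        have eq: "?I (\<lambda>s. norm (f s - f t)) = ?I (\<lambda>s. norm (F s - F t))"
          by (rule integral_cong) (use h t in \<open>auto simp: F_def\<close>)
        have "?I (\<lambda>s. norm (F s - F t)) / \<bar>h\<bar> < e"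
        proof (cases "h > 0")
          case True
          then show ?thesis using d1(2)[of h] h by simp
        next
          case False
          have "integral {- t..- t + - h} (\<lambda>s. norm (F (- s) - F t)) = integral {t + h..t} (\<lambda>s. norm (F s - F t))"
            using Henstock_Kurzweil_Integration.integral_reflect_real[of t "t + h" "\<lambda>s. norm (F s - F t)"] by (simp add: add.commute)
          moreover have "0 < - h" "- h < d2" using h False by auto
          ultimately show ?thesis using d2(2)[of "- h"] by simp
        qed
        moreover have "?I (\<lambda>s. norm (F s - F t)) \<ge> 0"
          using F by (intro Henstock_Kurzweil_Integration.integral_nonneg diff_int) auto
        ultimately show "dist (?I (\<lambda>s. norm (f s - f t)) / \<bar>h\<bar>) 0 < e"
          by (simp add: eq)
      qed (use d1 d2 in simp)
    qed
  qed
qed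

text \<open>The operator estimates are made in the Euclidean norm and transferred to the prescribed
  norm \<open>N\<close> at the end. The lower bound comes from the minimum of \<open>N\<close> on
  the unit sphere.\<close>

lemma is_norm_equivalent:
  fixes N :: "'a::euclidean_space \<Rightarrow> real"
  assumes "is_norm N"
  obtains c C where "c > 0" "C > 0" "\<And>x. norm x \<le> c * N x" "\<And>x. N x \<le> C * norm x"
proof -
  have N0: "N x = 0 \<longleftrightarrow> x = 0" and tri: "N (x + y) \<le> N x + N y" and hom: "N (r *\<^sub>R x) = \<bar>r\<bar> * N x" for x y r
    using assms by (auto simp: is_norm_def)
  have neg: "N (- x) = N x" for x using hom[of "-1" x] by simp
  have nonneg: "N x \<ge> 0" for x using tri[of x "- x"] N0[of 0] neg[of x] by simp
  have sum: "N (sum f A) \<le> (\<Sum>i\<in>A. N (f i))" for f and A :: "'a set"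
  proof (induction A rule: infinite_finite_induct)
    case (insert i A)
    then show ?case using tri[of "f i" "sum f A"] by simp
  qed (use N0[of 0] in auto)
  define C where "C = (\<Sum>b\<in>Basis. N b) + 1"
  have C: "C > 0" unfolding C_def using nonneg by (simp add: add_nonneg_pos sum_nonneg)
  have up: "N x \<le> C * norm x" for x
  proof -
    have "N x = N (\<Sum>b\<in>Basis. (x \<bullet> b) *\<^sub>R b)" by (simp add: euclidean_representation)
    also have "\<dots> \<le> (\<Sum>b\<in>Basis. N ((x \<bullet> b) *\<^sub>R b))" by (rule sum)
    also have "\<dots> \<le> (\<Sum>b\<in>Basis. norm x * N b)"
      by (intro sum_mono) (auto simp: hom intro!: mult_right_mono nonneg Basis_le_norm)
    also have "\<dots> = norm x * (\<Sum>b\<in>Basis. N b)" by (rule sum_distrib_left[symmetric])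
    also have "\<dots> \<le> norm x * C" by (intro mult_left_mono) (simp_all add: C_def)
    also have "\<dots> = C * norm x" by (rule mult.commute)
    finally show ?thesis .
  qed
  have lip: "\<bar>N x - N y\<bar> \<le> C * norm (x - y)" for x y
    using tri[of "x - y" y] tri[of "y - x" x] up[of "x - y"] neg[of "x - y"] by simp
  have cont: "continuous_on (sphere 0 1) N"
    unfolding continuous_on_iff
  proof (intro ballI allI impI)
    fix x :: 'a and e :: real assume "e > 0"
    show "\<exists>d>0. \<forall>x'\<in>sphere 0 1. dist x' x < d \<longrightarrow> dist (N x') (N x) < e"
    proof (intro exI[of _ "e / C"] conjI ballI impI)
      fix y assume "dist y x < e / C"
      then have "C * norm (y - x) < e" using C by (simp add: dist_norm field_simps)
      then show "dist (N y) (N x) < e" using lip[of y x] by (simp add: dist_real_def)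
    qed (use \<open>e > 0\<close> C in simp)
  qed
  have "sphere (0::'a) 1 \<noteq> {}" by simp
  then obtain z where z: "z \<in> sphere 0 1" "\<And>y. y \<in> sphere 0 1 \<Longrightarrow> N z \<le> N y"
    using continuous_attains_inf[OF compact_sphere _ cont] by blast
  have "N z > 0" using z N0[of z] nonneg[of z] by (cases "z = 0") (auto simp: less_le)
  have low: "norm x \<le> (1 / N z) * N x" for x
  proof (cases "x = 0")
    case False
    then have "N z \<le> N ((1 / norm x) *\<^sub>R x)" by (intro z) simp
    also have "\<dots> = N x / norm x" by (simp add: hom)
    finally show ?thesis using False \<open>N z > 0\<close> by (simp add: field_simps)
  qed (use nonneg \<open>N z > 0\<close> in simp)
  show thesis by (rule that[of "1 / N z" C]) (use \<open>N z > 0\<close> C up low in auto)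
qed

subsection \<open>Logarithm and Dynkin's formula in a nilpotent algebra\<close>

definition commutator :: "'a::ring \<Rightarrow> 'a \<Rightarrow> 'a" where
  "commutator x y = x * y - y * x"

text \<open>The polynomial \<open>log (1 + u)\<close>, truncated at degree \<open>m\<close>.\<close>
definition trunc_log :: "nat \<Rightarrow> 'a::real_algebra_1 \<Rightarrow> 'a" where
  "trunc_log m u = (\<Sum>n<m. ((-1) ^ n / real (Suc n)) *\<^sub>R u ^ Suc n)"

text \<open>A binomial theorem: the hypothesis splits left multiplication by u into right
  multiplication by u and the map sending x to T x (1 + u). In the application T x = G x G^-1 - x
  with G = 1 + u.\<close>

lemma power_times_eq_binomial_sum:
  fixes u x :: "'b::real_algebra_1"
  assumes T: "\<And>x. u * x = x * u + T x * (1 + u)"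
  shows "u ^ j * x = (\<Sum>i\<le>j. real (j choose i) *\<^sub>R ((T ^^ i) x * ((1 + u) ^ i * u ^ (j - i))))"
proof (induction j)
  case 0
  then show ?case by simp
next
  case (Suc j)
  let ?G = "1 + u"
  have comm: "u * ?G ^ i = ?G ^ i * u" for i
    by (rule power_commuting_commutes[symmetric]) (simp add: algebra_simps)
  let ?f = "\<lambda>i k. (T ^^ i) x * (?G ^ i * u ^ k)"
  have step: "u * ?f i k = ?f i (Suc k) + ?f (Suc i) k" for i k
  proof -
    have "u * ?f i k = (u * (T ^^ i) x) * (?G ^ i * u ^ k)"
      by (simp add: mult.assoc)
    also have "\<dots> = (T ^^ i) x * (u * ?G ^ i * u ^ k) + T ((T ^^ i) x) * (?G * ?G ^ i * u ^ k)"
      by (subst T) (simp add: algebra_simps)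
    finally show ?thesis
      by (simp only: comm) (simp add: mult.assoc)
  qed
  have "u ^ Suc j * x = u * (\<Sum>i\<le>j. real (j choose i) *\<^sub>R ?f i (j - i))"
    by (simp add: mult.assoc Suc.IH)
  also have "\<dots> = (\<Sum>i\<le>j. real (j choose i) *\<^sub>R (?f i (Suc j - i) + ?f (Suc i) (j - i)))"
    unfolding sum_distrib_left
    by (intro sum.cong refl) (simp add: step Suc_diff_le del: power_Suc funpow.simps)
  also have "\<dots> = (\<Sum>i\<le>j. real (j choose i) *\<^sub>R ?f i (Suc j - i))
      + (\<Sum>i\<le>j. real (j choose i) *\<^sub>R ?f (Suc i) (j - i))"
    by (simp add: scaleR_add_right sum.distrib)
  also have "(\<Sum>i\<le>j. real (j choose i) *\<^sub>R ?f i (Suc j - i))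
      = (\<Sum>i\<le>Suc j. real (j choose i) *\<^sub>R ?f i (Suc j - i))"
    by simp
  also have "\<dots> = ?f 0 (Suc j) + (\<Sum>i\<le>j. real (j choose Suc i) *\<^sub>R ?f (Suc i) (j - i))"
    by (subst sum.atMost_Suc_shift) (simp del: power_Suc funpow.simps)
  also have "\<dots> + (\<Sum>i\<le>j. real (j choose i) *\<^sub>R ?f (Suc i) (j - i))
     = ?f 0 (Suc j) + (\<Sum>i\<le>j. real (Suc j choose Suc i) *\<^sub>R ?f (Suc i) (Suc j - Suc i))"
    by (simp add: sum.distrib scaleR_add_left del: power_Suc funpow.simps)
  also have "\<dots> = (\<Sum>i\<le>Suc j. real (Suc j choose i) *\<^sub>R ?f i (Suc j - i))"
    unfolding sum.atMost_Suc_shift[of _ j] by (simp del: power_Suc funpow.simps binomial_Suc_Suc)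
  finally show ?case .
qed

text \<open>The sum is the beginning of the series of (1 + u)^-(i + 1). Only divisibility of the
  remainder by u^K matters, since nilpotency will annihilate it, so the coefficients
  \<open>y\<close> are left unspecified.\<close>

lemma negative_binomial_truncated:
  fixes u :: "'b::real_algebra_1"
  shows "\<exists>y. (1 + u) ^ Suc i * (\<Sum>k<K. ((-1) ^ k * real ((k + i) choose i)) *\<^sub>R u ^ k) = 1 + u ^ K * (\<Sum>n<Suc i. y n *\<^sub>R (1 + u) ^ n)"
proof (induction i)
  case 0
  have "(1 + u) * (\<Sum>k<K. (-1) ^ k *\<^sub>R u ^ k) = 1 - (-1) ^ K *\<^sub>R u ^ K"
    by (induction K) (auto simp: algebra_simps)
  then show ?case
    by (intro exI[of _ "\<lambda>_. - ((-1) ^ K)"]) simp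
next
  case (Suc i)
  let ?c = "\<lambda>i k. (-1) ^ k * real ((k + i) choose i)"
  have step: "(1 + u) * (\<Sum>k<K. ?c (Suc i) k *\<^sub>R u ^ k)
     = (\<Sum>k<K. ?c i k *\<^sub>R u ^ k) + (- ((-1) ^ K) * real ((K + i) choose (Suc i))) *\<^sub>R u ^ K"
  proof (induction K)
    case 0
    then show ?case by simp
  next
    case (Suc K)
    have "(1 + u) * (\<Sum>k<Suc K. ?c (Suc i) k *\<^sub>R u ^ k) =
       (\<Sum>k<K. ?c i k *\<^sub>R u ^ k) + (- ((-1) ^ K) * real ((K + i) choose (Suc i))) *\<^sub>R u ^ K
        + (1 + u) * (?c (Suc i) K *\<^sub>R u ^ K)"
      using Suc by (simp add: distrib_left)
    also have "\<dots> = (\<Sum>k<Suc K. ?c i k *\<^sub>R u ^ k) + ?c (Suc i) K *\<^sub>R u ^ Suc K"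
      by (simp add: algebra_simps)
    finally show ?case by simp
  qed
  obtain y where y: "(1 + u) ^ Suc i * (\<Sum>k<K. ?c i k *\<^sub>R u ^ k) = 1 + u ^ K * (\<Sum>n<Suc i. y n *\<^sub>R (1 + u) ^ n)"
    using Suc by blast
  define d where "d = - ((-1) ^ K) * real ((K + i) choose (Suc i))"
  have comm: "(1 + u) ^ n * u ^ K = u ^ K * (1 + u) ^ n" for n
    by (rule power_commuting_commutes) (simp add: algebra_simps power_commutes)
  have "(1 + u) ^ Suc (Suc i) * (\<Sum>k<K. ?c (Suc i) k *\<^sub>R u ^ k)
     = (1 + u) ^ Suc i * ((1 + u) * (\<Sum>k<K. ?c (Suc i) k *\<^sub>R u ^ k))"
    by (simp only: power_Suc2 mult.assoc)
  also have "\<dots> = (1 + u) ^ Suc i * (\<Sum>k<K. ?c i k *\<^sub>R u ^ k) + d *\<^sub>R ((1 + u) ^ Suc i * u ^ K)"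
    by (simp only: step d_def distrib_left mult_scaleR_right)
  also have "\<dots> = 1 + u ^ K * ((\<Sum>n<Suc i. y n *\<^sub>R (1 + u) ^ n) + d *\<^sub>R (1 + u) ^ Suc i)"
    by (simp only: y comm distrib_left mult_scaleR_right add.assoc)
  also have "(\<Sum>n<Suc i. y n *\<^sub>R (1 + u) ^ n) + d *\<^sub>R (1 + u) ^ Suc i
      = (\<Sum>n<Suc (Suc i). (y(Suc i := d)) n *\<^sub>R (1 + u) ^ n)"
    by (simp del: power_Suc)
  finally show ?case by blast
qed

lemma has_vector_derivative_power:
  fixes u :: "real \<Rightarrow> 'b::real_normed_algebra_1"
  assumes "(u has_vector_derivative u') (at t within S)"
  shows "((\<lambda>t. u t ^ n) has_vector_derivative (\<Sum>j<n. u t ^ j * u' * u t ^ (n - Suc j))) (at t within S)"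
proof (induction n)
  case 0
  then show ?case by (simp add: has_vector_derivative_const)
next
  case (Suc n)
  have eq: "u t ^ j * u' * u t ^ (Suc n - Suc j) = u t ^ j * u' * u t ^ (n - Suc j) * u t" if "j < n" for j
  proof -
    have "Suc n - Suc j = Suc (n - Suc j)" using that by simp
    then show ?thesis by (simp only: power_Suc2 mult.assoc)
  qed
  have "(\<Sum>j<Suc n. u t ^ j * u' * u t ^ (Suc n - Suc j)) =
      u t ^ n * u' + (\<Sum>j<n. u t ^ j * u' * u t ^ (n - Suc j)) * u t"
    using sum.cong[OF refl eq, of "{..<n}"] by (simp add: sum_distrib_right)
  with has_vector_derivative_mult[OF Suc assms] show ?case
    by (simp add: power_Suc2 add.commute del: power_Suc)
qed

text \<open>The model is a finite flag, with \<open>J k\<close> the operators that raise it by at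
  least k steps. A filtration, rather than nilpotency of single elements, controls products and
  commutators of different elements by counting degrees.\<close>

locale nilpotent_filtration =
  fixes J :: "nat \<Rightarrow> 'b::{real_normed_algebra_1,banach} set" and m :: nat
  assumes subspace_J: "subspace (J k)"
    and mult_J: "a \<in> J i \<Longrightarrow> b \<in> J j \<Longrightarrow> a * b \<in> J (i + j)"
    and Suc_J: "J (Suc k) \<subseteq> J k"
    and one_J: "1 \<in> J 0"
    and J_Suc_m: "J (Suc m) \<subseteq> {0}"
begin

lemma J_antimono: "i \<le> j \<Longrightarrow> J j \<subseteq> J i"
  by (induction j rule: dec_induct) (use Suc_J in auto)

lemma J_zero: "x \<in> J k \<Longrightarrow> m < k \<Longrightarrow> x = 0"
  using J_antimono[of "Suc m" k] J_Suc_m by auto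

lemma add_J: "x \<in> J k \<Longrightarrow> y \<in> J k \<Longrightarrow> x + y \<in> J k"
  and diff_J: "x \<in> J k \<Longrightarrow> y \<in> J k \<Longrightarrow> x - y \<in> J k"
  and scaleR_J: "x \<in> J k \<Longrightarrow> c *\<^sub>R x \<in> J k"
  and zero_J: "0 \<in> J k"
  and uminus_J: "x \<in> J k \<Longrightarrow> - x \<in> J k"
  and sum_J: "(\<And>i. i \<in> A \<Longrightarrow> f i \<in> J k) \<Longrightarrow> sum f A \<in> J k"
  using subspace_J[of k]
  by (auto simp: subspace_add subspace_diff subspace_scale subspace_0 subspace_neg subspace_sum)

lemma mult_J_le: "a \<in> J i \<Longrightarrow> b \<in> J j \<Longrightarrow> k \<le> i + j \<Longrightarrow> a * b \<in> J k"
  using mult_J[of a i b j] J_antimono[of k "i + j"] by auto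

lemma J1_J0: "x \<in> J 1 \<Longrightarrow> x \<in> J 0"
  using J_antimono[of 0 1] by auto

lemma power_J: "x \<in> J k \<Longrightarrow> x ^ n \<in> J (n * k)"
  by (induction n) (auto simp: one_J mult_J)

lemma power_J0: "x \<in> J 0 \<Longrightarrow> x ^ n \<in> J 0"
  using power_J[of x 0 n] by simp

lemma exp_eq_sum: 
  assumes "x \<in> J 1"
  shows "exp x = (\<Sum>n\<le>m. x ^ n /\<^sub>R fact n)"
  unfolding exp_def
proof (rule suminf_finite)
  fix n assume "n \<notin> {..m}"
  then show "x ^ n /\<^sub>R fact n = 0"
    using J_zero[OF power_J[OF assms, of n]] by simp
qed simp

lemma exp_J0: "x \<in> J 1 \<Longrightarrow> exp x \<in> J 0"
  unfolding exp_eq_sum by (intro sum_J scaleR_J power_J0 J1_J0)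

lemma exp_minus_one_J1:
  assumes "x \<in> J 1" 
  shows "exp x - 1 \<in> J 1"
proof -
  have "exp x = (\<Sum>n<Suc m. x ^ n /\<^sub>R fact n)"
    using exp_eq_sum[OF assms] by (simp add: lessThan_Suc_atMost)
  also have "\<dots> = 1 + (\<Sum>n<m. x ^ Suc n /\<^sub>R fact (Suc n))"
    by (subst sum.lessThan_Suc_shift) simp
  also have "\<dots> - 1 = (\<Sum>n<m. x ^ Suc n /\<^sub>R fact (Suc n))" by simp
  also have "\<dots> \<in> J 1"
    by (intro sum_J scaleR_J) (use power_J[OF assms] J_antimono[of 1] in fastforce)
  finally show ?thesis .
qed

text \<open>For G' = R G the logarithm of G has derivative log (Ad G) / (Ad G - 1) applied to R, and
  T = Ad G - 1. Moving R to the left in the derivative of each u^n produces binomial coefficients.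
  After exchanging sums, the coefficient of T^i R is G^(i + 1) times the truncated series of its
  inverse, up to terms of too high degree.\<close>

lemma trunc_log_has_vector_derivative:
  fixes u :: "real \<Rightarrow> 'b"
  defines "G \<equiv> \<lambda>t. 1 + u t"
  assumes deriv: "(u has_vector_derivative R * G t) (at t within S)"
    and u: "u t \<in> J 1" and R: "R \<in> J 1"
    and H: "G t * H = 1" "H * G t = 1" "H \<in> J 0"
  defines "T \<equiv> \<lambda>x. G t * x * H - x"
  shows "((\<lambda>t. trunc_log m (u t)) has_vector_derivative
            (\<Sum>i<m. ((-1) ^ i / real (Suc i)) *\<^sub>R (T ^^ i) R)) (at t within S)"
proof -
  let ?u = "u t" and ?G = "G t"
  have u_eq: "?u = ?G - 1" by (simp add: G_def)
  have commG: "?u ^ k * ?G ^ i = ?G ^ i * ?u ^ k" for i k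
    by (intro power_commuting_commutes power_commuting_commutes[symmetric]) 
       (simp add: G_def algebra_simps)
  \<comment> \<open>This is G x = (G x H) G with G = 1 + u and G x H = x + T x.\<close>
  have TuG: "?u * x = x * ?u + T x * (1 + ?u)" for x
    using H by (simp add: T_def u_eq algebra_simps mult.assoc)
  have G0: "?G \<in> J 0"
    unfolding G_def by (intro add_J one_J J1_J0 u)
  \<comment> \<open>T x is the commutator of u with x, multiplied by H, and u lies in
    \<open>J 1\<close>; hence T gains one degree.\<close>
  have TJ: "T x \<in> J (Suc k)" if "x \<in> J k" for x k
  proof -
    have "T x = (?u * x - x * ?u) * H"
      using H by (simp add: T_def u_eq algebra_simps mult.assoc)
    also have "\<dots> \<in> J (Suc k)"
      by (rule mult_J_le[OF diff_J[of _ "Suc k"] H(3)])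
         (auto intro!: mult_J_le[OF u that] mult_J_le[OF that u])
    finally show ?thesis .
  qed
  have TiR: "(T ^^ i) R \<in> J (Suc i)" for i
    by (induction i) (use R in \<open>auto intro: TJ\<close>)
  define A where "A i n = (T ^^ i) R * (?G ^ Suc i * ?u ^ (n - i))" for i n
  have inner: "(\<Sum>j<Suc n. ?u ^ j * (R * ?G) * ?u ^ (Suc n - Suc j))
     = (\<Sum>i\<le>n. real (Suc n choose Suc i) *\<^sub>R A i n)" for n
  proof -
    have "?u ^ j * (R * ?G) * ?u ^ (Suc n - Suc j) = (\<Sum>i\<le>n. real (j choose i) *\<^sub>R A i n)"
      if "j < Suc n" for j
    proof -
      have "?u ^ j * (R * ?G) * ?u ^ (Suc n - Suc j) = (?u ^ j * R) * (?G * ?u ^ (n - j))"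
        by (simp add: mult.assoc)
      also have "\<dots> = (\<Sum>i\<le>j. real (j choose i) *\<^sub>R ((T ^^ i) R * (?G ^ i * ?u ^ (j - i)))) * (?G * ?u ^ (n - j))"
        using power_times_eq_binomial_sum[of ?u T j R, OF TuG] by (simp add: G_def)
      also have "\<dots> = (\<Sum>i\<le>j. real (j choose i) *\<^sub>R A i n)"
        unfolding sum_distrib_right
      proof (intro sum.cong refl)
        fix i assume "i \<in> {..j}"
        then have i: "i \<le> j" by simp
        have "?G ^ i * ?u ^ (j - i) * (?G * ?u ^ (n - j)) = ?G ^ i * (?u ^ (j - i) * ?G ^ 1) * ?u ^ (n - j)"
          by (simp add: mult.assoc)
        also have "\<dots> = (?G ^ i * ?G ^ 1) * (?u ^ (j - i) * ?u ^ (n - j))"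
          by (subst commG) (simp add: mult.assoc)
        also have "\<dots> = ?G ^ Suc i * ?u ^ (n - i)"
          using i that by (simp add: power_add[symmetric] power_Suc2 del: power_Suc)
        finally show "real (j choose i) *\<^sub>R ((T ^^ i) R * (?G ^ i * ?u ^ (j - i))) * (?G * ?u ^ (n - j)) =
            real (j choose i) *\<^sub>R A i n"
          by (simp add: A_def mult.assoc)
      qed
      also have "\<dots> = (\<Sum>i\<le>n. real (j choose i) *\<^sub>R A i n)"
        by (rule sum.mono_neutral_left) (use that in \<open>auto simp: binomial_eq_0\<close>)
      finally show ?thesis .
    qed
    then have "(\<Sum>j<Suc n. ?u ^ j * (R * ?G) * ?u ^ (Suc n - Suc j))
       = (\<Sum>j<Suc n. \<Sum>i\<le>n. real (j choose i) *\<^sub>R A i n)"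
      by (intro sum.cong) auto
    also have "\<dots> = (\<Sum>i\<le>n. (\<Sum>j<Suc n. real (j choose i)) *\<^sub>R A i n)"
      by (subst sum.swap) (simp only: scaleR_sum_left)
    also have "\<dots> = (\<Sum>i\<le>n. real (Suc n choose Suc i) *\<^sub>R A i n)"
    proof (intro sum.cong refl)
      fix i
      \<comment> \<open>Hockey-stick identity.\<close>
      have "(\<Sum>j<Suc n. real (j choose i)) = real (Suc n choose Suc i)"
        using sum_choose_upper[of i n] by (simp add: lessThan_Suc_atMost atMost_atLeast0 flip: of_nat_sum)
      then show "(\<Sum>j<Suc n. real (j choose i)) *\<^sub>R A i n = real (Suc n choose Suc i) *\<^sub>R A i n"
        by simp
    qed
    finally show ?thesis .
  qed
  \<comment> \<open>The factor 1 / (n + 1) of the logarithm is absorbed here and becomes 1 / (i +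
    1), independent of n, so the inner sum can be evaluated.\<close>
  have choose: "real (Suc n choose Suc i) / real (Suc n) = real (n choose i) / real (Suc i)" for n i
    using Suc_times_binomial_eq[of n i] by (simp add: field_simps flip: of_nat_mult)
  have "((\<lambda>t. trunc_log m (u t)) has_vector_derivative
     (\<Sum>n<m. ((-1) ^ n / real (Suc n)) *\<^sub>R (\<Sum>j<Suc n. ?u ^ j * (R * ?G) * ?u ^ (Suc n - Suc j)))) (at t within S)"
    unfolding trunc_log_def
    by (intro has_vector_derivative_sum bounded_linear.has_vector_derivative[OF bounded_linear_scaleR_right] has_vector_derivative_power deriv)
  also have "(\<Sum>n<m. ((-1) ^ n / real (Suc n)) *\<^sub>R (\<Sum>j<Suc n. ?u ^ j * (R * ?G) * ?u ^ (Suc n - Suc j)))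
     = (\<Sum>n<m. \<Sum>i\<le>n. ((-1) ^ n * real (n choose i) / real (Suc i)) *\<^sub>R A i n)"
    unfolding inner scaleR_sum_right scaleR_scaleR
    by (intro sum.cong refl arg_cong2[where f = scaleR]) (metis choose times_divide_eq_left times_divide_eq_right)
  also have "\<dots> = (\<Sum>i<m. \<Sum>n\<in>{i..<m}. ((-1) ^ n * real (n choose i) / real (Suc i)) *\<^sub>R A i n)"
    by (subst (1 2) sum.Sigma) (auto intro!: sum.reindex_bij_witness[of _ prod.swap prod.swap])
  also have "\<dots> = (\<Sum>i<m. ((-1) ^ i / real (Suc i)) *\<^sub>R (T ^^ i) R)"
  proof (intro sum.cong refl)
    fix i assume "i \<in> {..<m}"
    then have i: "i < m" by simp
    obtain y where y: "(1 + ?u) ^ Suc i * (\<Sum>k<m - i. ((-1) ^ k * real ((k + i) choose i)) *\<^sub>R ?u ^ k) 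
         = 1 + ?u ^ (m - i) * (\<Sum>n<Suc i. y n *\<^sub>R (1 + ?u) ^ n)"
      using negative_binomial_truncated by blast
    define z where "z = (\<Sum>n<Suc i. y n *\<^sub>R (1 + ?u) ^ n)"
    have z0: "z \<in> J 0"
      unfolding z_def using G0 by (intro sum_J scaleR_J power_J0) (simp add: G_def)
    \<comment> \<open>Degree count: T^i R has degree i + 1 and u^(m - i) has degree m - i, together
      m + 1, where the filtration vanishes.\<close>
    have "(T ^^ i) R * (?u ^ (m - i) * z) \<in> J (Suc i + ((m - i) * 1 + 0))"
      by (intro mult_J TiR power_J u z0)
    then have van: "(T ^^ i) R * (?u ^ (m - i) * z) = 0"
      by (rule J_zero) (use i in simp)
    have "(\<Sum>n\<in>{i..<m}. ((-1) ^ n * real (n choose i) / real (Suc i)) *\<^sub>R A i n)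
       = (\<Sum>k<m - i. ((-1) ^ (k + i) * real ((k + i) choose i) / real (Suc i)) *\<^sub>R A i (k + i))"
      by (rule sum.reindex_bij_witness[of _ "\<lambda>k. k + i" "\<lambda>n. n - i"]) auto
    also have "\<dots> = ((-1) ^ i / real (Suc i)) *\<^sub>R ((T ^^ i) R * ((1 + ?u) ^ Suc i * (\<Sum>k<m - i. ((-1) ^ k * real ((k + i) choose i)) *\<^sub>R ?u ^ k)))"
      unfolding sum_distrib_left scaleR_sum_right
      by (intro sum.cong refl) (simp add: A_def G_def power_add mult_ac del: power_Suc)
    also have "\<dots> = ((-1) ^ i / real (Suc i)) *\<^sub>R (T ^^ i) R"
      unfolding y z_def[symmetric] by (simp add: distrib_left van)
    finally show "(\<Sum>n\<in>{i..<m}. ((-1) ^ n * real (n choose i) / real (Suc i)) *\<^sub>R A i n)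
       = ((-1) ^ i / real (Suc i)) *\<^sub>R (T ^^ i) R" .
  qed
  finally show ?thesis .
qed

text \<open>Along t \<mapsto> exp (t z) the element R = z commutes with G, so T z = 0 and only the
  term i = 0 of the derivative survives. That term is absent for m = 0, which is treated
  apart.\<close>

lemma trunc_log_exp:
  assumes z: "z \<in> J 1"
  shows "trunc_log m (exp z - 1) = z"
proof (cases m)
  case 0
  then show ?thesis using J_zero[OF z] by (simp add: trunc_log_def)
next
  case (Suc m')
  let ?f = "\<lambda>t::real. trunc_log m (exp (t *\<^sub>R z) - 1) - t *\<^sub>R z"
  have "(?f has_vector_derivative 0) (at t)" for t
  proof -
    have tz: "t *\<^sub>R z \<in> J 1" "- (t *\<^sub>R z) \<in> J 1" using scaleR_J[OF z] uminus_J by auto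
    have comm: "exp (t *\<^sub>R z) * z = z * exp (t *\<^sub>R z)"
      by (simp add: exp_times_scaleR_commute)
    have inv: "exp (t *\<^sub>R z) * exp (- (t *\<^sub>R z)) = 1" "exp (- (t *\<^sub>R z)) * exp (t *\<^sub>R z) = 1"
      using exp_minus_inverse[of "t *\<^sub>R z"] exp_minus_inverse[of "- (t *\<^sub>R z)"] by auto
    define T where "T x = exp (t *\<^sub>R z) * x * exp (- (t *\<^sub>R z)) - x" for x
    have T: "T z = 0" "T 0 = 0" 
      by (simp_all add: T_def comm mult.assoc inv)
    have Ti: "(T ^^ Suc i) z = 0" for i
      by (induction i) (auto simp: T)
    have "((\<lambda>t. trunc_log m (exp (t *\<^sub>R z) - 1)) has_vector_derivative
            (\<Sum>i<m. ((-1) ^ i / real (Suc i)) *\<^sub>R (T ^^ i) z)) (at t)"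
      unfolding T_def
      using trunc_log_has_vector_derivative[where u = "\<lambda>t. exp (t *\<^sub>R z) - 1" and R = z and t = t and S = UNIV and H = "exp (- (t *\<^sub>R z))"]
        exp_minus_one_J1[OF tz(1)] exp_J0[OF tz(2)] z inv
        has_vector_derivative_diff[OF exp_scaleR_has_vector_derivative_left[of z t] has_vector_derivative_const[of 1]]
      by simp
    also have "(\<Sum>i<m. ((-1) ^ i / real (Suc i)) *\<^sub>R (T ^^ i) z) = z"
      unfolding Suc sum.lessThan_Suc_shift by (simp add: Ti del: funpow.simps)
    finally show ?thesis
      by (auto intro!: derivative_eq_intros)
  qed
  then obtain c where "?f t = c" for t
    using has_vector_derivative_zero_constant[of UNIV ?f] by (metis UNIV_I convex_UNIV)
  then have "?f 1 = ?f 0" by metis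
  then show ?thesis by (simp add: trunc_log_def)
qed

text \<open>If the logarithms agree, u - v is a combination of differences of powers of exponent at
  least 2, each lying one degree deeper than u - v. Repetition drives u - v into
  \<open>J (Suc m)\<close>.\<close>

lemma trunc_log_inj:
  assumes u: "u \<in> J 1" and v: "v \<in> J 1" and eq: "trunc_log m u = trunc_log m v"
  shows "u = v"
proof -
  have "u - v \<in> J (Suc k)" for k
  proof (induction k)
    case 0
    then show ?case using diff_J[OF u v] by simp
  next
    case (Suc k)
    have pow: "u ^ Suc (Suc n) - v ^ Suc (Suc n) \<in> J (Suc (Suc k))" for n
    proof (induction n)
      case 0
      have "u ^ Suc (Suc 0) - v ^ Suc (Suc 0) = u * (u - v) + (u - v) * v"
        by (simp add: algebra_simps)
      also have "\<dots> \<in> J (Suc (Suc k))"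
        by (intro add_J mult_J_le[OF u Suc] mult_J_le[OF Suc v]) auto
      finally show ?case .
    next
      case (Suc n)
      have "u ^ Suc (Suc (Suc n)) - v ^ Suc (Suc (Suc n)) 
         = u * (u ^ Suc (Suc n) - v ^ Suc (Suc n)) + (u - v) * v ^ Suc (Suc n)"
        by (simp add: algebra_simps)
      also have "\<dots> \<in> J (Suc (Suc k))"
        by (intro add_J mult_J_le[OF u Suc] mult_J_le[OF \<open>u - v \<in> J (Suc k)\<close> power_J[OF v]]) auto
      finally show ?case .
    qed
    show ?case
    proof (cases m)
      case 0
      then show ?thesis using J_zero[OF u] J_zero[OF v] zero_J by simp
    next
      case (Suc m')
      have "u - v = - (\<Sum>n<m'. ((-1) ^ Suc n / real (Suc (Suc n))) *\<^sub>R (u ^ Suc (Suc n) - v ^ Suc (Suc n)))"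
        using eq unfolding trunc_log_def Suc sum.lessThan_Suc_shift scaleR_diff_right sum_subtractf
        by (simp add: algebra_simps)
      also have "\<dots> \<in> J (Suc (Suc k))"
        by (intro uminus_J sum_J scaleR_J pow)
      finally show ?thesis .
    qed
  qed
  from J_zero[OF this[of m]] show ?thesis by simp
qed

lemma exp_inj: "x \<in> J 1 \<Longrightarrow> y \<in> J 1 \<Longrightarrow> exp x = exp y \<Longrightarrow> x = y"
  using trunc_log_exp by metis

text \<open>Ad (exp x) = exp (ad x): the truncated series S of exp (t ad x) z solves S' = x S - S x,
  so exp (-t x) S exp (t x) is constant. The truncation is exact, since each commutator gains a
  degree.\<close>

lemma exp_conjugate:
  assumes x: "x \<in> J 1" and z: "z \<in> J 1"
  shows "exp x * z * exp (- x) = (\<Sum>r\<le>m. (commutator x ^^ r) z /\<^sub>R fact r)"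
proof -
  have commJ: "(commutator x ^^ r) z \<in> J (Suc r)" for r
  proof (induction r)
    case (Suc r)
    have "commutator x ((commutator x ^^ r) z) \<in> J (Suc (Suc r))"
      by (subst commutator_def) (intro diff_J mult_J_le[OF x Suc] mult_J_le[OF Suc x]; simp)
    then show ?case by simp
  qed (use z in simp)
  define S where "S t = (\<Sum>r\<le>m. (t ^ r / fact r) *\<^sub>R (commutator x ^^ r) z)" for t :: real
  define f where "f t = exp (t *\<^sub>R - x) * S t * exp (t *\<^sub>R x)" for t
  have S': "(S has_vector_derivative (x * S t - S t * x)) (at t)" for t
  proof -
    have "(S has_vector_derivative (\<Sum>r\<le>m. (real r * t ^ (r - 1) / fact r) *\<^sub>R (commutator x ^^ r) z)) (at t)"
      unfolding S_def by (auto intro!: derivative_eq_intros sum.cong)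
    also have "(\<Sum>r\<le>m. (real r * t ^ (r - 1) / fact r) *\<^sub>R (commutator x ^^ r) z)
       = (\<Sum>r<m. (t ^ r / fact r) *\<^sub>R (commutator x ^^ Suc r) z)"
      unfolding lessThan_Suc_atMost[symmetric] sum.lessThan_Suc_shift
      by (simp add: mult.assoc del: of_nat_Suc)
    \<comment> \<open>The added term r = m contains m + 1 commutators with x and vanishes.\<close>
    also have "\<dots> = (\<Sum>r\<le>m. (t ^ r / fact r) *\<^sub>R (commutator x ^^ Suc r) z)"
      unfolding lessThan_Suc_atMost[symmetric] using J_zero[OF commJ[of "Suc m"]] by simp
    also have "\<dots> = x * S t - S t * x"
      by (simp add: S_def sum_distrib_left sum_distrib_right sum_subtractf commutator_def algebra_simps)
    finally show ?thesis .
  qed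
  have "(f has_vector_derivative 0) (at t)" for t
  proof -
    have "(f has_vector_derivative 
       (exp (t *\<^sub>R - x) * S t * (x * exp (t *\<^sub>R x)) + 
        (exp (t *\<^sub>R - x) * (x * S t - S t * x) + exp (t *\<^sub>R - x) * (- x) * S t) * exp (t *\<^sub>R x))) (at t)"
      unfolding f_def
      by (intro has_vector_derivative_mult S' exp_scaleR_has_vector_derivative_left exp_scaleR_has_vector_derivative_right)
    then show ?thesis by (simp add: algebra_simps mult.assoc)
  qed
  then obtain c where c: "f t = c" for t
    using has_vector_derivative_zero_constant[of UNIV f] by (metis UNIV_I convex_UNIV)
  have "S 0 = z"
    unfolding S_def lessThan_Suc_atMost[symmetric] sum.lessThan_Suc_shift by simp
  then have "f 0 = z" by (simp add: f_def)
  with c have "f 1 = z" by metis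
  then have "exp (- x) * S 1 * exp x = z" by (simp add: f_def)
  then have "exp x * z * exp (- x) = (exp x * exp (- x)) * S 1 * (exp x * exp (- x))"
    by (metis mult.assoc)
  then show ?thesis
    by (simp add: exp_minus_inverse S_def divide_inverse)
qed

end

section \<open>Dynkin's formula for operators\<close>

text \<open>The formula defining \<^const>\<open>bch\<close>, freed from the class constraint so that it also makes sense
  in an algebra of operators.\<close>
definition dynkin :: "('a::real_vector \<Rightarrow> 'a \<Rightarrow> 'a) \<Rightarrow> nat \<Rightarrow> 'a \<Rightarrow> 'a \<Rightarrow> 'a" where
  "dynkin B m X Y =
     (\<Sum>n=1..m. ((-1) ^ (n - 1) / real n) *\<^sub>R
        (\<Sum>rs\<in>dyn_idx m n.
           (1 / (real (\<Sum>p\<leftarrow>rs. fst p + snd p) *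
                 (\<Prod>p\<leftarrow>rs. fact (fst p) * fact (snd p)))) *\<^sub>R
           rbr B (dyn_word X Y rs)))"

lemma bch_eq_dynkin: "bch = dynkin"
  by (simp add: fun_eq_iff bch_def dynkin_def)

lemma rbr_map:
  assumes "f 0 = 0" and "\<And>x y. f (B x y) = B' (f x) (f y)"
  shows "f (rbr B ws) = rbr B' (map f ws)"
  by (induction ws rule: induct_list012) (auto simp: assms)

lemma dyn_word_map: "map f (dyn_word X Y rs) = dyn_word (f X) (f Y) rs"
  by (auto simp: dyn_word_def map_concat intro!: arg_cong[where f = concat])

text \<open>Naturality under Lie homomorphisms. It carries the product to operators, commutes it
  with dilations, and projects it to the first layer.\<close>

lemma dynkin_map:
  assumes "linear f" and "\<And>x y. f (B x y) = B' (f x) (f y)"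
  shows "f (dynkin B m X Y) = dynkin B' m (f X) (f Y)"
proof -
  interpret linear f by fact
  show ?thesis
    unfolding dynkin_def
    by (simp add: sum scale rbr_map[where f = f and B = B and B' = B', OF zero assms(2)] dyn_word_map)
qed

lemma bch_map:
  assumes "linear f" and "\<And>x y. f (B x y) = B' (f x) (f y)"
  shows "f (bch B m X Y) = bch B' m (f X) (f Y)"
  unfolding bch_eq_dynkin by (rule dynkin_map[where B = B and B' = B', OF assms])

text \<open>Brackets nest to the right, so leading letters act by ad X. The last letter of a word is
  the argument rather than an operator, whence \<open>ws \<noteq> []\<close>.\<close>

lemma rbr_replicate_append: "ws \<noteq> [] \<Longrightarrow> rbr B (replicate r X @ ws) = (B X ^^ r) (rbr B ws)"
proof (induction r)
  case (Suc r)
  obtain y zs where yz: "replicate r X @ ws = y # zs"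
    using Suc.prems by (meson append_is_Nil_conv neq_Nil_conv)
  have "rbr B (replicate (Suc r) X @ ws) = B X (rbr B (replicate r X @ ws))"
    by (simp add: yz)
  then show ?case using Suc by simp
qed simp

lemma dyn_word_Cons: "dyn_word X Y (p # rs) = replicate (fst p) X @ replicate (snd p) Y @ dyn_word X Y rs"
  by (simp add: dyn_word_def case_prod_beta)

lemma length_dyn_word: "length (dyn_word X Y rs) = (\<Sum>p\<leftarrow>rs. fst p + snd p)"
  by (induction rs) (auto simp: dyn_word_Cons, simp add: dyn_word_def)

definition dyn_pairs :: "nat \<Rightarrow> (nat \<times> nat) set" where
  "dyn_pairs m = {..m} \<times> {..m} - {(0, 0)}"

lemma finite_dyn_pairs [simp]: "finite (dyn_pairs m)"
  by (simp add: dyn_pairs_def)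

lemma dyn_idx_0: "dyn_idx m 0 = {[]}"
  by (auto simp: dyn_idx_def)

lemma dyn_idx_Suc: "dyn_idx m (Suc n) = (\<lambda>(p, rs). p # rs) ` (dyn_pairs m \<times> dyn_idx m n)"
  by (force simp: dyn_idx_def dyn_pairs_def length_Suc_conv image_iff)

lemma finite_dyn_idx [simp]: "finite (dyn_idx m n)"
  by (induction n) (auto simp: dyn_idx_0 dyn_idx_Suc)

lemma sum_dyn_idx_Suc: "(\<Sum>rs\<in>dyn_idx m (Suc n). f rs) = (\<Sum>p\<in>dyn_pairs m. \<Sum>rs\<in>dyn_idx m n. f (p # rs))"
  unfolding dyn_idx_Suc sum.cartesian_product
  by (subst sum.reindex) (auto simp: inj_on_def intro!: sum.cong)

lemma dyn_idx_weight_pos: "rs \<in> dyn_idx m (Suc n) \<Longrightarrow> 0 < (\<Sum>p\<leftarrow>rs. fst p + snd p)"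
  by (auto simp: dyn_idx_Suc dyn_pairs_def)

lemma linear_commutator: "linear (commutator (x :: 'b::real_algebra_1))"
  by unfold_locales (simp_all add: commutator_def algebra_simps)

lemma linear_funpow: 
  fixes f :: "'b::real_vector \<Rightarrow> 'b"
  shows "linear f \<Longrightarrow> linear (f ^^ n)"
proof (induction n)
  case (Suc n)
  show ?case unfolding funpow.simps by (rule linear_compose) (use Suc in auto)
qed (auto simp: linear_id[unfolded id_def] id_def)

lemma commutator_scaleR_power:
  fixes x :: "'b::real_algebra_1"
  shows "(commutator (t *\<^sub>R x) ^^ r) z = t ^ r *\<^sub>R (commutator x ^^ r) z"
  by (induction r) (auto simp: commutator_def algebra_simps)

lemma rbr_commutator_scaleR:
  fixes ws :: "'b::real_algebra_1 list"
  shows "rbr commutator (map ((*\<^sub>R) t) ws) = t ^ length ws *\<^sub>R rbr commutator ws"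
  by (induction ws rule: induct_list012) (auto simp: commutator_def algebra_simps)

context nilpotent_filtration
begin

lemma commutator_J: "x \<in> J i \<Longrightarrow> y \<in> J j \<Longrightarrow> commutator x y \<in> J (i + j)"
  unfolding commutator_def by (intro diff_J) (use mult_J[of x i y j] mult_J[of y j x i] in \<open>auto simp: add.commute\<close>)

lemma rbr_commutator_J1:
  "set ws \<subseteq> J 1 \<Longrightarrow> rbr commutator ws \<in> J 1"
proof (induction ws rule: induct_list012)
  case (3 x y zs)
  then have "commutator x (rbr commutator (y # zs)) \<in> J (1 + 1)"
    by (intro commutator_J) auto
  then show ?case using J_antimono[of 1 "1 + 1"] by auto
qed (auto simp: zero_J)

lemma dynkin_commutator_J1:
  assumes "x \<in> J 1" "y \<in> J 1"
  shows "dynkin commutator m x y \<in> J 1"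
proof -
  have "set (dyn_word x y rs) \<subseteq> J 1" for rs
    using assms by (induction rs) (auto simp: dyn_word_Cons, simp add: dyn_word_def)
  then show ?thesis
    unfolding dynkin_def by (intro sum_J scaleR_J rbr_commutator_J1)
qed

text \<open>Derivative in t of the n-th inner sum of Dynkin's formula at (t x, t y): a word of
  length c scales by t^c, and differentiation cancels the weight 1 / c. Without that weight the sums
  satisfy a recursion in n.\<close>

definition dyn_deriv :: "'b \<Rightarrow> 'b \<Rightarrow> real \<Rightarrow> nat \<Rightarrow> 'b" where
  "dyn_deriv x y t n = (\<Sum>rs\<in>dyn_idx m n.
     (t ^ ((\<Sum>p\<leftarrow>rs. fst p + snd p) - 1) / (\<Prod>p\<leftarrow>rs. fact (fst p) * fact (snd p))) *\<^sub>R
       rbr commutator (dyn_word x y rs))"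

text \<open>Ad G for G = exp (t x) exp (t y), expanded as a double exponential series. The index
  pairs are those of Dynkin's formula together with (0, 0), whose term is the identity.\<close>

lemma conjugate_exp_exp:
  assumes x: "x \<in> J 1" and y: "y \<in> J 1" and z: "z \<in> J 1"
  shows "exp (t *\<^sub>R x) * exp (t *\<^sub>R y) * z * (exp (- (t *\<^sub>R y)) * exp (- (t *\<^sub>R x)))
    = (\<Sum>p\<in>{..m} \<times> {..m}. (t ^ (fst p + snd p) / (fact (fst p) * fact (snd p))) *\<^sub>R
         (commutator x ^^ fst p) ((commutator y ^^ snd p) z))"
proof -
  let ?w = "exp (t *\<^sub>R y) * z * exp (- (t *\<^sub>R y))"
  have "?w \<in> J (0 + 1 + 0)"
    by (intro mult_J exp_J0 z uminus_J scaleR_J y)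
  then have w: "?w \<in> J 1" by simp
  have "exp (t *\<^sub>R x) * exp (t *\<^sub>R y) * z * (exp (- (t *\<^sub>R y)) * exp (- (t *\<^sub>R x)))
     = exp (t *\<^sub>R x) * ?w * exp (- (t *\<^sub>R x))"
    by (simp add: mult.assoc)
  also have "\<dots> = (\<Sum>r\<le>m. (t ^ r / fact r) *\<^sub>R (commutator x ^^ r) ?w)"
    by (subst exp_conjugate[OF scaleR_J[OF x] w]) (simp add: commutator_scaleR_power divide_inverse mult.commute)
  also have "?w = (\<Sum>s\<le>m. (t ^ s / fact s) *\<^sub>R (commutator y ^^ s) z)"
    by (subst exp_conjugate[OF scaleR_J[OF y] z]) (simp add: commutator_scaleR_power divide_inverse mult.commute)
  also have "(\<Sum>r\<le>m. (t ^ r / fact r) *\<^sub>R (commutator x ^^ r) \<dots>) = 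
     (\<Sum>r\<le>m. \<Sum>s\<le>m. (t ^ (r + s) / (fact r * fact s)) *\<^sub>R (commutator x ^^ r) ((commutator y ^^ s) z))"
    by (simp add: linear_sum[OF linear_funpow[OF linear_commutator]] 
         linear_scale[OF linear_funpow[OF linear_commutator]] scaleR_sum_right power_add)
  finally show ?thesis by (simp add: sum.cartesian_product case_prod_beta)
qed

text \<open>A bracket whose last two letters agree is 0, so among the words x^r y^s only x and x^r y
  survive, and the latter sum to Ad (exp (t x)) y.\<close>

lemma dyn_deriv_1:
  assumes x: "x \<in> J 1" and y: "y \<in> J 1" and "m \<ge> 1"
  shows "dyn_deriv x y t 1 = x + exp (t *\<^sub>R x) * y * exp (- (t *\<^sub>R x))"
proof -
  let ?g = "\<lambda>p. (t ^ (fst p + snd p - 1) / (fact (fst p) * fact (snd p))) *\<^sub>R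
                   rbr commutator (replicate (fst p) x @ replicate (snd p) y)"
  have rep: "rbr commutator (replicate (Suc (Suc s)) v) = 0" for s and v :: 'b
    by (induction s) (auto simp: commutator_def)
  have g0: "?g p = 0" if pm: "p \<in> dyn_pairs m - insert (1, 0) ((\<lambda>r. (r, 1)) ` {..m})" for p
  proof -
    obtain r s where p: "p = (r, s)" by (cases p)
    consider "s = 0" "r \<ge> 2" | "s \<ge> 2"
      using pm p by (cases "s = 0"; cases "s = 1"; cases "r = 1") (auto simp: dyn_pairs_def)
    then show ?thesis
    proof cases
      case 1
      then show ?thesis using rep[of "r - 2" x] p by (simp add: numeral_2_eq_2 Suc_diff_Suc)
    next
      case 2
      then have "rbr commutator (replicate r x @ replicate s y) = (commutator x ^^ r) 0"
        using rep[of "s - 2" y] by (subst rbr_replicate_append) (auto simp: numeral_2_eq_2 Suc_diff_Suc)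
      then show ?thesis using p by (simp add: linear_0[OF linear_funpow[OF linear_commutator]])
    qed
  qed
  have "dyn_deriv x y t 1 = (\<Sum>p\<in>dyn_pairs m. ?g p)"
    unfolding dyn_deriv_def One_nat_def sum_dyn_idx_Suc dyn_idx_0
    by (simp add: dyn_word_Cons, simp add: dyn_word_def)
  also have "\<dots> = (\<Sum>p\<in>insert (1, 0) ((\<lambda>r. (r, 1)) ` {..m}). ?g p)"
    by (rule sum.mono_neutral_right) (use g0 \<open>m \<ge> 1\<close> in \<open>auto simp: dyn_pairs_def\<close>)
  also have "\<dots> = x + (\<Sum>r\<le>m. ?g (r, 1))"
    by (subst sum.insert) (auto simp: sum.reindex inj_on_def)
  also have "(\<Sum>r\<le>m. ?g (r, 1)) = (\<Sum>r\<le>m. (commutator (t *\<^sub>R x) ^^ r) y /\<^sub>R fact r)"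
    by (intro sum.cong refl) (simp add: rbr_replicate_append commutator_scaleR_power divide_inverse mult.commute)
  also have "\<dots> = exp (t *\<^sub>R x) * y * exp (- (t *\<^sub>R x))"
    by (rule exp_conjugate[OF scaleR_J[OF x] y, symmetric])
  finally show ?thesis .
qed

text \<open>A pair (r, s) put in front of a word applies (ad x)^r (ad y)^s with weight t^(r + s) /
  (r! s!). Summing over all pairs but (0, 0) gives Ad G - 1.\<close>

lemma dyn_deriv_Suc:
  assumes x: "x \<in> J 1" and y: "y \<in> J 1" 
  shows "dyn_deriv x y t (Suc (Suc n)) 
     = exp (t *\<^sub>R x) * exp (t *\<^sub>R y) * dyn_deriv x y t (Suc n) * (exp (- (t *\<^sub>R y)) * exp (- (t *\<^sub>R x)))
       - dyn_deriv x y t (Suc n)"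
proof -
  let ?c = "\<lambda>rs. (\<Sum>p\<leftarrow>rs. fst p + snd p) :: nat"
  let ?d = "\<lambda>rs. (\<Prod>p\<leftarrow>rs. fact (fst p) * fact (snd p)) :: real"
  let ?z = "dyn_deriv x y t (Suc n)"
  let ?g = "\<lambda>p z. (t ^ (fst p + snd p) / (fact (fst p) * fact (snd p))) *\<^sub>R
         (commutator x ^^ fst p) ((commutator y ^^ snd p) z)"
  have z: "?z \<in> J 1"
  proof -
    have "set (dyn_word x y rs) \<subseteq> J 1" for rs
      using assms by (induction rs) (auto simp: dyn_word_Cons, simp add: dyn_word_def)
    then show ?thesis
      unfolding dyn_deriv_def by (intro sum_J scaleR_J rbr_commutator_J1)
  qed
  have "dyn_deriv x y t (Suc (Suc n)) = (\<Sum>p\<in>dyn_pairs m. ?g p ?z)"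
    unfolding dyn_deriv_def[of _ _ _ "Suc (Suc n)"] sum_dyn_idx_Suc[of _ _ "Suc n"]
  proof (intro sum.cong refl)
    fix p assume "p \<in> dyn_pairs m"
    have "(t ^ (?c (p # rs) - 1) / ?d (p # rs)) *\<^sub>R rbr commutator (dyn_word x y (p # rs))
       = ?g p ((t ^ (?c rs - 1) / ?d rs) *\<^sub>R rbr commutator (dyn_word x y rs))"
      if rs: "rs \<in> dyn_idx m (Suc n)" for rs
    proof -
      have pos: "?c rs > 0" using dyn_idx_weight_pos[OF rs] .
      then have ne: "dyn_word x y rs \<noteq> []" using length_dyn_word[of x y rs] by (metis list.size(3) less_irrefl)
      \<comment> \<open>Truncated subtraction: this uses that \<open>rs\<close> has positive weight,
        which is why the recursion starts at n = 1.\<close>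
      have "?c (p # rs) - 1 = (fst p + snd p) + (?c rs - 1)" using pos by simp
      then show ?thesis 
        using ne by (simp add: dyn_word_Cons rbr_replicate_append power_add
            linear_scale[OF linear_funpow[OF linear_commutator]] del: sum_list.Cons)
    qed
    then have "(\<Sum>rs\<in>dyn_idx m (Suc n). (t ^ (?c (p # rs) - 1) / ?d (p # rs)) *\<^sub>R rbr commutator (dyn_word x y (p # rs)))
      = (\<Sum>rs\<in>dyn_idx m (Suc n). ?g p ((t ^ (?c rs - 1) / ?d rs) *\<^sub>R rbr commutator (dyn_word x y rs)))"
      by (rule sum.cong[OF refl])
    also have "\<dots> = ?g p ?z"
      unfolding dyn_deriv_def
      by (simp only: linear_sum[OF linear_funpow[OF linear_commutator]] scaleR_sum_right)
    finally show "(\<Sum>rs\<in>dyn_idx m (Suc n). (t ^ (?c (p # rs) - 1) / ?d (p # rs)) *\<^sub>R rbr commutator (dyn_word x y (p # rs))) = ?g p ?z" .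
  qed
  also have "\<dots> = (\<Sum>p\<in>{..m} \<times> {..m}. ?g p ?z) - ?z"
    unfolding dyn_pairs_def by (subst sum_diff1) auto
  also have "(\<Sum>p\<in>{..m} \<times> {..m}. ?g p ?z) = exp (t *\<^sub>R x) * exp (t *\<^sub>R y) * ?z * (exp (- (t *\<^sub>R y)) * exp (- (t *\<^sub>R x)))"
    by (rule conjugate_exp_exp[OF x y z, symmetric])
  finally show ?thesis .
qed

text \<open>Along the ray \<open>t \<mapsto> (t x, t y)\<close> both sides have the same derivative
  \<open>log (Ad G) / (Ad G - 1)\<close> applied to \<open>G' G\<inverse>\<close>, where \<open>G = exp (t x) exp (t y)\<close>.\<close>
theorem dynkin_formula:
  assumes x: "x \<in> J 1" and y: "y \<in> J 1"
  shows "dynkin commutator m x y = trunc_log m (exp x * exp y - 1)"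
proof (cases "m = 0")
  case True
  then show ?thesis by (simp add: dynkin_def trunc_log_def)
next
  case False
  define D where "D t = dynkin commutator m (t *\<^sub>R x) (t *\<^sub>R y)" for t
  define u where "u t = exp (t *\<^sub>R x) * exp (t *\<^sub>R y) - 1" for t :: real
  \<comment> \<open>With G = exp (t x) exp (t y), \<open>R\<close> is G' times the inverse of G, and
    \<open>H\<close> is that inverse.\<close>
  define R where "R t = x + exp (t *\<^sub>R x) * y * exp (- (t *\<^sub>R x))" for t :: real
  define H where "H t = exp (- (t *\<^sub>R y)) * exp (- (t *\<^sub>R x))" for t :: real
  define T where "T t z = (1 + u t) * z * H t - z" for t z
  let ?c = "\<lambda>rs. (\<Sum>p\<leftarrow>rs. fst p + snd p) :: nat"
  let ?d = "\<lambda>rs. (\<Prod>p\<leftarrow>rs. fact (fst p) * fact (snd p)) :: real"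
  have inv: "exp z * exp (- z) = 1" "exp (- z) * exp z = 1" for z :: 'b
    using exp_minus_inverse[of z] exp_minus_inverse[of "- z"] by auto
  have deriv_eq: "dyn_deriv x y t (Suc n) = (T t ^^ n) (R t)" for t n
    by (induction n) (use dyn_deriv_1[OF x y] False in 
       \<open>auto simp: R_def dyn_deriv_Suc[OF x y] T_def u_def H_def\<close>)
  have D: "(D has_vector_derivative (\<Sum>i<m. ((-1) ^ i / real (Suc i)) *\<^sub>R (T t ^^ i) (R t))) (at t)" for t
  proof -
    have D_eq: "D = (\<lambda>t. \<Sum>n=1..m. ((-1) ^ (n - 1) / real n) *\<^sub>R
        (\<Sum>rs\<in>dyn_idx m n. (1 / (real (?c rs) * ?d rs)) *\<^sub>R t ^ ?c rs *\<^sub>R rbr commutator (dyn_word x y rs)))"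
      unfolding D_def dynkin_def dyn_word_map[of "(*\<^sub>R) _", symmetric] rbr_commutator_scaleR length_dyn_word ..
    have "(D has_vector_derivative (\<Sum>n=1..m. ((-1) ^ (n - 1) / real n) *\<^sub>R dyn_deriv x y t n)) (at t)"
      unfolding D_eq dyn_deriv_def
    proof (intro has_vector_derivative_sum bounded_linear.has_vector_derivative[OF bounded_linear_scaleR_right])
      fix n rs assume n: "n \<in> {1..m}" and rs: "rs \<in> dyn_idx m n"
      obtain n' where n': "n = Suc n'" using n by (cases n) auto
      have pos: "?c rs > 0" using dyn_idx_weight_pos rs n' by blast
      have "((\<lambda>t. (1 / (real (?c rs) * ?d rs)) *\<^sub>R t ^ ?c rs *\<^sub>R rbr commutator (dyn_word x y rs)) has_vector_derivative
        (1 / (real (?c rs) * ?d rs)) *\<^sub>R (real (?c rs) * t ^ (?c rs - 1)) *\<^sub>R rbr commutator (dyn_word x y rs)) (at t)"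
        by (intro bounded_linear.has_vector_derivative[OF bounded_linear_scaleR_right]
              bounded_linear.has_vector_derivative[OF bounded_linear_scaleR_left])
           (auto intro!: derivative_eq_intros simp flip: has_real_derivative_iff_has_vector_derivative)
      moreover have "1 / (real c * d) * (real c * v) = v / d" if "c > 0" for c :: nat and d v :: real
        using that by simp
      ultimately show "((\<lambda>t. (1 / (real (?c rs) * ?d rs)) *\<^sub>R t ^ ?c rs *\<^sub>R rbr commutator (dyn_word x y rs)) has_vector_derivative
        (t ^ (?c rs - 1) / ?d rs) *\<^sub>R rbr commutator (dyn_word x y rs)) (at t)"
        using pos by (simp only: scaleR_scaleR)
    qed
    also have "(\<Sum>n=1..m. ((-1) ^ (n - 1) / real n) *\<^sub>R dyn_deriv x y t n) = 
       (\<Sum>i<m. ((-1) ^ i / real (Suc i)) *\<^sub>R (T t ^^ i) (R t))"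
      unfolding deriv_eq[symmetric]
      by (rule sum.reindex_bij_witness[of _ Suc "\<lambda>n. n - 1"]) auto
    finally show ?thesis .
  qed
  have L: "((\<lambda>t. trunc_log m (u t)) has_vector_derivative (\<Sum>i<m. ((-1) ^ i / real (Suc i)) *\<^sub>R (T t ^^ i) (R t))) (at t)" for t
    unfolding T_def
  proof (rule trunc_log_has_vector_derivative)
    have tx: "t *\<^sub>R x \<in> J 1" "- (t *\<^sub>R x) \<in> J 1" and ty: "t *\<^sub>R y \<in> J 1" "- (t *\<^sub>R y) \<in> J 1"
      using x y by (auto intro: scaleR_J uminus_J)
    have "(u has_vector_derivative (exp (t *\<^sub>R x) * (y * exp (t *\<^sub>R y)) + x * exp (t *\<^sub>R x) * exp (t *\<^sub>R y) - 0)) (at t)"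
      unfolding u_def
      by (intro has_vector_derivative_mult has_vector_derivative_diff has_vector_derivative_const
            exp_scaleR_has_vector_derivative_left)
    also have "exp (t *\<^sub>R x) * (y * exp (t *\<^sub>R y)) + x * exp (t *\<^sub>R x) * exp (t *\<^sub>R y) - 0 = R t * (1 + u t)"
    proof -
      have "exp (- (t *\<^sub>R x)) * (exp (t *\<^sub>R x) * v) = v" for v
        using inv(2)[of "t *\<^sub>R x"] by (metis mult.assoc mult_1_left)
      then show ?thesis by (simp add: R_def u_def algebra_simps mult.assoc)
    qed
    finally show "(u has_vector_derivative R t * (1 + u t)) (at t)" .
    have "u t = (exp (t *\<^sub>R x) - 1) * exp (t *\<^sub>R y) + (exp (t *\<^sub>R y) - 1)"
      by (simp add: u_def algebra_simps)
    also have "\<dots> \<in> J 1"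
      by (intro add_J mult_J_le[OF exp_minus_one_J1[OF tx(1)] exp_J0[OF ty(1)]] exp_minus_one_J1 ty) simp
    finally show "u t \<in> J 1" .
    have "exp (t *\<^sub>R x) * y * exp (- (t *\<^sub>R x)) \<in> J (0 + 1 + 0)"
      by (intro mult_J exp_J0 y tx)
    then show "R t \<in> J 1" unfolding R_def using add_J[OF x] by simp
    have "1 + u t = exp (t *\<^sub>R x) * exp (t *\<^sub>R y)" by (simp add: u_def)
    moreover have "exp (t *\<^sub>R x) * exp (t *\<^sub>R y) * H t = exp (t *\<^sub>R x) * (exp (t *\<^sub>R y) * exp (- (t *\<^sub>R y))) * exp (- (t *\<^sub>R x))"
      "H t * (exp (t *\<^sub>R x) * exp (t *\<^sub>R y)) = exp (- (t *\<^sub>R y)) * (exp (- (t *\<^sub>R x)) * exp (t *\<^sub>R x)) * exp (t *\<^sub>R y)"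
      by (simp_all only: H_def mult.assoc)
    ultimately show "(1 + u t) * H t = 1" "H t * (1 + u t) = 1" by (simp_all add: inv)
    show "H t \<in> J 0" unfolding H_def using mult_J[OF exp_J0[OF ty(2)] exp_J0[OF tx(2)]] by simp
  qed
  have "((\<lambda>t. D t - trunc_log m (u t)) has_vector_derivative 0) (at t)" for t
    using has_vector_derivative_diff[OF D L] by simp
  then obtain c where c: "D t - trunc_log m (u t) = c" for t
    using has_vector_derivative_zero_constant[of UNIV "\<lambda>t. D t - trunc_log m (u t)"] by (metis UNIV_I convex_UNIV)
  \<comment> \<open>Every word with at least one pair is nonempty, so its bracket carries a positive
    power of t.\<close>
  have "D 0 = 0"
  proof -
    have "rbr commutator (dyn_word (0 *\<^sub>R x) (0 *\<^sub>R y) rs) = 0" if "rs \<in> dyn_idx m n" "n \<in> {1..m}" for rs n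
    proof -
      obtain n' where "n = Suc n'" using \<open>n \<in> {1..m}\<close> by (cases n) auto
      then have "?c rs > 0" using dyn_idx_weight_pos that by blast
      then show ?thesis
        unfolding dyn_word_map[of "(*\<^sub>R) _", symmetric] rbr_commutator_scaleR length_dyn_word by simp
    qed
    then show ?thesis unfolding D_def dynkin_def by (intro sum.neutral ballI) (simp add: sum.neutral)
  qed
  moreover have "trunc_log m (u 0) = 0" by (simp add: u_def trunc_log_def)
  ultimately have "c = 0" using c[of 0] by simp
  then show ?thesis using c[of 1] by (simp add: D_def u_def)
qed

text \<open>Both sides have the same truncated logarithm, which is injective on
  \<open>J 1\<close>.\<close>

theorem exp_dynkin:
  assumes x: "x \<in> J 1" and y: "y \<in> J 1"
  shows "exp (dynkin commutator m x y) = exp x * exp y"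
proof -
  have "exp x * exp y - 1 = (exp x - 1) * exp y + (exp y - 1)"
    by (simp add: algebra_simps)
  also have "\<dots> \<in> J 1"
    by (intro add_J mult_J_le[OF exp_minus_one_J1[OF x] exp_J0[OF y]] exp_minus_one_J1 y) simp
  finally have "exp (dynkin commutator m x y) - 1 = exp x * exp y - 1"
    using trunc_log_exp[OF dynkin_commutator_J1[OF x y]] dynkin_formula[OF x y]
    by (intro trunc_log_inj[OF exp_minus_one_J1[OF dynkin_commutator_J1[OF x y]]]) simp_all
  then show ?thesis by simp
qed

end

subsection \<open>The algebra of endomorphisms\<close>

text \<open>A type of its own, on which composition is the multiplication of a Banach algebra;
  \<open>exp\<close>, powers and the product rule then apply to operators.\<close>

typedef (overloaded) ('a::euclidean_space) endo = "UNIV :: ('a \<Rightarrow>\<^sub>L 'a) set"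
  by simp

setup_lifting type_definition_endo

instantiation endo :: (euclidean_space) real_vector
begin

lift_definition plus_endo :: "'a endo \<Rightarrow> 'a endo \<Rightarrow> 'a endo" is "(+)" .
lift_definition minus_endo :: "'a endo \<Rightarrow> 'a endo \<Rightarrow> 'a endo" is "(-)" .
lift_definition uminus_endo :: "'a endo \<Rightarrow> 'a endo" is uminus .
lift_definition zero_endo :: "'a endo" is 0 .
lift_definition scaleR_endo :: "real \<Rightarrow> 'a endo \<Rightarrow> 'a endo" is "(*\<^sub>R)" .

instance
  by standard (transfer; simp add: algebra_simps)+

end

instantiation endo :: (euclidean_space) real_normed_vector
begin

lift_definition norm_endo :: "'a endo \<Rightarrow> real" is norm .
lift_definition sgn_endo :: "'a endo \<Rightarrow> 'a endo" is sgn .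
lift_definition dist_endo :: "'a endo \<Rightarrow> 'a endo \<Rightarrow> real" is dist .

definition uniformity_endo :: "('a endo \<times> 'a endo) filter" where
  "uniformity_endo = (INF e\<in>{0<..}. principal {(x, y). dist x y < e})"
definition open_endo :: "'a endo set \<Rightarrow> bool" where
  "open_endo S = (\<forall>x\<in>S. \<forall>\<^sub>F (x', y) in uniformity. x' = x \<longrightarrow> y \<in> S)"

instance
proof
  fix x y :: "'a endo" and a :: real
  show "dist x y = norm (x - y)"
    by transfer (rule dist_norm)
  show "sgn x = x /\<^sub>R norm x"
    by transfer (rule sgn_div_norm)
  show "(norm x = 0) = (x = 0)" "norm (x + y) \<le> norm x + norm y" "norm (a *\<^sub>R x) = \<bar>a\<bar> * norm x"
    by (transfer; simp add: norm_triangle_ineq)+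
qed (rule uniformity_endo_def open_endo_def)+

end

instantiation endo :: (euclidean_space) real_normed_algebra_1
begin

lift_definition one_endo :: "'a endo" is id_blinfun .
lift_definition times_endo :: "'a endo \<Rightarrow> 'a endo \<Rightarrow> 'a endo" is "(o\<^sub>L)" .

instance
proof
  fix x y z :: "'a endo" and a :: real
  show "x * y * z = x * (y * z)" "1 * x = x" "x * 1 = x"
    by (transfer; auto intro!: blinfun_eqI)+
  show "(x + y) * z = x * z + y * z" "x * (y + z) = x * y + x * z" 
    "a *\<^sub>R x * y = a *\<^sub>R (x * y)" "x * a *\<^sub>R y = a *\<^sub>R (x * y)"
    by (transfer; auto intro!: blinfun_eqI simp: blinfun.bilinear_simps)+
  show "(0::'a endo) \<noteq> 1"
    by transfer (metis norm_blinfun_id norm_zero zero_neq_one)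
  show "norm (x * y) \<le> norm x * norm y"
    by transfer (rule norm_blinfun_compose)
  show "norm (1 :: 'a endo) = 1"
    by transfer simp
qed

end

instance endo :: (euclidean_space) banach
proof
  fix X :: "nat \<Rightarrow> 'a endo"
  assume "Cauchy X"
  then have "Cauchy (\<lambda>n. Rep_endo (X n))"
    by (simp add: Cauchy_def dist_endo.rep_eq)
  then obtain L where "(\<lambda>n. Rep_endo (X n)) \<longlonglongrightarrow> L"
    using convergent_eq_Cauchy by blast
  then have "X \<longlonglongrightarrow> Abs_endo L"
    by (simp add: lim_sequentially dist_endo.rep_eq Abs_endo_inverse)
  then show "convergent X" by (auto simp: convergent_def)
qed

lift_definition endo_apply :: "('a::euclidean_space) endo \<Rightarrow> 'a \<Rightarrow> 'a" is blinfun_apply .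

definition to_endo :: "('a::euclidean_space \<Rightarrow> 'a) \<Rightarrow> 'a endo" where
  "to_endo f = Abs_endo (Blinfun f)"

lemma endo_apply_to_endo: "linear f \<Longrightarrow> endo_apply (to_endo f) = f"
  by (simp add: to_endo_def endo_apply.abs_eq bounded_linear_Blinfun_apply linear_conv_bounded_linear)

lemma endo_eqI: "(\<And>x. endo_apply f x = endo_apply g x) \<Longrightarrow> f = g"
  by transfer (rule blinfun_eqI)

lemma endo_apply_simps [simp]:
  "endo_apply (f + g) x = endo_apply f x + endo_apply g x"
  "endo_apply (f - g) x = endo_apply f x - endo_apply g x"
  "endo_apply (f * g) x = endo_apply f (endo_apply g x)"
  "endo_apply (c *\<^sub>R f) x = c *\<^sub>R endo_apply f x"
  "endo_apply 0 x = 0"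
  "endo_apply 1 x = x"
  by (transfer; simp add: blinfun.bilinear_simps)+

lemma norm_endo_apply: "norm (endo_apply f x) \<le> norm f * norm x"
  by transfer (rule norm_blinfun)

subsection \<open>Graded Lie algebras\<close>

locale graded_lie =
  fixes B :: "'a::euclidean_space \<Rightarrow> 'a \<Rightarrow> 'a" and W :: "nat \<Rightarrow> 'a set" and ups :: nat
  assumes graded: "graded_lie_algebra B W ups"
begin

abbreviation "\<pi> \<equiv> proj W ups"

lemma bilinear_B: "bilinear B"
  and B_self: "B x x = 0"
  and jacobi: "B x (B y z) + B y (B z x) + B z (B x y) = 0"
  and subspace_W: "i \<in> {1..ups} \<Longrightarrow> subspace (W i)"
  and decomposition: "\<exists>!c. (\<forall>i. i \<notin> {1..ups} \<longrightarrow> c i = 0) \<and> (\<forall>i\<in>{1..ups}. c i \<in> W i) \<and>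
              x = (\<Sum>i=1..ups. c i)"
  and B_layers: "i \<in> {1..ups} \<Longrightarrow> j \<in> {1..ups} \<Longrightarrow> u \<in> W i \<Longrightarrow> v \<in> W j \<Longrightarrow>
        B u v \<in> (if i + j \<le> ups then W (i + j) else {0})"
  using graded unfolding graded_lie_algebra_def by blast+

lemma linear_B: "linear (B x)" "linear (\<lambda>x. B x y)"
  using bilinear_B by (auto simp: bilinear_def)

lemma B_swap: "B y x = - B x y"
proof -
  have "B x y + B y x = 0"
    using B_self[of "x + y"] B_self[of x] B_self[of y] 
    by (simp add: bilinear_ladd[OF bilinear_B] bilinear_radd[OF bilinear_B] add.commute)
  then show ?thesis by (simp add: add_eq_0_iff)
qed

lemma proj_decomposition:
  "(\<forall>i. i \<notin> {1..ups} \<longrightarrow> \<pi> i x = 0) \<and> (\<forall>i\<in>{1..ups}. \<pi> i x \<in> W i) \<and> x = (\<Sum>i=1..ups. \<pi> i x)"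
proof -
  have "\<pi> = (\<lambda>i x. (THE c. (\<forall>i. i \<notin> {1..ups} \<longrightarrow> c i = 0) \<and> (\<forall>i\<in>{1..ups}. c i \<in> W i) \<and>
              x = (\<Sum>i=1..ups. c i)) i)"
    by (simp add: fun_eq_iff proj_def)
  with theI'[OF decomposition[of x]] show ?thesis by simp
qed

lemma proj_outside: "i \<notin> {1..ups} \<Longrightarrow> \<pi> i x = 0"
  and proj_in_W: "i \<in> {1..ups} \<Longrightarrow> \<pi> i x \<in> W i"
  and sum_proj: "(\<Sum>i=1..ups. \<pi> i x) = x"
  using proj_decomposition[of x] by auto

lemma proj_unique:
  assumes "\<And>i. i \<in> {1..ups} \<Longrightarrow> c i \<in> W i" and "x = (\<Sum>i=1..ups. c i)" and "i \<in> {1..ups}"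
  shows "\<pi> i x = c i"
proof -
  let ?c = "\<lambda>i. if i \<in> {1..ups} then c i else 0"
  have ex1_eq: "a = b" if "\<exists>!c. P c" "P a" "P b" for P and a b :: "nat \<Rightarrow> 'a"
    using that by blast
  have "(\<lambda>i. \<pi> i x) = ?c"
    using proj_decomposition[of x] assms by (intro ex1_eq[OF decomposition[of x]]) auto
  from fun_cong[OF this, of i] show ?thesis using assms(3) by simp
qed

lemma linear_proj: "linear (\<pi> i)"
proof (cases "i \<in> {1..ups}")
  case True
  show ?thesis
  proof
    fix x y :: 'a and r :: real
    show "\<pi> i (x + y) = \<pi> i x + \<pi> i y"
      by (rule proj_unique[OF _ _ True]) 
         (auto simp: sum.distrib sum_proj simp del: One_nat_def intro!: subspace_add[OF subspace_W] proj_in_W)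
    show "\<pi> i (r *\<^sub>R x) = r *\<^sub>R \<pi> i x"
      by (rule proj_unique[OF _ _ True])
         (auto simp: sum_proj simp del: One_nat_def simp flip: scaleR_sum_right intro!: subspace_scale[OF subspace_W] proj_in_W)
  qed
next
  case False
  then have "\<pi> i = (\<lambda>_. 0)" by (simp add: fun_eq_iff proj_outside del: One_nat_def)
  then show ?thesis by (simp add: linear_zero)
qed

lemma proj_layer:
  assumes "x \<in> W j" "j \<in> {1..ups}"
  shows "\<pi> i x = (if i = j then x else 0)"
proof (cases "i \<in> {1..ups}")
  case True
  show ?thesis
    by (rule proj_unique[OF _ _ True]) (use assms in \<open>auto simp: subspace_0[OF subspace_W]\<close>)
qed (use assms proj_outside in auto)

text \<open>For \<open>c i = i\<close> this is the derivation of the grading, for \<open>c i = s ^ i\<close> the dilation.\<close>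
definition scale_layers :: "(nat \<Rightarrow> real) \<Rightarrow> 'a \<Rightarrow> 'a" where
  "scale_layers c x = (\<Sum>i=1..ups. c i *\<^sub>R \<pi> i x)"

lemma linear_scale_layers: "linear (scale_layers c)"
  unfolding scale_layers_def
  by (intro linear_compose_sum ballI linear_compose_scale_right linear_proj)

lemma scale_layers_layer: "x \<in> W j \<Longrightarrow> j \<in> {1..ups} \<Longrightarrow> scale_layers c x = c j *\<^sub>R x"
  unfolding scale_layers_def by (simp add: proj_layer if_distrib sum.delta cong: if_cong)

lemma proj_scale_layers: "i \<in> {1..ups} \<Longrightarrow> \<pi> i (scale_layers c x) = c i *\<^sub>R \<pi> i x"
  unfolding scale_layers_def 
  by (rule proj_unique) (auto intro!: subspace_scale[OF subspace_W] proj_in_W)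

lemma scale_layers_comp: "scale_layers c (scale_layers d x) = scale_layers (\<lambda>i. c i * d i) x"
  unfolding scale_layers_def[of c] scale_layers_def[of "\<lambda>i. c i * d i"]
  by (intro sum.cong refl) (simp add: proj_scale_layers)

lemma B_expand: "B x y = (\<Sum>i=1..ups. \<Sum>j=1..ups. B (\<pi> i x) (\<pi> j y))"
proof -
  have "B x y = B (\<Sum>i=1..ups. \<pi> i x) (\<Sum>j=1..ups. \<pi> j y)" by (simp only: sum_proj)
  also have "\<dots> = (\<Sum>i=1..ups. B (\<pi> i x) (\<Sum>j=1..ups. \<pi> j y))"
    by (rule linear_sum[OF linear_B(2)])
  finally show ?thesis by (simp only: linear_sum[OF linear_B(1)])
qed

lemma scale_layers_B_layers:
  assumes "i \<in> {1..ups}" "j \<in> {1..ups}" "u \<in> W i" "v \<in> W j"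
  shows "scale_layers c (B u v) = c (i + j) *\<^sub>R B u v"
proof (cases "i + j \<le> ups")
  case True
  then show ?thesis using B_layers[OF assms] assms(1) by (intro scale_layers_layer) auto
next
  case False
  then have "B u v = 0" using B_layers[OF assms] by simp
  then show ?thesis by (simp add: linear_0[OF linear_scale_layers])
qed

text \<open>Covers both uses: additive weights, c (i + j) = c i + c j, give a derivation, and
  multiplicative ones an automorphism. Beyond degree \<open>ups\<close> the bracket vanishes, so the
  value of c there does not matter.\<close>

lemma scale_layers_B:
  "scale_layers c (B x y) = (\<Sum>i=1..ups. \<Sum>j=1..ups. c (i + j) *\<^sub>R B (\<pi> i x) (\<pi> j y))"
proof -
  have "scale_layers c (B x y) = (\<Sum>i=1..ups. \<Sum>j=1..ups. scale_layers c (B (\<pi> i x) (\<pi> j y)))"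
    by (subst B_expand) (simp only: linear_sum[OF linear_scale_layers])
  also have "\<dots> = (\<Sum>i=1..ups. \<Sum>j=1..ups. c (i + j) *\<^sub>R B (\<pi> i x) (\<pi> j y))"
    by (intro sum.cong refl scale_layers_B_layers proj_in_W)
  finally show ?thesis .
qed

abbreviation "\<delta> \<equiv> dil W ups"

lemma dil_eq: "\<delta> s = scale_layers (\<lambda>i. s ^ i)"
  by (simp add: fun_eq_iff dil_def scale_layers_def)

lemma linear_dil: "linear (\<delta> s)"
  by (simp add: dil_eq linear_scale_layers)

lemma dil_B: "\<delta> s (B x y) = B (\<delta> s x) (\<delta> s y)"
proof -
  have power_add': "s ^ (i + j) = s ^ j * s ^ i" for i j by (simp add: power_add)
  have "\<delta> s (B x y) = (\<Sum>i=1..ups. \<Sum>j=1..ups. s ^ (i + j) *\<^sub>R B (\<pi> i x) (\<pi> j y))"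
    unfolding dil_eq by (rule scale_layers_B)
  also have "\<dots> = B (\<delta> s x) (\<delta> s y)"
    by (subst B_expand[of "\<delta> s x"]) (simp add: dil_eq proj_scale_layers linear_scale[OF linear_B(1)] linear_scale[OF linear_B(2)] power_add')
  finally show ?thesis .
qed

lemma dil_dil: "\<delta> r (\<delta> s x) = \<delta> (r * s) x"
  by (simp add: dil_eq scale_layers_comp power_mult_distrib)

lemma dil_layer_1: "x \<in> W 1 \<Longrightarrow> 1 \<le> ups \<Longrightarrow> \<delta> s x = s *\<^sub>R x"
  by (simp add: dil_eq scale_layers_layer)

definition deg :: "'a \<Rightarrow> 'a" where
  "deg = scale_layers real"

lemma linear_deg: "linear deg"
  by (simp add: deg_def linear_scale_layers)

lemma deg_B: "deg (B x y) = B (deg x) y + B x (deg y)"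
proof -
  have "deg (B x y) = (\<Sum>i=1..ups. \<Sum>j=1..ups. real (i + j) *\<^sub>R B (\<pi> i x) (\<pi> j y))"
    unfolding deg_def by (rule scale_layers_B)
  also have "\<dots> = (\<Sum>i=1..ups. \<Sum>j=1..ups. B (\<pi> i (deg x)) (\<pi> j y)) + (\<Sum>i=1..ups. \<Sum>j=1..ups. B (\<pi> i x) (\<pi> j (deg y)))"
    by (simp add: deg_def proj_scale_layers linear_scale[OF linear_B(1)] linear_scale[OF linear_B(2)] scaleR_add_left sum.distrib)
  also have "\<dots> = B (deg x) y + B x (deg y)"
    by (simp only: B_expand[symmetric])
  finally show ?thesis .
qed

text \<open>The eigenvalues of \<open>deg\<close> on the layers are 1, ..., \<open>ups\<close>, none
  of them 0.\<close>

lemma deg_inj: "deg x = 0 \<Longrightarrow> x = 0"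
proof -
  assume "deg x = 0"
  then have "\<pi> i x = 0" if "i \<in> {1..ups}" for i
    using proj_scale_layers[OF that, of real x] that by (simp add: deg_def linear_0[OF linear_proj])
  then show "x = 0" using sum_proj[of x] by simp
qed

end

text \<open>Termwise bound on z = log (exp z), with the denominators estimated by 1. It converts
  closeness of a group element to 1 into smallness of its coordinates.\<close>

lemma (in nilpotent_filtration) norm_le_norm_exp_minus_one:
  assumes "z \<in> J 1"
  shows "norm z \<le> norm (exp z - 1) * (\<Sum>n<m. norm (exp z - 1) ^ n)"
proof -
  let ?u = "exp z - 1"
  have "norm z = norm (trunc_log m ?u)"
    using trunc_log_exp[OF assms] by simp
  also have "\<dots> \<le> (\<Sum>n<m. norm ?u ^ Suc n)"
    unfolding trunc_log_def
  proof (rule sum_norm_le)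
    fix n
    have "norm (((-1) ^ n / real (Suc n)) *\<^sub>R ?u ^ Suc n) = norm (?u ^ Suc n) / real (Suc n)"
      by (simp add: power_abs)
    also have "\<dots> \<le> norm (?u ^ Suc n)"
      by (simp add: field_simps del: power_Suc)
    also have "\<dots> \<le> norm ?u ^ Suc n"
      by (rule norm_power_ineq)
    finally show "norm (((-1) ^ n / real (Suc n)) *\<^sub>R ?u ^ Suc n) \<le> norm ?u ^ Suc n" .
  qed
  finally show ?thesis by (simp add: sum_distrib_left)
qed

section \<open>The group as a group of unipotent operators\<close>

context graded_lie
begin

text \<open>The adjoint action on the extension of the Lie algebra by its grading derivation \<^term>\<open>deg\<close>;
  the extra dimension makes it faithful, since \<^term>\<open>deg\<close> is injective.\<close>
definition rep :: "'a \<Rightarrow> ('a \<times> real) endo" where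
  "rep x = to_endo (\<lambda>p. (B x (fst p) - snd p *\<^sub>R deg x, 0))"

lemma rep_apply: "endo_apply (rep x) p = (B x (fst p) - snd p *\<^sub>R deg x, 0)"
proof -
  have "linear (\<lambda>p. (B x (fst p) - snd p *\<^sub>R deg x, 0 :: real))"
    by (rule linearI) (auto simp: algebra_simps linear_add[OF linear_B(1)] linear_scale[OF linear_B(1)])
  then show ?thesis
    unfolding rep_def by (simp add: endo_apply_to_endo)
qed

lemma linear_rep: "linear rep"
  by (rule linearI; rule endo_eqI)
     (auto simp: rep_apply algebra_simps linear_add[OF linear_B(2)] linear_scale[OF linear_B(2)] 
       linear_add[OF linear_deg] linear_scale[OF linear_deg])

text \<open>On the Lie algebra this is the Jacobi identity; on the extra dimension it is the
  derivation property of \<open>deg\<close>.\<close>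

lemma rep_B: "rep (B x y) = commutator (rep x) (rep y)"
proof (rule endo_eqI)
  fix p :: "'a \<times> real"
  have B2: "B (B x y) z = B x (B y z) - B y (B x z)" for z
    using jacobi[of x y z] B_swap[of z x] B_swap[of z "B x y"] linear_neg[OF linear_B(1), of y "B x z"]
    by (simp add: algebra_simps add_eq_0_iff)
  have deg2: "deg (B x y) = B x (deg y) - B y (deg x)"
    using deg_B[of x y] B_swap[of "deg x" y] by (simp add: algebra_simps)
  show "endo_apply (rep (B x y)) p = endo_apply (commutator (rep x) (rep y)) p"
    by (simp add: B2 deg2 rep_apply commutator_def linear_diff[OF linear_B(1)] linear_scale[OF linear_B(1)] algebra_simps)
qed

text \<open>The derivation is given degree 0: \<open>F 0\<close> is the whole extension,
  \<open>F 1\<close> the Lie algebra itself, and for j \<ge> 1 \<open>F j\<close> consists of the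
  elements with layers of degree at least j only.\<close>

definition F :: "nat \<Rightarrow> ('a \<times> real) set" where
  "F j = {p. (j = 0 \<or> snd p = 0) \<and> (\<forall>i<j. \<pi> i (fst p) = 0)}"

definition J :: "nat \<Rightarrow> ('a \<times> real) endo set" where
  "J k = {f. \<forall>j. \<forall>p\<in>F j. endo_apply f p \<in> F (j + k)}"

lemma subspace_F: "subspace (F j)"
  by (auto simp: F_def subspace_def linear_0[OF linear_proj] linear_add[OF linear_proj] linear_scale[OF linear_proj])

lemma F_Suc: "F (Suc j) \<subseteq> F j"
  by (auto simp: F_def)

lemma F_Suc_ups: "F (Suc ups) \<subseteq> {0}"
proof
  fix p assume p: "p \<in> F (Suc ups)"
  then have "fst p = 0"
    using sum_proj[of "fst p"] by (simp add: F_def)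
  with p show "p \<in> {0}" by (simp add: F_def prod_eq_iff)
qed

text \<open>The flag reaches 0 after \<open>ups + 1\<close> steps, so the truncation order is
  exactly the bound \<open>ups\<close> in the sums defining \<open>bch\<close>.\<close>

sublocale nilpotent_filtration J ups
proof
  show "subspace (J k)" for k
    by (auto simp: J_def subspace_def subspace_0[OF subspace_F] subspace_add[OF subspace_F] subspace_scale[OF subspace_F])
  show "a * b \<in> J (i + j)" if "a \<in> J i" "b \<in> J j" for a b i j
    unfolding J_def
  proof safe
    fix l a' b' assume "(a', b') \<in> F l"
    then have "endo_apply a (endo_apply b (a', b')) \<in> F (l + j + i)"
      using that by (auto simp: J_def)
    then show "endo_apply (a * b) (a', b') \<in> F (l + (i + j))" by (simp add: ac_simps)
  qed
  show "J (Suc k) \<subseteq> J k" for k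
    using F_Suc by (fastforce simp: J_def)
  show "1 \<in> J 0" by (simp add: J_def)
  show "J (Suc ups) \<subseteq> {0}"
  proof
    fix f assume f: "f \<in> J (Suc ups)"
    have "endo_apply f p = 0" for p
    proof -
      have "p \<in> F 0" by (simp add: F_def)
      then have "endo_apply f p \<in> F (0 + Suc ups)" using f unfolding J_def by blast
      then show ?thesis using F_Suc_ups by auto
    qed
    then show "f \<in> {0}" by (auto intro: endo_eqI)
  qed
qed

lemma proj_B_layers:
  assumes "i \<in> {1..ups}" "j \<in> {1..ups}" "u \<in> W i" "v \<in> W j" "k \<noteq> i + j"
  shows "\<pi> k (B u v) = 0"
proof (cases "i + j \<le> ups")
  case True
  then have "B u v \<in> W (i + j)" "i + j \<in> {1..ups}" using B_layers[OF assms(1-4)] assms by auto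
  then show ?thesis using assms(5) by (simp add: proj_layer)
next
  case False
  then have "B u v = 0" using B_layers[OF assms(1-4)] by simp
  then show ?thesis by (simp add: linear_0[OF linear_proj])
qed

text \<open>All layers have degree at least 1, so a bracket with x gains a degree; the derivation,
  of degree 0, is sent to a multiple of \<open>deg x\<close> in degree at least 1.\<close>

lemma rep_J1: "rep x \<in> J 1"
  unfolding J_def
proof (safe)
  fix j y r assume p: "(y, r) \<in> F j"
  show "endo_apply (rep x) (y, r) \<in> F (j + 1)"
  proof (cases "j = 0")
    case True
    then show ?thesis by (simp add: F_def rep_apply proj_outside)
  next
    case False
    then have r: "r = 0" and y: "\<And>i. i < j \<Longrightarrow> \<pi> i y = 0" using p by (auto simp: F_def)
    have "\<pi> k (B x y) = 0" if "k < j + 1" for k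
    proof -
      have "\<pi> k (B (\<pi> i x) (\<pi> l y)) = 0" if "i \<in> {1..ups}" "l \<in> {1..ups}" for i l
      proof (cases "l < j")
        case True
        then show ?thesis by (simp add: y linear_0[OF linear_B(1)] linear_0[OF linear_proj])
      next
        case False
        then show ?thesis
          using that \<open>k < j + 1\<close> by (intro proj_B_layers[OF that] proj_in_W) auto
      qed
      then show ?thesis
        by (subst B_expand) (simp add: linear_sum[OF linear_proj])
    qed
    then show ?thesis by (simp add: r F_def rep_apply)
  qed
qed

text \<open>Evaluating \<open>rep x\<close> at the derivation (0, 1) returns \<open>- deg x\<close>,
  and \<open>deg\<close> is bounded below because it is injective in finite dimension.\<close>

lemma rep_lower_bound: "\<exists>C>0. \<forall>x. norm x \<le> C * norm (rep x)"
proof -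
  have "inj deg"
    using deg_inj linear_injective_0[OF linear_deg] by blast
  then obtain c where c: "c > 0" "\<And>x. c * norm x \<le> norm (deg x)"
    using linear_inj_bounded_below_pos[OF linear_deg] by blast
  have "norm x \<le> (1 / c) * norm (rep x)" for x
  proof -
    have "norm (deg x) = norm (endo_apply (rep x) (0, 1))"
      by (simp add: rep_apply linear_0[OF linear_B(1)] norm_Pair)
    also have "\<dots> \<le> norm (rep x)"
      using norm_endo_apply[of "rep x" "(0, 1)"] by (simp add: norm_Pair)
    finally show ?thesis using c(1) c(2)[of x] by (simp add: field_simps)
  qed
  with c(1) show ?thesis by (intro exI[of _ "1 / c"]) simp
qed

lemma bounded_linear_rep: "bounded_linear rep"
  using linear_rep linear_conv_bounded_linear by blast

lemma rep_inj: "rep x = rep y \<Longrightarrow> x = y"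
proof -
  assume "rep x = rep y"
  then have "rep (x - y) = 0" by (simp add: linear_diff[OF linear_rep])
  moreover obtain C where "norm (x - y) \<le> C * norm (rep (x - y))" using rep_lower_bound by blast
  ultimately show ?thesis by simp
qed

definition Exp :: "'a \<Rightarrow> ('a \<times> real) endo" where
  "Exp x = exp (rep x)"

lemma Exp_inj: "Exp x = Exp y \<Longrightarrow> x = y"
  unfolding Exp_def using exp_inj[OF rep_J1 rep_J1] rep_inj by blast

abbreviation bch_prod :: "'a \<Rightarrow> 'a \<Rightarrow> 'a" (infixl "\<odot>" 70) where
  "x \<odot> y \<equiv> bch B ups x y"

text \<open>\<open>rep\<close> turns brackets into commutators, where Dynkin's formula is already
  known. Together with injectivity of \<open>Exp\<close>, group laws of \<open>bch\<close> can now
  be read off from operator multiplication.\<close>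

theorem Exp_bch: "Exp (x \<odot> y) = Exp x * Exp y"
  unfolding Exp_def bch_eq_dynkin
  by (subst dynkin_map[where B' = commutator, OF linear_rep rep_B]) (rule exp_dynkin[OF rep_J1 rep_J1])

lemma Exp_uminus: "Exp x * Exp (- x) = 1" "Exp (- x) * Exp x = 1"
  using exp_minus_inverse[of "rep x"] exp_minus_inverse[of "rep (- x)"]
  by (simp_all add: Exp_def linear_neg[OF linear_rep])

lemma Exp_0: "Exp 0 = 1"
  by (simp add: Exp_def linear_0[OF linear_rep])

lemma bch_assoc: "x \<odot> y \<odot> z = x \<odot> (y \<odot> z)"
  by (rule Exp_inj) (simp add: Exp_bch mult.assoc)

lemma bch_uminus: "- x \<odot> x = 0"
  by (rule Exp_inj) (simp add: Exp_bch Exp_uminus Exp_0)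

lemma bch_scaleR_same: "(r *\<^sub>R x) \<odot> (s *\<^sub>R x) = (r + s) *\<^sub>R x"
proof (rule Exp_inj)
  have "Exp ((r + s) *\<^sub>R x) = exp (r *\<^sub>R rep x + s *\<^sub>R rep x)"
    by (simp add: Exp_def linear_add[OF linear_rep] linear_scale[OF linear_rep] scaleR_add_left)
  also have "\<dots> = exp (r *\<^sub>R rep x) * exp (s *\<^sub>R rep x)"
    by (rule exp_add_commuting) simp
  finally show "Exp ((r *\<^sub>R x) \<odot> (s *\<^sub>R x)) = Exp ((r + s) *\<^sub>R x)"
    by (simp add: Exp_bch) (simp add: Exp_def linear_scale[OF linear_rep])
qed

lemma Exp_differentiable: "Exp differentiable (at x)"
proof -
  have pow: "(\<lambda>x. rep x ^ n) differentiable (at x)" for n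
  proof (induction n)
    case (Suc n)
    show ?case unfolding power_Suc
      by (rule differentiable_mult[OF bounded_linear_imp_differentiable[OF bounded_linear_rep] Suc])
  qed simp
  have eq: "Exp = (\<lambda>x. \<Sum>n\<le>ups. (1 / fact n) *\<^sub>R rep x ^ n)"
    by (simp add: fun_eq_iff Exp_def exp_eq_sum[OF rep_J1] divide_inverse)
  show ?thesis
    unfolding eq by (intro differentiable_sum differentiable_scaleR differentiable_const pow ballI) simp_all
qed

lemma dil_bch: "\<delta> s (x \<odot> y) = \<delta> s x \<odot> \<delta> s y"
  by (rule bch_map[where B' = B, OF linear_dil dil_B])

end

text \<open>\<^term>\<open>\<pi> 1\<close> is a homomorphism onto an abelian Lie algebra, where the product is addition.\<close>
lemma (in graded_lie) proj_1_bch: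
  "\<pi> 1 (x \<odot> y) = \<pi> 1 x + \<pi> 1 y"
proof (cases "ups = 0")
  case True
  then show ?thesis using proj_outside[of 1] by simp
next
  case False
  then have 1: "1 \<in> {1..ups}" by simp
  let ?W = "\<lambda>i. if i = 1 then UNIV else {0 :: 'a}"
  define W' :: "nat \<Rightarrow> 'a set" where "W' = ?W"
  \<comment> \<open>The zero bracket with the whole space as first layer is again a graded Lie
    algebra, so the theory applies to it; its operators commute, and injectivity of its exponential
    identifies the product with addition.\<close>
  interpret abelian: graded_lie "\<lambda>_ _. 0" W' ups
  proof
    have "\<exists>!c. (\<forall>i. i \<notin> {1..ups} \<longrightarrow> c i = 0) \<and> (\<forall>i\<in>{1..ups}. c i \<in> ?W i) \<and> x = (\<Sum>i=1..ups. c i)" for x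
    proof (rule ex1I)
      let ?c = "\<lambda>i. if i = 1 then x else 0"
      show "(\<forall>i. i \<notin> {1..ups} \<longrightarrow> ?c i = 0) \<and> (\<forall>i\<in>{1..ups}. ?c i \<in> ?W i) \<and> x = (\<Sum>i=1..ups. ?c i)"
        using 1 by auto
    next
      fix c assume c: "(\<forall>i. i \<notin> {1..ups} \<longrightarrow> c i = 0) \<and> (\<forall>i\<in>{1..ups}. c i \<in> ?W i) \<and> x = (\<Sum>i=1..ups. c i)"
      then have c0: "c i = 0" if "i \<noteq> 1" for i 
      proof (cases "i \<in> {1..ups}")
        case True
        with c have "c i \<in> ?W i" by blast
        with that show ?thesis by simp
      qed (use c in blast)
      have "(\<Sum>i=1..ups. c i) = (\<Sum>i\<in>{1}. c i)"
        by (rule sum.mono_neutral_right) (use 1 c0 in auto)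
      then show "c = (\<lambda>i. if i = 1 then x else 0)" using c c0 by auto
    qed
    moreover have "bilinear (\<lambda>_ _. 0 :: 'a)" by (simp add: bilinear_def linear_zero)
    ultimately show "graded_lie_algebra (\<lambda>_ _. 0) W' ups"
      unfolding W'_def graded_lie_algebra_def by (auto simp: subspace_UNIV subspace_0)
  qed
  have proj_B: "\<pi> 1 (B x y) = 0" for x y
    by (subst B_expand) (simp add: linear_sum[OF linear_proj] proj_B_layers proj_in_W)
  have "\<pi> 1 (x \<odot> y) = bch (\<lambda>_ _. 0) ups (\<pi> 1 x) (\<pi> 1 y)"
    by (rule bch_map[OF linear_proj proj_B])
  also have "\<dots> = \<pi> 1 x + \<pi> 1 y"
  proof (rule abelian.Exp_inj)
    let ?u = "\<pi> 1 x" and ?v = "\<pi> 1 y"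
    have "commutator (abelian.rep ?u) (abelian.rep ?v) = 0"
      unfolding abelian.rep_B[symmetric] by (rule linear_0[OF abelian.linear_rep])
    then show "abelian.Exp (bch (\<lambda>_ _. 0) ups ?u ?v) = abelian.Exp (?u + ?v)"
      by (simp add: abelian.Exp_bch) 
         (simp add: abelian.Exp_def linear_add[OF abelian.linear_rep] exp_add_commuting commutator_def)
  qed
  finally show ?thesis .
qed

subsection \<open>Horizontal curves\<close>

context graded_lie
begin

text \<open>A Euclidean space is nonzero, so at least one layer is present.\<close>

lemma ups_pos: "1 \<in> {1..ups}"
proof -
  obtain x :: 'a where "x \<noteq> 0" using nonempty_Basis nonzero_Basis by blast
  then have "ups \<noteq> 0" using sum_proj[of x] by (intro notI) simp
  then show ?thesis by simp
qed

lemma abs_cont_on_Exp: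
  assumes "abs_cont_on a b f"
  shows "abs_cont_on a b (\<lambda>x. Exp (f x))"
proof -
  have eq: "Exp (f x) = (\<Sum>n\<le>ups. (1 / fact n) *\<^sub>R rep (f x) ^ n)" for x
    by (simp add: Exp_def exp_eq_sum[OF rep_J1] divide_inverse)
  show ?thesis
    unfolding eq
    by (intro abs_cont_on_sum abs_cont_on_bounded_linear[OF bounded_linear_scaleR_right] abs_cont_on_power
          abs_cont_on_bounded_linear[OF bounded_linear_rep] assms)
qed

definition velocity :: "real \<Rightarrow> real \<Rightarrow> (real \<Rightarrow> 'a) \<Rightarrow> real \<Rightarrow> 'a" where
  "velocity a b gam s = vector_derivative (\<lambda>r. \<pi> 1 (gam r)) (at s within {a..b})"

lemma bounded_linear_proj: "bounded_linear (\<pi> i)"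
  by (rule linear_proj[THEN linear_conv_bounded_linear[THEN iffD1]])

lemma bounded_linear_dil: "bounded_linear (\<delta> s)"
  by (rule linear_dil[THEN linear_conv_bounded_linear[THEN iffD1]])

text \<open>Projecting the left invariant direction gives \<pi> 1 (gam s) + r U, so U is the
  derivative of the first-layer component. The existentially quantified U of the definition is
  thereby identified with \<open>velocity\<close>.\<close>

lemma horizontal_velocity:
  assumes "horizontal B W ups a b gam" "a < b"
  obtains E where "negligible E"
    and "\<And>s. s \<in> {a..b} - E \<Longrightarrow> velocity a b gam s \<in> W 1"
    and "\<And>s. s \<in> {a..b} - E \<Longrightarrow> ((\<lambda>r. \<pi> 1 (gam r)) has_vector_derivative velocity a b gam s) (at s within {a..b})"
    and "\<And>s. s \<in> {a..b} - E \<Longrightarrow> \<exists>v. (gam has_vector_derivative v) (at s within {a..b}) \<and>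
           ((\<lambda>r. gam s \<odot> r *\<^sub>R velocity a b gam s) has_vector_derivative v) (at 0)"
proof -
  define P where "P s \<longleftrightarrow> (\<exists>U\<in>W 1. \<exists>v. (gam has_vector_derivative v) (at s within {a..b}) \<and>
                     ((\<lambda>r. gam s \<odot> r *\<^sub>R U) has_vector_derivative v) (at 0))" for s
  have "AE s in lborel. s \<in> {a..b} \<longrightarrow> P s"
    using assms(1) unfolding horizontal_def P_def by (rule conjunct2)
  then obtain E where E: "E \<in> null_sets lborel" "{s \<in> space lborel. \<not> (s \<in> {a..b} \<longrightarrow> P s)} \<subseteq> E"
    unfolding eventually_ae_filter by blast
  then have hor: "P s" if "s \<notin> E" "s \<in> {a..b}" for s
    using that by auto
  have "negligible E"
    using E(1) by (simp add: negligible_iff_null_sets null_sets_completionI)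
  have main: "velocity a b gam s \<in> W 1 \<and>
      ((\<lambda>r. \<pi> 1 (gam r)) has_vector_derivative velocity a b gam s) (at s within {a..b}) \<and>
      (\<exists>v. (gam has_vector_derivative v) (at s within {a..b}) \<and>
           ((\<lambda>r. gam s \<odot> r *\<^sub>R velocity a b gam s) has_vector_derivative v) (at 0))"
    if s: "s \<in> {a..b} - E" for s
  proof -
    obtain U v where U: "U \<in> W 1" and v: "(gam has_vector_derivative v) (at s within {a..b})"
      and v': "((\<lambda>r. gam s \<odot> r *\<^sub>R U) has_vector_derivative v) (at 0)"
      using hor[of s] s unfolding P_def by blast
    have "((\<lambda>r. \<pi> 1 (gam s \<odot> r *\<^sub>R U)) has_vector_derivative \<pi> 1 v) (at 0)"
      by (rule bounded_linear.has_vector_derivative[OF bounded_linear_proj v'])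
    moreover have "(\<lambda>r. \<pi> 1 (gam s \<odot> r *\<^sub>R U)) = (\<lambda>r. \<pi> 1 (gam s) + r *\<^sub>R U)"
      by (simp only: proj_1_bch linear_scale[OF linear_proj] proj_layer[OF U ups_pos] refl if_True)
    moreover have "((\<lambda>r. \<pi> 1 (gam s) + r *\<^sub>R U) has_vector_derivative U) (at 0)"
      by (auto intro!: derivative_eq_intros)
    ultimately have "\<pi> 1 v = U"
      by (metis vector_derivative_unique_at)
    then have "((\<lambda>r. \<pi> 1 (gam r)) has_vector_derivative U) (at s within {a..b})"
      using bounded_linear.has_vector_derivative[OF bounded_linear_proj v, of 1] by simp
    moreover from this have "velocity a b gam s = U"
      unfolding velocity_def using s \<open>a < b\<close> 
      by (intro vector_derivative_within_cbox[of a b, unfolded box_real]) auto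
    ultimately show ?thesis using U v v' by auto
  qed
  show thesis
    by (rule that[OF \<open>negligible E\<close>]) (use main in blast)+
qed

text \<open>The differential of \<open>Exp\<close> at the point need not be computed. The curve
  \<open>gam\<close> and the curve r \<mapsto> gam s \<odot> r U have the same velocity v, and on
  the second, after dilation, \<open>Exp\<close> is a translate of a one-parameter group. The factor
  c is the action of the dilation on the first layer.\<close>

lemma Exp_dil_has_vector_derivative:
  assumes v: "(gam has_vector_derivative v) (at s within S)"
    and v': "((\<lambda>r. gam s \<odot> r *\<^sub>R U) has_vector_derivative v) (at 0)"
    and U: "U \<in> W 1"
  shows "((\<lambda>r. Exp (\<delta> c (gam r))) has_vector_derivative c *\<^sub>R (Exp (\<delta> c (gam s)) * rep U)) (at s within S)"
proof -
  obtain D where D: "(Exp has_derivative D) (at (\<delta> c (gam s)))"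
    using Exp_differentiable unfolding differentiable_def by blast
  have cU: "\<delta> c U = c *\<^sub>R U" using dil_layer_1[OF U] ups_pos by simp
  have "((\<lambda>r. \<delta> c (gam r)) has_vector_derivative \<delta> c v) (at s within S)"
    by (rule bounded_linear.has_vector_derivative[OF bounded_linear_dil v])
  then have 1: "(Exp \<circ> (\<lambda>r. \<delta> c (gam r)) has_vector_derivative D (\<delta> c v)) (at s within S)"
    by (rule vector_derivative_diff_chain_within) (rule has_derivative_at_withinI[OF D])
  have "gam s \<odot> 0 *\<^sub>R U = gam s"
    by (rule Exp_inj) (simp add: Exp_bch Exp_0)
  then have D': "(Exp has_derivative D) (at (\<delta> c (gam s \<odot> 0 *\<^sub>R U)) within X)" for X
    using has_derivative_at_withinI[OF D] by simp
  have "((\<lambda>r. \<delta> c (gam s \<odot> r *\<^sub>R U)) has_vector_derivative \<delta> c v) (at 0)"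
    by (rule bounded_linear.has_vector_derivative[OF bounded_linear_dil v'])
  then have "(Exp \<circ> (\<lambda>r. \<delta> c (gam s \<odot> r *\<^sub>R U)) has_vector_derivative D (\<delta> c v)) (at 0)"
    by (rule vector_derivative_diff_chain_within) (rule D')
  moreover have "Exp \<circ> (\<lambda>r. \<delta> c (gam s \<odot> r *\<^sub>R U)) = (\<lambda>r. Exp (\<delta> c (gam s)) * exp (r *\<^sub>R (c *\<^sub>R rep U)))"
    by (simp add: fun_eq_iff dil_bch Exp_bch linear_scale[OF linear_dil] cU) 
       (simp add: Exp_def linear_scale[OF linear_rep])
  moreover have "((\<lambda>r. Exp (\<delta> c (gam s)) * exp (r *\<^sub>R (c *\<^sub>R rep U))) has_vector_derivative
      Exp (\<delta> c (gam s)) * (exp (0 *\<^sub>R (c *\<^sub>R rep U)) * (c *\<^sub>R rep U))) (at 0)"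
    by (intro has_vector_derivative_mult_right exp_scaleR_has_vector_derivative_right)
  ultimately have "D (\<delta> c v) = Exp (\<delta> c (gam s)) * (exp (0 *\<^sub>R (c *\<^sub>R rep U)) * (c *\<^sub>R rep U))"
    by (metis vector_derivative_unique_at)
  with 1 show ?thesis by (simp add: o_def)
qed

lemma abs_cont_on_horizontal: "horizontal B W ups a b gam \<Longrightarrow> abs_cont_on a b gam"
  by (simp add: horizontal_def)

lemma velocity_absolutely_integrable:
  assumes hor: "horizontal B W ups a b gam" and "a < b"
  shows "velocity a b gam absolutely_integrable_on {a..b}"
proof -
  obtain E where E: "negligible E" "\<And>s. s \<in> {a..b} - E \<Longrightarrow>
       ((\<lambda>r. \<pi> 1 (gam r)) has_vector_derivative velocity a b gam s) (at s within {a..b})"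
    using horizontal_velocity[OF assms] by metis
  show ?thesis
    by (rule abs_cont_on_deriv_absolutely_integrable[OF 
          abs_cont_on_bounded_linear[OF bounded_linear_proj abs_cont_on_horizontal[OF hor]] _ E])
       (use \<open>a < b\<close> in auto)
qed

lemma velocity_diff_absolutely_integrable:
  assumes "horizontal B W ups a b gam" "a < b" "{c..d} \<subseteq> {a..b}"
  shows "(\<lambda>s. velocity a b gam s - \<xi>) absolutely_integrable_on {c..d}"
proof (rule set_integral_diff(1))
  show "velocity a b gam absolutely_integrable_on {c..d}"
    by (rule set_integrable_subset[OF velocity_absolutely_integrable[OF assms(1,2)]]) (use assms(3) in auto)
  show "(\<lambda>s. \<xi>) absolutely_integrable_on {c..d}"
    by (rule absolutely_integrable_continuous_real) (rule continuous_on_const)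
qed

lemma norm_velocity_diff_integrable:
  assumes "horizontal B W ups a b gam" "a < b" "{c..d} \<subseteq> {a..b}"
  shows "(\<lambda>s. norm (velocity a b gam s - \<xi>)) integrable_on {c..d}"
  using velocity_diff_absolutely_integrable[OF assms] by (simp add: absolutely_integrable_on_def)

abbreviation seg :: "real \<Rightarrow> real \<Rightarrow> real set" where
  "seg t s \<equiv> {min t s..max t s}"

text \<open>Induction along the filtration: the derivative of \<open>Q z\<close> is \<open>Q (X z) / h\<close>, and \<open>X z\<close> lies one
  step deeper than \<open>z\<close>.\<close>
lemma development_bound:
  assumes hor: "horizontal B W ups a b gam" and ab: "a < b" and t: "t \<in> {a..b}" and th: "t + h \<in> {a..b}" and "h \<noteq> 0"
    and K: "\<And>x. norm (rep x) \<le> K * norm x" "K \<ge> 0"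
  defines "L \<equiv> integral (seg t (t + h)) (\<lambda>s. norm (velocity a b gam s)) / \<bar>h\<bar>"
  defines "Q \<equiv> \<lambda>s. Exp (- \<delta> (1 / h) (gam t)) * Exp (\<delta> (1 / h) (gam s))"
  assumes s: "s \<in> seg t (t + h)" and z: "z \<in> J (Suc ups - j)" and "j \<le> Suc ups"
  shows "norm (Q s * z) \<le> (1 + K * L) ^ j * norm z"
  using s z \<open>j \<le> Suc ups\<close>
\<comment> \<open>The induction hypothesis is applied at every r between t and s, and to
  \<open>rep (velocity a b gam r) * z\<close> in place of z.\<close>
proof (induction j arbitrary: s z)
  case 0
  then show ?case using J_zero[of z "Suc ups"] by simp
next
  case (Suc j)
  note s = Suc.prems(1) and z = Suc.prems(2)
  obtain E where E: "negligible E" "\<And>s. s \<in> {a..b} - E \<Longrightarrow> velocity a b gam s \<in> W 1"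
     "\<And>s. s \<in> {a..b} - E \<Longrightarrow> \<exists>v. (gam has_vector_derivative v) (at s within {a..b}) \<and>
           ((\<lambda>r. gam s \<odot> r *\<^sub>R velocity a b gam s) has_vector_derivative v) (at 0)"
    using horizontal_velocity[OF hor ab] by metis
  let ?g = "velocity a b gam"
  have segs: "seg t (t + h) \<subseteq> {a..b}" "seg t s \<subseteq> seg t (t + h)" using t th s by auto
  have int: "(\<lambda>r. norm (?g r)) integrable_on {c..d}" if "{c..d} \<subseteq> {a..b}" for c d
    using norm_velocity_diff_integrable[OF hor ab that, of 0] by simp
  have L: "L \<ge> 0" unfolding L_def by (intro divide_nonneg_nonneg integral_nonneg int segs) auto
  have deriv: "((\<lambda>r. Q r * z) has_vector_derivative (1 / h) *\<^sub>R (Q r * (rep (?g r) * z))) (at r within {a..b})"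
    if "r \<in> {a..b} - E" for r
  proof -
    obtain v where v: "(gam has_vector_derivative v) (at r within {a..b})"
           "((\<lambda>q. gam r \<odot> q *\<^sub>R ?g r) has_vector_derivative v) (at 0)"
      using E(3)[OF \<open>r \<in> {a..b} - E\<close>] by blast
    have "((\<lambda>r. Exp (\<delta> (1 / h) (gam r))) has_vector_derivative (1 / h) *\<^sub>R (Exp (\<delta> (1 / h) (gam r)) * rep (?g r))) (at r within {a..b})"
      by (rule Exp_dil_has_vector_derivative[OF v E(2)[OF that]])
    from has_vector_derivative_mult_left[OF has_vector_derivative_mult_right[OF this]]
    show ?thesis unfolding Q_def by (simp add: mult.assoc)
  qed
  let ?k = "\<lambda>r. ((1 + K * L) ^ j * K * norm z / \<bar>h\<bar>) * norm (?g r)"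
  have ac: "abs_cont_on a b (\<lambda>r. Q r * z)"
    unfolding Q_def
    by (intro abs_cont_on_mult abs_cont_on_const abs_cont_on_Exp abs_cont_on_bounded_linear[OF bounded_linear_dil]
          abs_cont_on_horizontal[OF hor])
  have bound: "norm ((1 / h) *\<^sub>R (Q r * (rep (?g r) * z))) \<le> ?k r" if "r \<in> seg t s - E" for r
  proof -
    have "rep (?g r) * z \<in> J (Suc ups - j)"
      by (rule mult_J_le[OF rep_J1 z]) (use Suc.prems(3) in auto)
    moreover have "r \<in> seg t (t + h)" using that segs(2) by blast
    ultimately have "norm (Q r * (rep (?g r) * z)) \<le> (1 + K * L) ^ j * norm (rep (?g r) * z)"
      using Suc.IH Suc.prems(3) by simp
    also have "\<dots> \<le> (1 + K * L) ^ j * (K * norm (?g r) * norm z)"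
    proof (rule mult_left_mono)
      have "norm (rep (?g r) * z) \<le> norm (rep (?g r)) * norm z" by (rule norm_mult_ineq)
      also have "\<dots> \<le> K * norm (?g r) * norm z" by (intro mult_right_mono K) simp
      finally show "norm (rep (?g r) * z) \<le> K * norm (?g r) * norm z" .
    qed (use K L in simp)
    finally have "norm (Q r * (rep (?g r) * z)) / \<bar>h\<bar> \<le> (1 + K * L) ^ j * (K * norm (?g r) * norm z) / \<bar>h\<bar>"
      by (rule divide_right_mono) simp
    then show ?thesis by (simp add: mult_ac)
  qed
  have "?k integrable_on seg t s"
    using integrable_cmul[OF int[OF order_trans[OF segs(2) segs(1)]], of "(1 + K * L) ^ j * K * norm z / \<bar>h\<bar>"]
    by (simp only: real_scaleR_def)
  then have incr: "norm (Q (max t s) * z - Q (min t s) * z) \<le> integral (seg t s) ?k"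
    by (intro abs_cont_on_increment_bound[OF ac E(1) deriv bound] order_trans[OF segs(2) segs(1)]) auto
  also have "\<dots> = ((1 + K * L) ^ j * K * norm z / \<bar>h\<bar>) * integral (seg t s) (\<lambda>r. norm (?g r))"
    by (rule integral_mult_right)
  \<comment> \<open>Enlarging the segment to its full length produces the same mean L for every
    s.\<close>
  also have "\<dots> \<le> ((1 + K * L) ^ j * K * norm z / \<bar>h\<bar>) * integral (seg t (t + h)) (\<lambda>r. norm (?g r))"
    by (intro mult_left_mono integral_subset_le int segs order_trans[OF segs(2) segs(1)]) (use K L in auto)
  also have "\<dots> = (1 + K * L) ^ j * (K * L) * norm z"
    by (simp add: L_def)
  finally have "norm (Q (max t s) * z - Q (min t s) * z) \<le> (1 + K * L) ^ j * (K * L) * norm z" .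
  moreover have "Q t = 1" by (simp add: Q_def Exp_uminus)
  ultimately have "norm (Q s * z - z) \<le> (1 + K * L) ^ j * (K * L) * norm z"
    by (cases "t \<le> s") (auto simp: min_def max_def norm_minus_commute)
  then have "norm (Q s * z) \<le> norm z + (1 + K * L) ^ j * (K * L) * norm z"
    using norm_triangle_sub[of "Q s * z" z] by simp
  also have "\<dots> \<le> (1 + K * L) ^ j * norm z + (1 + K * L) ^ j * (K * L) * norm z"
    using K L by (simp add: mult_le_cancel_right1 one_le_power)
  also have "\<dots> = (1 + K * L) ^ Suc j * norm z" by (simp add: algebra_simps)
  finally show ?case .
qed

text \<open>Any \<xi> in the first layer is allowed, which keeps this estimate independent of how
  g1(t) is shown to lie there. The mean of the velocity is at most \<open>A + norm \<xi>\<close>, so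
  only these two quantities enter.\<close>

lemma rescaled_increment_bound:
  assumes hor: "horizontal B W ups a b gam" and ab: "a < b" and t: "t \<in> {a..b}" and th: "t + h \<in> {a..b}" and h: "h \<noteq> 0"
    and K: "\<And>x. norm (rep x) \<le> K * norm x" "K \<ge> 0" and xi: "\<xi> \<in> W 1"
  defines "A \<equiv> integral (seg t (t + h)) (\<lambda>s. norm (velocity a b gam s - \<xi>)) / \<bar>h\<bar>"
  defines "e \<equiv> \<delta> (1 / h) (- (h *\<^sub>R \<xi>) \<odot> - gam t \<odot> gam (t + h))"
  shows "norm (Exp e - 1) \<le> exp (3 * K * norm \<xi>) * (1 + K * (A + norm \<xi>)) ^ Suc ups * K * A"
proof -
  obtain E where E: "negligible E" "\<And>s. s \<in> {a..b} - E \<Longrightarrow> velocity a b gam s \<in> W 1"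
     "\<And>s. s \<in> {a..b} - E \<Longrightarrow> \<exists>v. (gam has_vector_derivative v) (at s within {a..b}) \<and>
           ((\<lambda>r. gam s \<odot> r *\<^sub>R velocity a b gam s) has_vector_derivative v) (at 0)"
    using horizontal_velocity[OF hor ab] by metis
  let ?g = "velocity a b gam"
  define L where "L = integral (seg t (t + h)) (\<lambda>s. norm (?g s)) / \<bar>h\<bar>"
  define Q where "Q s = Exp (- \<delta> (1 / h) (gam t)) * Exp (\<delta> (1 / h) (gam s))" for s
  define X where "X = rep \<xi>"
  define M where "M = (1 + K * L) ^ Suc ups"
  have segs: "seg t (t + h) \<subseteq> {a..b}" using t th by auto
  note int = norm_velocity_diff_integrable[OF hor ab segs]
  have L: "L \<ge> 0" "A \<ge> 0" unfolding L_def A_def 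
    using int[of 0] int[of \<xi>] by (auto intro!: divide_nonneg_nonneg integral_nonneg)
  have LA: "L \<le> A + norm \<xi>"
  proof -
    have "integral (seg t (t + h)) (\<lambda>s. norm (?g s)) \<le> integral (seg t (t + h)) (\<lambda>s. norm (?g s - \<xi>) + norm \<xi>)"
    proof (rule integral_le)
      show "norm (?g s) \<le> norm (?g s - \<xi>) + norm \<xi>" for s
        using norm_triangle_sub[of "?g s" \<xi>] by simp
    qed (use int[of 0] int[of \<xi>] in \<open>auto intro!: integrable_add\<close>)
    also have "\<dots> = integral (seg t (t + h)) (\<lambda>s. norm (?g s - \<xi>)) + \<bar>h\<bar> * norm \<xi>"
      using int[of \<xi>] by (subst integral_add) (auto simp: min_def max_def)
    finally have "L \<le> (integral (seg t (t + h)) (\<lambda>s. norm (?g s - \<xi>)) + \<bar>h\<bar> * norm \<xi>) / \<bar>h\<bar>"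
      unfolding L_def by (rule divide_right_mono) simp
    then show ?thesis using h by (simp add: A_def add_divide_distrib)
  qed
  \<comment> \<open>Here z = 1, which lies only in degree 0; hence the exponent
    \<open>Suc ups\<close>.\<close>
  have QM: "norm (Q s) \<le> M" if "s \<in> seg t (t + h)" for s
    using development_bound[OF hor ab t th h K that, of 1 "Suc ups"] one_J
    by (simp add: Q_def M_def L_def)
  have M: "M \<ge> 0" unfolding M_def using K L by simp
  \<comment> \<open>\<sigma> runs from 0 at t to -1 at t + h, for either sign of h, so G runs from 1
    to Q (t + h) exp (-X).\<close>
  define \<sigma> where "\<sigma> s = (- (s - t) / h)" for s
  define G where "G s = Q s * exp (\<sigma> s *\<^sub>R X)" for s
  have normX: "norm X \<le> K * norm \<xi>" unfolding X_def by (rule K)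
  have \<sigma>: "\<bar>\<sigma> s\<bar> \<le> 1" if "s \<in> seg t (t + h)" for s
    using that h by (auto simp: \<sigma>_def abs_le_iff field_simps min_def max_def split: if_splits)
  have exp_bound: "norm (exp (c *\<^sub>R X)) \<le> exp (K * norm \<xi>)" if "\<bar>c\<bar> \<le> 1" for c
  proof -
    have "norm (c *\<^sub>R X) \<le> 1 * norm X" unfolding norm_scaleR by (intro mult_right_mono that) simp
    then have "norm (c *\<^sub>R X) \<le> K * norm \<xi>" using normX by simp
    then show ?thesis using norm_exp[of "c *\<^sub>R X"] by (meson exp_le_cancel_iff order_trans)
  qed
  have deriv: "(G has_vector_derivative (1 / h) *\<^sub>R (Q r * (rep (?g r - \<xi>) * exp (\<sigma> r *\<^sub>R X)))) (at r within {a..b})"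
    if "r \<in> {a..b} - E" for r
  proof -
    obtain v where v: "(gam has_vector_derivative v) (at r within {a..b})"
           "((\<lambda>q. gam r \<odot> q *\<^sub>R ?g r) has_vector_derivative v) (at 0)"
      using E(3)[OF \<open>r \<in> {a..b} - E\<close>] by blast
    have "((\<lambda>r. Exp (\<delta> (1 / h) (gam r))) has_vector_derivative (1 / h) *\<^sub>R (Exp (\<delta> (1 / h) (gam r)) * rep (?g r))) (at r within {a..b})"
      by (rule Exp_dil_has_vector_derivative[OF v E(2)[OF that]])
    from has_vector_derivative_mult_right[OF this]
    have Q: "(Q has_vector_derivative (1 / h) *\<^sub>R (Q r * rep (?g r))) (at r within {a..b})"
      unfolding Q_def by (simp add: mult.assoc)
    have "(\<sigma> has_real_derivative - (1 / h)) (at r within {a..b})"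
      unfolding \<sigma>_def using h by (auto intro!: derivative_eq_intros)
    then have "((\<lambda>s. exp (s *\<^sub>R X)) \<circ> \<sigma> has_vector_derivative (- (1 / h)) *\<^sub>R (X * exp (\<sigma> r *\<^sub>R X))) (at r within {a..b})"
      by (intro vector_diff_chain_within has_vector_derivative_at_within[OF exp_scaleR_has_vector_derivative_left])
         (simp add: has_real_derivative_iff_has_vector_derivative)
    from has_vector_derivative_mult[OF Q this] 
    have "(G has_vector_derivative (Q r * ((- (1 / h)) *\<^sub>R (X * exp (\<sigma> r *\<^sub>R X))) + (1 / h) *\<^sub>R (Q r * rep (?g r)) * exp (\<sigma> r *\<^sub>R X))) (at r within {a..b})"
      by (simp add: G_def[abs_def] o_def)
    then show ?thesis
      by (simp add: linear_diff[OF linear_rep] X_def algebra_simps)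
  qed
  have ac: "abs_cont_on a b G"
  proof -
    have eq: "G s = Q s * Exp (\<sigma> s *\<^sub>R \<xi>)" for s
      by (simp add: G_def Exp_def X_def linear_scale[OF linear_rep])
    have "abs_cont_on a b (\<lambda>s. (t / h) *\<^sub>R \<xi> + s *\<^sub>R ((- 1 / h) *\<^sub>R \<xi>))"
      by (intro abs_cont_on_add abs_cont_on_const abs_cont_on_bounded_linear[OF bounded_linear_scaleR_left] abs_cont_on_ident)
    also have "(\<lambda>s. (t / h) *\<^sub>R \<xi> + s *\<^sub>R ((- 1 / h) *\<^sub>R \<xi>)) = (\<lambda>s. \<sigma> s *\<^sub>R \<xi>)"
    proof
      fix s
      have "\<sigma> s = t / h + s * (- 1 / h)" by (simp add: \<sigma>_def diff_divide_distrib)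
      then show "(t / h) *\<^sub>R \<xi> + s *\<^sub>R ((- 1 / h) *\<^sub>R \<xi>) = \<sigma> s *\<^sub>R \<xi>"
        by (simp only: scaleR_add_left scaleR_scaleR)
    qed
    finally show ?thesis
      unfolding eq[abs_def] unfolding Q_def
      by (intro abs_cont_on_mult abs_cont_on_const abs_cont_on_Exp abs_cont_on_bounded_linear[OF bounded_linear_dil]
            abs_cont_on_horizontal[OF hor])
  qed
  let ?c = "M * K * exp (K * norm \<xi>) / \<bar>h\<bar>"
  have bound: "norm ((1 / h) *\<^sub>R (Q r * (rep (?g r - \<xi>) * exp (\<sigma> r *\<^sub>R X)))) \<le> ?c * norm (?g r - \<xi>)"
    if "r \<in> seg t (t + h) - E" for r
  proof -
    have r: "r \<in> seg t (t + h)" using that by blast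
    have "norm (Q r * (rep (?g r - \<xi>) * exp (\<sigma> r *\<^sub>R X))) \<le> norm (Q r) * (norm (rep (?g r - \<xi>)) * norm (exp (\<sigma> r *\<^sub>R X)))"
      by (intro norm_mult_ineq[THEN order_trans] mult_left_mono norm_mult_ineq) simp
    also have "\<dots> \<le> M * (K * norm (?g r - \<xi>) * exp (K * norm \<xi>))"
      by (intro mult_mono QM[OF r] K exp_bound \<sigma>[OF r]) (use K M in auto)
    finally have "norm (Q r * (rep (?g r - \<xi>) * exp (\<sigma> r *\<^sub>R X))) / \<bar>h\<bar> \<le> M * (K * norm (?g r - \<xi>) * exp (K * norm \<xi>)) / \<bar>h\<bar>"
      by (rule divide_right_mono) simp
    then show ?thesis by (simp add: mult_ac)
  qed
  have "(\<lambda>r. ?c * norm (?g r - \<xi>)) integrable_on seg t (t + h)"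
    using integrable_cmul[OF int[of \<xi>], of ?c] by (simp only: real_scaleR_def)
  then have "norm (G (max t (t + h)) - G (min t (t + h))) \<le> integral (seg t (t + h)) (\<lambda>r. ?c * norm (?g r - \<xi>))"
    by (intro abs_cont_on_increment_bound[OF ac E(1) deriv bound] segs) auto
  also have "\<dots> = ?c * integral (seg t (t + h)) (\<lambda>r. norm (?g r - \<xi>))"
    by (rule integral_mult_right)
  also have "\<dots> = M * K * exp (K * norm \<xi>) * A" by (simp add: A_def)
  finally have "norm (G (max t (t + h)) - G (min t (t + h))) \<le> M * K * exp (K * norm \<xi>) * A" .
  moreover have "G t = 1" by (simp add: G_def Q_def \<sigma>_def Exp_uminus)
  ultimately have G1: "norm (G (t + h) - 1) \<le> M * K * exp (K * norm \<xi>) * A"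
    by (cases "h \<ge> 0") (auto simp: min_def max_def norm_minus_commute)
  have Gth: "G (t + h) = Q (t + h) * exp (- X)" using h by (simp add: G_def \<sigma>_def)
  have cU: "\<delta> (1 / h) \<xi> = (1 / h) *\<^sub>R \<xi>" using dil_layer_1[OF xi] ups_pos by simp
  have "e = - \<xi> \<odot> - \<delta> (1 / h) (gam t) \<odot> \<delta> (1 / h) (gam (t + h))"
    using h by (simp add: e_def dil_bch linear_neg[OF linear_dil] linear_scale[OF linear_dil] cU)
  then have "Exp e = exp (- X) * Q (t + h)"
    by (simp add: Exp_bch Q_def mult.assoc) (simp add: Exp_def X_def linear_neg[OF linear_rep])
  \<comment> \<open>The increment has exp (-X) on the left of Q (t + h), while G has it on the
    right; conjugation by exp X passes from one to the other. With the exponential in the bound for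
    G this makes three factors exp (K norm \<xi>).\<close>
  also have "\<dots> = exp (- X) * (G (t + h) - 1) * exp X + 1"
  proof -
    have "G (t + h) * exp X = Q (t + h)"
      using exp_minus_inverse[of "- X"] by (simp add: Gth mult.assoc)
    then show ?thesis
      using exp_minus_inverse[of "- X"] by (simp add: left_diff_distrib right_diff_distrib mult.assoc)
  qed
  finally have "norm (Exp e - 1) = norm (exp (- X) * (G (t + h) - 1) * exp X)" by simp
  also have "\<dots> \<le> norm (exp (- X)) * norm (G (t + h) - 1) * norm (exp X)"
    by (intro norm_mult_ineq[THEN order_trans] mult_right_mono norm_mult_ineq) simp
  also have "\<dots> \<le> exp (K * norm \<xi>) * (M * K * exp (K * norm \<xi>) * A) * exp (K * norm \<xi>)"
    using exp_bound[of 1] exp_bound[of "-1"] G1 K L M by (intro mult_mono) auto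
  also have "\<dots> = exp (3 * K * norm \<xi>) * M * K * A"
    by (simp add: mult_ac flip: exp_add)
  also have "\<dots> \<le> exp (3 * K * norm \<xi>) * (1 + K * (A + norm \<xi>)) ^ Suc ups * K * A"
    unfolding M_def using K L LA by (intro mult_right_mono mult_left_mono power_mono add_left_mono) auto
  finally show ?thesis .
qed

end

section \<open>The estimate in terms of mean deviations\<close>

text \<open>\<Phi> A bounds the distance of the operator from 1. The sum over n comes from the
  polynomial logarithm, C from the lower bound for \<open>rep\<close>, and K is its operator bound.
  The factor A is split off, to be multiplied in separately.\<close>

definition estimate :: "real \<Rightarrow> real \<Rightarrow> nat \<Rightarrow> real \<Rightarrow> real \<Rightarrow> real" where
  "estimate C K m A x = (let \<Phi> = exp (3 * K * x) * (1 + K * (A + x)) ^ Suc m * K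
     in C * \<Phi> * (\<Sum>n<m. (\<Phi> * A) ^ n))"

lemma estimate_mono:
  assumes "0 \<le> C" "0 \<le> K" "0 \<le> A" "A \<le> A'" "0 \<le> x" "x \<le> x'"
  shows "estimate C K m A x \<le> estimate C K m A' x'"
proof -
  define \<Phi> where "\<Phi> A x = exp (3 * K * x) * (1 + K * (A + x)) ^ Suc m * K" for A x
  have "\<Phi> A x \<le> \<Phi> A' x'"
    unfolding \<Phi>_def
    using assms by (intro mult_mono power_mono add_left_mono mult_left_mono add_mono) (auto intro: mult_left_mono)
  moreover have "0 \<le> \<Phi> A x" using assms by (simp add: \<Phi>_def)
  ultimately have "C * \<Phi> A x * (\<Sum>n<m. (\<Phi> A x * A) ^ n) \<le> C * \<Phi> A' x' * (\<Sum>n<m. (\<Phi> A' x' * A') ^ n)"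
    using assms by (intro mult_mono sum_mono power_mono sum_nonneg mult_nonneg_nonneg zero_le_power) auto
  then show ?thesis by (simp only: estimate_def Let_def \<Phi>_def)
qed

lemma estimate_nonneg: "0 \<le> C \<Longrightarrow> 0 \<le> K \<Longrightarrow> 0 \<le> A \<Longrightarrow> 0 \<le> x \<Longrightarrow> 0 \<le> estimate C K m A x"
  unfolding estimate_def Let_def by (intro mult_nonneg_nonneg sum_nonneg zero_le_power) auto

context graded_lie
begin

definition mean_dev :: "real \<Rightarrow> real \<Rightarrow> (real \<Rightarrow> 'a) \<Rightarrow> real \<Rightarrow> real \<Rightarrow> 'a \<Rightarrow> real" where
  "mean_dev a b gam t h \<xi> = integral (seg t (t + h)) (\<lambda>s. norm (velocity a b gam s - \<xi>)) / \<bar>h\<bar>"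

lemma mean_dev_nonneg:
  assumes "horizontal B W ups a b gam" "a < b" "seg t (t + h) \<subseteq> {a..b}"
  shows "0 \<le> mean_dev a b gam t h \<xi>"
  unfolding mean_dev_def using norm_velocity_diff_integrable[OF assms]
  by (intro divide_nonneg_nonneg Henstock_Kurzweil_Integration.integral_nonneg) auto

text \<open>C and K are chosen before the curve and the times, so they depend only on the
  algebra.\<close>

lemma curve_estimate:
  "\<exists>C\<ge>0. \<exists>K\<ge>0. \<forall>a b gam t h \<xi>. horizontal B W ups a b gam \<and> a < b \<and> t \<in> {a..b} \<and> t + h \<in> {a..b} \<and> h \<noteq> 0 \<and>
       \<xi> \<in> W 1 \<longrightarrow>
       norm (\<delta> (1 / h) (- (h *\<^sub>R \<xi>) \<odot> - gam t \<odot> gam (t + h)))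
         \<le> estimate C K ups (mean_dev a b gam t h \<xi>) (norm \<xi>) * mean_dev a b gam t h \<xi>"
proof -
  obtain C where C: "C > 0" "\<And>x. norm x \<le> C * norm (rep x)" using rep_lower_bound by blast
  obtain K where K: "K > 0" "\<And>x. norm (rep x) \<le> norm x * K"
    using bounded_linear.pos_bounded[OF bounded_linear_rep] by blast
  show ?thesis
  proof (rule exI[of _ C], rule conjI[rotated], rule exI[of _ K], rule conjI[rotated], intro allI impI, elim conjE)
    fix a b gam t h \<xi>
    assume *: "horizontal B W ups a b gam" "a < b" "t \<in> {a..b}" "t + h \<in> {a..b}" "h \<noteq> 0" and xi: "\<xi> \<in> W 1"
    define A where "A = mean_dev a b gam t h \<xi>"
    define e where "e = \<delta> (1 / h) (- (h *\<^sub>R \<xi>) \<odot> - gam t \<odot> gam (t + h))"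
    define \<Phi> where "\<Phi> = exp (3 * K * norm \<xi>) * (1 + K * (A + norm \<xi>)) ^ Suc ups * K"
    have E: "norm (Exp e - 1) \<le> \<Phi> * A"
      unfolding e_def A_def \<Phi>_def mean_dev_def
      by (rule rescaled_increment_bound[OF * _ _ xi]) (use K in \<open>simp_all add: mult.commute\<close>)
    then have PA: "0 \<le> \<Phi> * A" using norm_ge_zero order_trans by blast
    have "norm e \<le> C * norm (rep e)" by (rule C(2))
    also have "\<dots> \<le> C * (norm (Exp e - 1) * (\<Sum>n<ups. norm (Exp e - 1) ^ n))"
      using norm_le_norm_exp_minus_one[OF rep_J1, of e] C(1) by (intro mult_left_mono) (auto simp: Exp_def)
    also have "\<dots> \<le> C * (\<Phi> * A * (\<Sum>n<ups. (\<Phi> * A) ^ n))"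
      using C(1) PA by (intro mult_left_mono mult_mono E sum_mono power_mono sum_nonneg zero_le_power) auto
    also have "\<dots> = estimate C K ups A (norm \<xi>) * A"
      by (simp add: estimate_def \<Phi>_def Let_def mult_ac)
    finally show "norm (\<delta> (1 / h) (- (h *\<^sub>R \<xi>) \<odot> - gam t \<odot> gam (t + h)))
         \<le> estimate C K ups (mean_dev a b gam t h \<xi>) (norm \<xi>) * mean_dev a b gam t h \<xi>"
      by (simp only: e_def A_def)
  qed (use C K in auto)
qed

section \<open>Sup-averages and points of approximate continuity\<close>

text \<open>The mean over the whole segment is the member \<tau> = h of the supremum; dividing by c
  passes from the Euclidean norm to \<open>N\<close>.\<close>

lemma average_le_sup_avg:
  assumes hor: "horizontal B W ups a b gam" and ab: "a < b" and seg: "seg t (t + h) \<subseteq> {a..b}" and h: "h \<noteq> 0"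
    and c: "c > 0" "\<And>x. norm x \<le> c * N x"
  shows "ennreal (mean_dev a b gam t h \<xi> / c)
     \<le> sup_avg N h t (\<lambda>s. velocity a b gam s - \<xi>)"
proof -
  let ?f = "\<lambda>s. velocity a b gam s - \<xi>" and ?S = "seg t (t + h)"
  let ?I = "integral ?S (\<lambda>s. norm (?f s))"
  have "((\<lambda>s. (1 / c) * norm (?f s)) has_integral (1 / c) * ?I) ?S"
    by (intro has_integral_mult_right integrable_integral norm_velocity_diff_integrable[OF hor ab seg])
  then have "ennreal (?I / c) = (\<integral>\<^sup>+ s. indicator ?S s * ennreal ((1 / c) * norm (?f s)) \<partial>lborel)"
    using nn_integral_has_integral_lebesgue'[of ?S "\<lambda>s. (1 / c) * norm (?f s)"] c(1)
    by (simp add: mult.commute)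
  also have "\<dots> \<le> (\<integral>\<^sup>+ s. indicator ?S s * ennreal (N (?f s)) \<partial>lborel)"
    using c by (intro nn_integral_mono mult_left_mono ennreal_leI) (auto simp: field_simps)
  finally have "ennreal (?I / c) / ennreal \<bar>h\<bar> \<le> (\<integral>\<^sup>+ s. indicator ?S s * ennreal (N (?f s)) \<partial>lborel) / ennreal \<bar>h\<bar>"
    by (rule divide_right_mono_ennreal)
  moreover have "ennreal (?I / c) / ennreal \<bar>h\<bar> = ennreal (?I / \<bar>h\<bar> / c)"
    using h c(1) norm_velocity_diff_integrable[OF hor ab seg, of \<xi>]
    by (subst divide_ennreal) (auto simp: divide_divide_eq_left mult.commute intro!: divide_nonneg_nonneg Henstock_Kurzweil_Integration.integral_nonneg)
  moreover have "(\<integral>\<^sup>+ s. indicator ?S s * ennreal (N (?f s)) \<partial>lborel) / ennreal \<bar>h\<bar> \<le> sup_avg N h t ?f"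
  proof (cases "h > 0")
    case True
    then show ?thesis unfolding sup_avg_def by (auto intro!: SUP_upper2[of h])
  next
    case False
    then have "h < 0" using h by simp
    then show ?thesis unfolding sup_avg_def by (auto simp: min_def max_def intro!: SUP_upper2[of h])
  qed
  ultimately show ?thesis by (simp add: mean_dev_def)
qed

lemma sup_avg_mono:
  assumes "0 < h" "h \<le> k"
  shows "sup_avg N h t f \<le> sup_avg N k t f"
proof -
  have "0 < k" using assms by simp
  show ?thesis
    unfolding sup_avg_def if_P[OF \<open>0 < h\<close>] if_P[OF \<open>0 < k\<close>]
    by (rule SUP_subset_mono) (use assms in auto)
qed

lemma sup_avg_mono_neg:
  assumes "h < 0" "k \<le> h"
  shows "sup_avg N h t f \<le> sup_avg N k t f"
proof -
  have "k < 0" "\<not> 0 < h" "\<not> 0 < k" using assms by auto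
  show ?thesis
    unfolding sup_avg_def if_not_P[OF \<open>\<not> 0 < h\<close>] if_not_P[OF \<open>\<not> 0 < k\<close>] if_P[OF \<open>h < 0\<close>] if_P[OF \<open>k < 0\<close>]
    by (rule SUP_subset_mono) (use assms in auto)
qed

lemma sup_avg_le_max:
  assumes "h \<noteq> 0" "t + h \<in> {a..b}"
  shows "sup_avg N h t f \<le> max (sup_avg N (b - t) t f) (sup_avg N (a - t) t f)"
proof (cases "h > 0")
  case True
  then have "sup_avg N h t f \<le> sup_avg N (b - t) t f" using assms by (intro sup_avg_mono) auto
  then show ?thesis by (rule max.coboundedI1)
next
  case False
  then have "sup_avg N h t f \<le> sup_avg N (a - t) t f" using assms by (intro sup_avg_mono_neg) auto
  then show ?thesis by (rule max.coboundedI2)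
qed

text \<open>The side of \<open>t\<close> is dictated by \<open>h\<close> because \<open>t\<close> may be an endpoint.\<close>
lemma approx_cont_good_set:
  assumes hor: "horizontal B W ups a b gam" and ab: "a < b" and ap: "approx_cont_at {a..b} (velocity a b gam) t"
    and h: "h \<noteq> 0" "t + h \<in> {a..b}" and "e > 0" "\<epsilon> > 0"
  obtains k X where "k \<noteq> 0" "t + k \<in> {a..b}" "X \<subseteq> seg t (t + k)" "X \<in> lmeasurable" 
    "measure lebesgue X \<ge> (1 - \<epsilon>) * \<bar>k\<bar>" "\<And>s. s \<in> X \<Longrightarrow> norm (velocity a b gam s - velocity a b gam t) \<le> e"
proof -
  let ?g = "velocity a b gam"
  let ?bad = "\<lambda>r. {s \<in> {a..b} \<inter> {t - r..t + r}. norm (?g s - ?g t) > e}"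
  have t: "t \<in> {a..b}" using ap unfolding approx_cont_at_def by (rule conjunct1)
  have "((\<lambda>r. measure lebesgue (?bad r) / (2 * r)) \<longlongrightarrow> 0) (at_right 0)"
    using ap \<open>e > 0\<close> unfolding approx_cont_at_def by blast
  \<comment> \<open>Density below \<epsilon> / 2 in the two-sided window of length 2 r leaves bad
    measure at most \<epsilon> r, the fraction \<epsilon> of a one-sided segment of length
    r.\<close>
  then have "eventually (\<lambda>r. measure lebesgue (?bad r) / (2 * r) < \<epsilon> / 2) (at_right 0)"
    by (rule order_tendstoD(2)) (use \<open>\<epsilon> > 0\<close> in simp)
  moreover have "eventually (\<lambda>r. r \<in> {0<..<\<bar>h\<bar>}) (at_right 0)"
    using h by (intro eventually_at_right_real) simp
  ultimately have "eventually (\<lambda>r. measure lebesgue (?bad r) / (2 * r) < \<epsilon> / 2 \<and> r \<in> {0<..<\<bar>h\<bar>}) (at_right 0)"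
    by (rule eventually_conj)
  then have "\<exists>r. measure lebesgue (?bad r) / (2 * r) < \<epsilon> / 2 \<and> r \<in> {0<..<\<bar>h\<bar>}"
    by (rule eventually_happens'[rotated]) simp
  then obtain r where r1: "measure lebesgue (?bad r) / (2 * r) < \<epsilon> / 2" and r0: "r \<in> {0<..<\<bar>h\<bar>}"
    by blast
  have r: "0 < r" "r < \<bar>h\<bar>" using r0 by simp_all
  have "m \<le> \<epsilon> * r" if "m / (2 * r) < \<epsilon> / 2" for m
    using that r(1) by (simp add: field_simps)
  from this[OF r1] have small: "measure lebesgue (?bad r) \<le> \<epsilon> * r" .
  define k where "k = sgn h * r"
  have absk: "\<bar>k\<bar> = r" using r h by (simp add: k_def abs_mult)
  have tk: "t + k \<in> {a..b}" using h r t by (cases "h > 0") (auto simp: k_def)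
  have segk: "seg t (t + k) \<subseteq> {a..b} \<inter> {t - r..t + r}" using tk t absk by auto
  define Z where "Z = ?bad r"
  have small: "measure lebesgue Z \<le> \<epsilon> * r" unfolding Z_def by (rule small)
  \<comment> \<open>For measurability the deviation is extended by 0 outside \<open>{a..b}\<close>;
    since e > 0 this adds no point.\<close>
  have bad_eq: "Z = {s \<in> space lebesgue. norm (indicator {a..b} s *\<^sub>R (?g s - ?g t)) > e} \<inter> {t - r..t + r}"
    using \<open>e > 0\<close> unfolding Z_def by (auto simp: indicator_def split: if_splits)
  have "(\<lambda>s. indicator {a..b} s *\<^sub>R (?g s - ?g t)) \<in> borel_measurable lebesgue"
    using velocity_diff_absolutely_integrable[OF hor ab order_refl, of "?g t"]
    unfolding set_integrable_def by (rule borel_measurable_integrable)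
  then have S: "{s \<in> space lebesgue. norm (indicator {a..b} s *\<^sub>R (?g s - ?g t)) > e} \<in> sets lebesgue"
    by measurable
  have bad: "Z \<in> lmeasurable"
  proof (rule fmeasurableI2)
    show "{t - r..t + r} \<in> lmeasurable" by simp
    show "Z \<subseteq> {t - r..t + r}" unfolding bad_eq by (rule Int_lower2)
    show "Z \<in> sets lebesgue" unfolding bad_eq by (rule sets.Int[OF S]) simp
  qed
  define X where "X = seg t (t + k) - Z"
  have X: "X \<in> lmeasurable" unfolding X_def using bad by (intro fmeasurable.Diff) auto
  have "measure lebesgue (seg t (t + k)) \<le> measure lebesgue (X \<union> Z)"
    using X bad by (intro measure_mono_fmeasurable) (auto simp: X_def intro: fmeasurable.Un)
  also have "\<dots> \<le> measure lebesgue X + measure lebesgue (Z)"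
    using X bad by (intro measure_Un_le) auto
  also have "measure lebesgue (Z) \<le> \<epsilon> * \<bar>k\<bar>"
    unfolding absk by (rule small)
  also have "measure lebesgue (seg t (t + k)) = \<bar>k\<bar>" by (auto simp: min_def max_def)
  finally have "(1 - \<epsilon>) * \<bar>k\<bar> \<le> measure lebesgue X" by (simp add: algebra_simps)
  moreover have "norm (?g s - ?g t) \<le> e" if "s \<in> X" for s
  proof (rule ccontr)
    assume *: "\<not> norm (?g s - ?g t) \<le> e"
    have "s \<in> {a..b} \<inter> {t - r..t + r}" using that segk unfolding X_def by blast
    with * have "s \<in> Z" unfolding Z_def by simp
    with that show False unfolding X_def by blast
  qed
  ultimately show thesis
    using X tk absk r by (intro that[of k X]) (auto simp: X_def)
qed

text \<open>Where the curve is not differentiable, \<^const>\<open>vector_derivative\<close> is an unspecified value, so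
  membership in the first layer has to come from approximate continuity.\<close>
lemma velocity_in_W1:
  assumes hor: "horizontal B W ups a b gam" and ab: "a < b" and ap: "approx_cont_at {a..b} (velocity a b gam) t"
    and h: "h \<noteq> 0" "t + h \<in> {a..b}"
  shows "velocity a b gam t \<in> W 1"
proof -
  let ?g = "velocity a b gam"
  obtain E where E: "negligible E" "\<And>s. s \<in> {a..b} - E \<Longrightarrow> ?g s \<in> W 1"
    using horizontal_velocity[OF hor ab] by metis
  have t: "t \<in> {a..b}" using ap unfolding approx_cont_at_def by (rule conjunct1)
  have "\<exists>y\<in>W 1. dist y (?g t) < e" if "e > 0" for e
  proof -
    obtain k X where X: "k \<noteq> 0" "t + k \<in> {a..b}" "X \<subseteq> seg t (t + k)" "X \<in> lmeasurable" 
      "measure lebesgue X \<ge> (1 - 1 / 2) * \<bar>k\<bar>" "\<And>s. s \<in> X \<Longrightarrow> norm (?g s - ?g t) \<le> e / 2"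
      using approx_cont_good_set[OF hor ab ap h, of "e / 2" "1 / 2"] \<open>e > 0\<close> by auto
    have "\<not> X \<subseteq> E"
    proof
      assume "X \<subseteq> E"
      then have "measure lebesgue X = 0" using E(1) negligible_subset negligible_imp_measure0 by blast
      then show False using X(1,5) by simp
    qed
    then obtain s where s: "s \<in> X" "s \<notin> E" by blast
    have "seg t (t + k) \<subseteq> {a..b}" using X(2) t by auto
    with s have "s \<in> {a..b}" using X(3) by blast
    then show ?thesis using E(2)[of s] s X(6)[of s] \<open>e > 0\<close> by (intro bexI[of _ "?g s"]) (auto simp: dist_norm)
  qed
  then have "?g t \<in> closure (W 1)" by (simp add: closure_approachable)
  then show ?thesis using closed_subspace[OF subspace_W[OF ups_pos]] by simp
qed

text \<open>Removes the norm of g1(t) from the estimate in favour of L_t. On a set filling the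
  fraction 1 - e of some segment, g1 has norm at least \<open>norm (g1 t) - e\<close>, so the mean
  there is at least (1 - e) times this; then e tends to 0.\<close>

lemma norm_velocity_le_sup_avg:
  assumes hor: "horizontal B W ups a b gam" and ab: "a < b" and ap: "approx_cont_at {a..b} (velocity a b gam) t"
    and h: "h \<noteq> 0" "t + h \<in> {a..b}"
    and c: "c > 0" "\<And>x. norm x \<le> c * N x"
    and l: "l \<ge> 0" "max (sup_avg N (b - t) t (velocity a b gam)) (sup_avg N (a - t) t (velocity a b gam)) = ennreal l"
  shows "norm (velocity a b gam t) \<le> c * l"
proof -
  let ?g = "velocity a b gam"
  let ?x = "norm (?g t)"
  have t: "t \<in> {a..b}" using ap unfolding approx_cont_at_def by (rule conjunct1)
  \<comment> \<open>The restriction e < \<open>?x\<close> keeps the lower bound nonnegative, so it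
    may be multiplied by the measure of X.\<close>
  have key: "(1 - e) * (?x - e) \<le> c * l" if e: "0 < e" "e < ?x" for e
  proof -
    obtain k X where X: "k \<noteq> 0" "t + k \<in> {a..b}" "X \<subseteq> seg t (t + k)" "X \<in> lmeasurable" 
      "measure lebesgue X \<ge> (1 - e) * \<bar>k\<bar>" "\<And>s. s \<in> X \<Longrightarrow> norm (?g s - ?g t) \<le> e"
      using approx_cont_good_set[OF hor ab ap h e(1) e(1)] by metis
    have seg: "seg t (t + k) \<subseteq> {a..b}" using X(2) t by auto
    let ?I = "integral (seg t (t + k)) (\<lambda>s. norm (?g s))"
    have int: "(\<lambda>s. norm (?g s)) integrable_on seg t (t + k)"
      using norm_velocity_diff_integrable[OF hor ab seg, of 0] by simp
    have XX: "X \<inter> seg t (t + k) = X" using X(3) by auto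
    have "((\<lambda>s. indicator X s) has_integral measure lebesgue X) (seg t (t + k))"
      using integral_indicator[of X "seg t (t + k)"] integrable_on_indicator[of X "seg t (t + k)"] X(4)
      by (simp add: XX has_integral_iff)
    then have hi: "((\<lambda>s. (?x - e) * indicator X s) has_integral (?x - e) * measure lebesgue X) (seg t (t + k))"
      by (rule has_integral_mult_right)
    have "(?x - e) * ((1 - e) * \<bar>k\<bar>) \<le> (?x - e) * measure lebesgue X"
      using X(5) e by (intro mult_left_mono) auto
    also have "\<dots> \<le> ?I"
    proof (rule has_integral_le[OF hi integrable_integral[OF int]])
      fix s
      show "(?x - e) * indicator X s \<le> norm (?g s)"
        using X(6)[of s] norm_triangle_ineq3[of "?g s" "?g t"] by (cases "s \<in> X") auto
    qed
    finally have "(1 - e) * (?x - e) \<le> ?I / \<bar>k\<bar>" using X(1) by (simp add: field_simps)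
    moreover have "ennreal (?I / \<bar>k\<bar> / c) \<le> sup_avg N k t ?g"
      using average_le_sup_avg[OF hor ab seg X(1) c, of 0] by (simp add: mean_dev_def)
    then have "ennreal (?I / \<bar>k\<bar> / c) \<le> ennreal l"
      unfolding l(2)[symmetric] by (rule order_trans) (rule sup_avg_le_max[OF X(1,2)])
    then have "?I / \<bar>k\<bar> / c \<le> l" using l(1) by (simp add: ennreal_le_iff)
    then have "?I / \<bar>k\<bar> \<le> c * l" by (simp only: pos_divide_le_eq[OF c(1)] mult.commute)
    ultimately show ?thesis by linarith
  qed
  show ?thesis
  proof (cases "?x = 0")
    case False
    have "((\<lambda>e. (1 - e) * (?x - e)) \<longlongrightarrow> (1 - 0) * (?x - 0)) (at_right 0)"
      by (intro tendsto_intros)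
    moreover have "eventually (\<lambda>e. (1 - e) * (?x - e) \<le> c * l) (at_right 0)"
    proof (rule eventually_mono)
      show "eventually (\<lambda>e. e \<in> {0<..<?x}) (at_right 0)"
        using False by (intro eventually_at_right_real) simp
    qed (use key in simp)
    ultimately have "(1 - 0) * (?x - 0) \<le> c * l"
      by (intro tendsto_upperbound[of _ _ "at_right (0::real)"]) auto
    then show ?thesis by simp
  qed (use c l in simp)
qed

lemma sup_avg_estimate:
  assumes "is_norm N"
  shows "\<exists>\<Upsilon> :: real \<Rightarrow> real. (\<forall>x\<ge>0. \<Upsilon> x \<ge> 0) \<and> mono_on {0..} \<Upsilon> \<and>
    (\<forall>a b gam t h. horizontal B W ups a b gam \<and> approx_cont_at {a..b} (velocity a b gam) t \<and> h \<noteq> 0 \<and> t + h \<in> {a..b} \<longrightarrow>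
       (let Lt = max (sup_avg N (b - t) t (velocity a b gam)) (sup_avg N (a - t) t (velocity a b gam)) in
        ennreal (N (\<delta> (1 / h) (- (h *\<^sub>R velocity a b gam t) \<odot> - gam t \<odot> gam (t + h))))
         \<le> (if Lt = \<infinity> then \<infinity> else ennreal (\<Upsilon> (enn2real Lt)))
           * sup_avg N h t (\<lambda>s. velocity a b gam s - velocity a b gam t)))"
proof -
  obtain c C' where c: "c > 0" "C' > 0" "\<And>x. norm x \<le> c * N x" "\<And>x. N x \<le> C' * norm x"
    using is_norm_equivalent[OF assms] by metis
  obtain C K where CK: "C \<ge> 0" "K \<ge> 0" and est: "\<forall>a b gam t h \<xi>. horizontal B W ups a b gam \<and> a < b \<and> t \<in> {a..b} \<and> t + h \<in> {a..b} \<and> h \<noteq> 0 \<and>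
       \<xi> \<in> W 1 \<longrightarrow>
       norm (\<delta> (1 / h) (- (h *\<^sub>R \<xi>) \<odot> - gam t \<odot> gam (t + h)))
         \<le> estimate C K ups (mean_dev a b gam t h \<xi>) (norm \<xi>) * mean_dev a b gam t h \<xi>"
    using curve_estimate by blast
  \<comment> \<open>2 c l bounds the mean deviation and c l the norm of g1(t). \<open>C'\<close>
    turns the Euclidean norm of the increment into \<open>N\<close>, and c bounds the mean deviation
    by the sup-average. The added 1 keeps \<Upsilon> positive, so that its product with an infinite
    average is \<infinity> and not 0.\<close>
  define \<Upsilon> where "\<Upsilon> l = C' * c * estimate C K ups (2 * c * l) (c * l) + 1" for l
  have \<Upsilon>_ge: "\<Upsilon> x \<ge> 1" if "x \<ge> 0" for x
    unfolding \<Upsilon>_def using c(1,2) CK that by (simp add: estimate_nonneg)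
  show ?thesis
  proof (intro exI[of _ \<Upsilon>] conjI allI impI; (elim conjE)?)
    show "\<Upsilon> x \<ge> 0" if "x \<ge> 0" for x using \<Upsilon>_ge[OF that] by simp
    show "mono_on {0..} \<Upsilon>"
    proof (rule mono_onI)
      fix x y :: real assume "x \<in> {0..}" "x \<le> y"
      then show "\<Upsilon> x \<le> \<Upsilon> y"
        unfolding \<Upsilon>_def using c(1,2) CK by (intro add_right_mono mult_left_mono estimate_mono) auto
    qed
    fix a b gam t h
    assume hor: "horizontal B W ups a b gam" and ap: "approx_cont_at {a..b} (velocity a b gam) t" 
      and h: "h \<noteq> 0" "t + h \<in> {a..b}"
    let ?g = "velocity a b gam"
    let ?e = "\<delta> (1 / h) (- (h *\<^sub>R ?g t) \<odot> - gam t \<odot> gam (t + h))"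
    define Lt where "Lt = max (sup_avg N (b - t) t ?g) (sup_avg N (a - t) t ?g)"
    define S where "S = sup_avg N h t (\<lambda>s. ?g s - ?g t)"
    define A where "A = mean_dev a b gam t h (?g t)"
    define L where "L = mean_dev a b gam t h 0"
    have t: "t \<in> {a..b}" using ap unfolding approx_cont_at_def by (rule conjunct1)
    have ab: "a < b" using t h by auto
    have sg: "seg t (t + h) \<subseteq> {a..b}" using t h by auto
    note int = norm_velocity_diff_integrable[OF hor ab sg]
    have A0: "A \<ge> 0"
      unfolding A_def by (rule mean_dev_nonneg[OF hor ab sg])
    have "N ?e \<le> C' * norm ?e" by (rule c(4))
    also have "\<dots> \<le> C' * (estimate C K ups A (norm (?g t)) * A)"
      unfolding A_def
      by (intro mult_left_mono est[rule_format] conjI hor ab t h velocity_in_W1[OF hor ab ap h]) (use c(2) in simp)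
    finally have Ne: "N ?e \<le> C' * (estimate C K ups A (norm (?g t)) * A)" .
    have AS: "ennreal (A / c) \<le> S"
      unfolding A_def S_def by (rule average_le_sup_avg[OF hor ab sg h(1) c(1,3)])
    have "ennreal (N ?e) \<le> (if Lt = \<infinity> then \<infinity> else ennreal (\<Upsilon> (enn2real Lt))) * S"
    proof (cases "Lt = \<infinity>")
      case True
      \<comment> \<open>not trivial, because \<open>\<infinity> * 0 = 0\<close> in \<^typ>\<open>ennreal\<close>\<close>
      show ?thesis
      proof (cases "S = 0")
        case S0: True
        then have "A / c \<le> 0" using AS by (simp add: ennreal_eq_0_iff)
        then have "A = 0" using A0 c(1) by (simp add: divide_le_0_iff)
        then have "ennreal (N ?e) = 0" using Ne by (simp add: ennreal_eq_0_iff)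
        then show ?thesis by simp
      next
        case False
        then show ?thesis using True by (simp add: ennreal_top_mult)
      qed
    next
      case False
      define l where "l = enn2real Lt"
      have l: "l \<ge> 0" "Lt = ennreal l" using False by (simp_all add: l_def top.not_eq_extremum)
      have x: "norm (?g t) \<le> c * l"
        by (rule norm_velocity_le_sup_avg[OF hor ab ap h c(1,3) l(1)]) (use l(2) Lt_def in simp)
      have "ennreal (L / c) \<le> ennreal l"
        unfolding l(2)[symmetric] Lt_def L_def
        using average_le_sup_avg[OF hor ab sg h(1) c(1,3), of 0] sup_avg_le_max[OF h, of N ?g]
        by simp
      then have "L / c \<le> l" using l(1) by (simp add: ennreal_le_iff)
      then have Ll: "L \<le> c * l" by (simp only: pos_divide_le_eq[OF c(1)] mult.commute)
      have "integral (seg t (t + h)) (\<lambda>s. norm (?g s - ?g t)) \<le> integral (seg t (t + h)) (\<lambda>s. norm (?g s) + norm (?g t))"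
        by (rule integral_le) (use int[of 0] int[of "?g t"] in \<open>auto intro!: integrable_add norm_triangle_ineq4\<close>)
      also have "\<dots> = integral (seg t (t + h)) (\<lambda>s. norm (?g s)) + \<bar>h\<bar> * norm (?g t)"
        using int[of 0] by (subst integral_add) (auto simp: min_def max_def)
      finally have "A \<le> (integral (seg t (t + h)) (\<lambda>s. norm (?g s)) + \<bar>h\<bar> * norm (?g t)) / \<bar>h\<bar>"
        unfolding A_def mean_dev_def by (rule divide_right_mono) simp
      also have "\<dots> = L + norm (?g t)" using h by (simp add: L_def mean_dev_def add_divide_distrib)
      finally have A2: "A \<le> 2 * c * l" using Ll x by simp
      show ?thesis
      proof (cases "S = \<infinity>")
        case True
        then show ?thesis using False \<Upsilon>_ge[OF l(1)] by (simp add: l_def ennreal_mult_top)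
      next
        case S: False
        define s where "s = enn2real S"
        have s: "s \<ge> 0" "S = ennreal s" using S by (simp_all add: s_def top.not_eq_extremum)
        have "A / c \<le> s" using AS s by (simp add: ennreal_le_iff)
        then have As: "A \<le> c * s" by (simp only: pos_divide_le_eq[OF c(1)] mult.commute)
        have "N ?e \<le> C' * (estimate C K ups (2 * c * l) (c * l) * (c * s))"
          using Ne A0 A2 As x CK c(1,2) l(1)
          by (elim order_trans) (intro mult_left_mono mult_mono estimate_mono estimate_nonneg; simp)
        also have "\<dots> \<le> \<Upsilon> l * s"
          using s(1) by (simp add: \<Upsilon>_def algebra_simps)
        finally have "ennreal (N ?e) \<le> ennreal (\<Upsilon> l * s)" by (rule ennreal_leI)
        also have "\<dots> = ennreal (\<Upsilon> l) * S" using \<Upsilon>_ge[OF l(1)] s by (simp add: ennreal_mult)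
        finally show ?thesis using False by (simp add: l_def)
      qed
    qed
    then show "let Lt = max (sup_avg N (b - t) t ?g) (sup_avg N (a - t) t ?g) in
        ennreal (N ?e) \<le> (if Lt = \<infinity> then \<infinity> else ennreal (\<Upsilon> (enn2real Lt)))
           * sup_avg N h t (\<lambda>s. ?g s - ?g t)"
      by (simp only: Lt_def S_def Let_def)
  qed
qed

section \<open>P-differentiability\<close>

lemma h_hom_line:
  assumes "\<xi> \<in> W 1"
  shows "h_hom B W ups (\<lambda>h. h *\<^sub>R \<xi>)"
  unfolding h_hom_def
  using dil_layer_1[OF assms] ups_pos
  by (simp add: bch_scaleR_same linear_scale[OF linear_dil])

text \<open>The differential is h \<mapsto> h g1(t). Left invariance moves the distance to one
  between \<open>e h\<close> and 0, homogeneity absorbs the division by |h|, and continuity of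
  \<rho> at (0, 0) turns the norm estimate into convergence.\<close>

lemma P_diff_at_lebesgue_point:
  assumes hor: "horizontal B W ups a b gam" and ab: "a < b" and t: "t \<in> {a..b}"
    and xi: "velocity a b gam t \<in> W 1" and \<rho>: "hom_dist B W ups \<rho>"
    and leb: "((\<lambda>h. mean_dev a b gam t h (velocity a b gam t)) \<longlongrightarrow> 0)
         (at 0 within {h. t + h \<in> {a..b}})"
  shows "P_diff_at B W ups \<rho> {a..b} gam t"
proof -
  let ?\<xi> = "velocity a b gam t" and ?F = "at 0 within {h. t + h \<in> {a..b}}"
  define A where "A h = mean_dev a b gam t h ?\<xi>" for h
  define e where "e h = - (h *\<^sub>R ?\<xi>) \<odot> - gam t \<odot> gam (t + h)" for h
  \<comment> \<open>\<rho> is homogeneous only under positive dilations, so w is scaled by 1 / |h|.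
    The estimate concerns 1 / h; for negative h the two differ by the fixed map \<delta> (-1), whose
    bound is M.\<close>
  define w where "w h = \<delta> (1 / \<bar>h\<bar>) (e h)" for h
  obtain C K where CK: "C \<ge> 0" "K \<ge> 0" and est: "\<forall>a b gam t h \<xi>. horizontal B W ups a b gam \<and> a < b \<and> t \<in> {a..b} \<and> t + h \<in> {a..b} \<and> h \<noteq> 0 \<and>
       \<xi> \<in> W 1 \<longrightarrow>
       norm (\<delta> (1 / h) (- (h *\<^sub>R \<xi>) \<odot> - gam t \<odot> gam (t + h)))
         \<le> estimate C K ups (mean_dev a b gam t h \<xi>) (norm \<xi>) * mean_dev a b gam t h \<xi>"
    using curve_estimate by blast
  obtain M where M: "\<And>x. norm (\<delta> (-1) x) \<le> norm x * M" "M > 0"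
    using bounded_linear.pos_bounded[OF bounded_linear_dil, of "-1"] by blast
  have lebA: "(A \<longlongrightarrow> 0) ?F" using leb by (simp add: A_def[abs_def])
  have dom: "eventually (\<lambda>h. h \<noteq> 0 \<and> t + h \<in> {a..b}) ?F"
    unfolding eventually_at by (intro exI[of _ 1]) auto
  \<comment> \<open>Once A h < 1, monotonicity of \<open>estimate\<close> replaces it by a constant
    independent of h.\<close>
  have small: "eventually (\<lambda>h. A h < 1) ?F"
    by (rule order_tendstoD(2)[OF lebA]) simp
  have "eventually (\<lambda>h. norm (w h) \<le> ((M + 1) * estimate C K ups 1 (norm ?\<xi>)) * A h) ?F"
    using eventually_conj[OF dom small]
  proof (rule eventually_mono, elim conjE)
    fix h assume h: "h \<noteq> 0" "t + h \<in> {a..b}" and A1: "A h < 1"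
    have sg: "seg t (t + h) \<subseteq> {a..b}" using t h by auto
    have A0: "A h \<ge> 0"
      unfolding A_def by (rule mean_dev_nonneg[OF hor ab sg])
    have "norm (w h) \<le> (M + 1) * norm (\<delta> (1 / h) (e h))"
    proof (cases "h > 0")
      case True
      then show ?thesis using M(2) by (simp add: w_def mult_le_cancel_right1)
    next
      case False
      then have "w h = \<delta> (-1) (\<delta> (1 / h) (e h))" by (simp add: w_def dil_dil)
      also have "norm \<dots> \<le> norm (\<delta> (1 / h) (e h)) * M" by (rule M(1))
      also have "\<dots> \<le> (M + 1) * norm (\<delta> (1 / h) (e h))" by (simp add: algebra_simps)
      finally show ?thesis .
    qed
    also have "\<dots> \<le> (M + 1) * (estimate C K ups (A h) (norm ?\<xi>) * A h)"
      unfolding A_def e_def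
      by (intro mult_left_mono est[rule_format] conjI hor ab t h xi) (use M(2) in simp)
    also have "\<dots> \<le> (M + 1) * (estimate C K ups 1 (norm ?\<xi>) * A h)"
      using A0 A1 M(2) CK by (intro mult_left_mono mult_right_mono estimate_mono) auto
    finally show "norm (w h) \<le> ((M + 1) * estimate C K ups 1 (norm ?\<xi>)) * A h"
      by (simp only: mult.assoc)
  qed
  moreover have "((\<lambda>h. ((M + 1) * estimate C K ups 1 (norm ?\<xi>)) * A h) \<longlongrightarrow> 0) ?F"
    using tendsto_mult_left[OF lebA] by simp
  ultimately have w0: "(w \<longlongrightarrow> 0) ?F"
    by (rule Lim_null_comparison)
  have refl0: "\<rho> 0 0 = 0" using \<rho> unfolding hom_dist_def by blast
  have "continuous_on UNIV (\<lambda>p. \<rho> (fst p) (snd p))" using \<rho> unfolding hom_dist_def by blast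
  then have cont: "isCont (\<lambda>p. \<rho> (fst p) (snd p)) (0, 0)"
    using continuous_on_eq_continuous_at open_UNIV by blast
  have "((\<lambda>h. (w h, 0)) \<longlongrightarrow> (0, 0)) ?F"
    by (intro tendsto_Pair w0 tendsto_const)
  from isCont_tendsto_compose[OF cont this] have "((\<lambda>h. \<rho> (w h) 0) \<longlongrightarrow> 0) ?F"
    by (simp only: fst_conv snd_conv refl0)
  moreover have "eventually (\<lambda>h. \<rho> (w h) 0 = \<rho> (- gam t \<odot> gam (t + h)) (h *\<^sub>R ?\<xi>) / \<bar>h\<bar>) ?F"
    using dom
  proof (rule eventually_mono, elim conjE)
    fix h assume h: "h \<noteq> 0" "t + h \<in> {a..b}"
    have inv: "\<rho> (z \<odot> x) (z \<odot> y) = \<rho> x y" for x y z using \<rho> unfolding hom_dist_def by blast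
    have hom: "\<rho> (\<delta> r x) (\<delta> r y) = r * \<rho> x y" if "r > 0" for r x y using \<rho> that unfolding hom_dist_def by blast
    have "\<rho> (w h) 0 = \<rho> (\<delta> (1 / \<bar>h\<bar>) (e h)) (\<delta> (1 / \<bar>h\<bar>) 0)"
      by (simp add: w_def linear_0[OF linear_dil])
    also have "\<dots> = (1 / \<bar>h\<bar>) * \<rho> (e h) 0" using h by (intro hom) simp
    also have "\<rho> (e h) 0 = \<rho> (- (h *\<^sub>R ?\<xi>) \<odot> (- gam t \<odot> gam (t + h))) (- (h *\<^sub>R ?\<xi>) \<odot> (h *\<^sub>R ?\<xi>))"
      by (simp only: e_def bch_assoc bch_uminus)
    also have "\<dots> = \<rho> (- gam t \<odot> gam (t + h)) (h *\<^sub>R ?\<xi>)" by (rule inv)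
    finally show "\<rho> (w h) 0 = \<rho> (- gam t \<odot> gam (t + h)) (h *\<^sub>R ?\<xi>) / \<bar>h\<bar>" by simp
  qed
  ultimately have "((\<lambda>h. \<rho> (- gam t \<odot> gam (t + h)) (h *\<^sub>R ?\<xi>) / \<bar>h\<bar>) \<longlongrightarrow> 0) ?F"
    by (rule Lim_transform_eventually)
  then show ?thesis
    unfolding P_diff_at_def using h_hom_line[OF xi] by blast
qed

lemma P_diff_ae:
  assumes hor: "horizontal B W ups a b gam" and \<rho>: "hom_dist B W ups \<rho>"
  shows "AE t in lborel. t \<in> {a..b} \<longrightarrow> P_diff_at B W ups \<rho> {a..b} gam t"
proof (cases "a < b")
  case True
  obtain E1 where E1: "negligible E1" "\<And>s. s \<in> {a..b} - E1 \<Longrightarrow> velocity a b gam s \<in> W 1"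
    using horizontal_velocity[OF hor True] by metis
  obtain E2 where E2: "negligible E2"
    "\<forall>t\<in>{a..b} - E2. ((\<lambda>h. mean_dev a b gam t h (velocity a b gam t)) \<longlongrightarrow> 0) (at 0 within {h. t + h \<in> {a..b}})"
    using lebesgue_point_ae[OF velocity_absolutely_integrable[OF hor True]] unfolding mean_dev_def by blast
  have "negligible (E1 \<union> E2)" using E1(1) E2(1) by (rule negligible_Un)
  then have "AE t in lebesgue. t \<notin> E1 \<union> E2"
    by (intro AE_not_in) (simp add: negligible_iff_null_sets)
  then have "AE t in lborel. t \<notin> E1 \<union> E2" by (simp only: AE_completion_iff)
  then show ?thesis
  proof (rule eventually_mono, intro impI)
    fix t assume t: "t \<notin> E1 \<union> E2" "t \<in> {a..b}"
    show "P_diff_at B W ups \<rho> {a..b} gam t"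
      by (rule P_diff_at_lebesgue_point[OF hor True t(2) E1(2) \<rho> E2(2)[rule_format]]) (use t in auto)
  qed
next
  case False
  \<comment> \<open>Here \<open>{a..b}\<close> is empty or the single point a.\<close>
  have "AE t in lborel. t \<noteq> a" by (rule AE_lborel_singleton)
  then show ?thesis by (rule eventually_mono) (use False in auto)
qed

end

theorem theorem4p6:
  fixes B :: "'a::euclidean_space \<Rightarrow> 'a \<Rightarrow> 'a" and W :: "nat \<Rightarrow> 'a set" and ups :: nat
    and N :: "'a \<Rightarrow> real"
  assumes "graded_lie_algebra B W ups" and "is_norm N"
  shows "(\<exists>\<Upsilon> :: real \<Rightarrow> real. (\<forall>x\<ge>0. \<Upsilon> x \<ge> 0) \<and> mono_on {0..} \<Upsilon> \<and>
    (\<forall>a b (gam :: real \<Rightarrow> 'a). horizontal B W ups a b gam \<longrightarrow>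
      (let g1 = (\<lambda>s. vector_derivative (\<lambda>r. proj W ups 1 (gam r)) (at s within {a..b})) in
       \<forall>t h. approx_cont_at {a..b} g1 t \<and> h \<noteq> 0 \<and> t + h \<in> {a..b} \<longrightarrow>
         (let Lt = max (sup_avg N (b - t) t g1) (sup_avg N (a - t) t g1) in
          ennreal (N (dil W ups (1 / h)
              (bch B ups (bch B ups (- (h *\<^sub>R g1 t)) (- gam t)) (gam (t + h)))))
          \<le> (if Lt = \<infinity> then \<infinity> else ennreal (\<Upsilon> (enn2real Lt)))
             * sup_avg N h t (\<lambda>s. g1 s - g1 t))))) \<and>
    (\<forall>a b (gam :: real \<Rightarrow> 'a). horizontal B W ups a b gam \<longrightarrow>
      (\<forall>\<rho>. hom_dist B W ups \<rho> \<longrightarrow>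
         (AE t in lborel. t \<in> {a..b} \<longrightarrow> P_diff_at B W ups \<rho> {a..b} gam t)))"
proof -
  interpret graded_lie B W ups by unfold_locales (rule assms(1))
  obtain \<Upsilon> :: "real \<Rightarrow> real" where \<Upsilon>: "\<forall>x\<ge>0. \<Upsilon> x \<ge> 0" "mono_on {0..} \<Upsilon>" and est:
    "\<forall>a b gam t h. horizontal B W ups a b gam \<and> approx_cont_at {a..b} (velocity a b gam) t \<and> h \<noteq> 0 \<and> t + h \<in> {a..b} \<longrightarrow>
       (let Lt = max (sup_avg N (b - t) t (velocity a b gam)) (sup_avg N (a - t) t (velocity a b gam)) in
        ennreal (N (\<delta> (1 / h) (- (h *\<^sub>R velocity a b gam t) \<odot> - gam t \<odot> gam (t + h))))
         \<le> (if Lt = \<infinity> then \<infinity> else ennreal (\<Upsilon> (enn2real Lt)))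
           * sup_avg N h t (\<lambda>s. velocity a b gam s - velocity a b gam t))"
    using sup_avg_estimate[OF assms(2)] by blast
  show ?thesis
  proof (intro conjI exI[of _ \<Upsilon>] allI impI)
    show "mono_on {0..} \<Upsilon>" by (rule \<Upsilon>(2))
    show "\<Upsilon> x \<ge> 0" if "x \<ge> 0" for x using \<Upsilon>(1) that by blast
    fix a b and gam :: "real \<Rightarrow> 'a" assume hor: "horizontal B W ups a b gam"
    show "AE t in lborel. t \<in> {a..b} \<longrightarrow> P_diff_at B W ups \<rho> {a..b} gam t" if "hom_dist B W ups \<rho>" for \<rho>
      by (rule P_diff_ae[OF hor that])
    have vel: "(\<lambda>s. vector_derivative (\<lambda>r. proj W ups 1 (gam r)) (at s within {a..b})) = velocity a b gam"
      by (simp only: velocity_def[abs_def])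
    show "let g1 = (\<lambda>s. vector_derivative (\<lambda>r. proj W ups 1 (gam r)) (at s within {a..b})) in
       \<forall>t h. approx_cont_at {a..b} g1 t \<and> h \<noteq> 0 \<and> t + h \<in> {a..b} \<longrightarrow>
         (let Lt = max (sup_avg N (b - t) t g1) (sup_avg N (a - t) t g1) in
          ennreal (N (dil W ups (1 / h)
              (bch B ups (bch B ups (- (h *\<^sub>R g1 t)) (- gam t)) (gam (t + h)))))
          \<le> (if Lt = \<infinity> then \<infinity> else ennreal (\<Upsilon> (enn2real Lt)))
             * sup_avg N h t (\<lambda>s. g1 s - g1 t))"
      unfolding vel Let_def[of "velocity a b gam"] using est hor by blast
  qed
qed

end
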